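(* Let $\hat\pi\in(0,1)$ and $c>0$. Put $\Psi(x)=2c(1-2x)\log\frac{x}{1-x}$ for $x\in(0,1)$, so that $$\Psi'(x)=2c\left[\frac{2x-2(x-1)x\log\left(\frac{x}{1-x}\right)-1}{(x-1)x}\right],$$ and set $\overline A=-\Psi'(\hat\pi)$. Let $\pi^*\in(\hat\pi,1)$ be the unique point with $\Psi'(\pi^* )+\overline A=-1$, let $\overline B$ be determined by $1-\pi^*=\Psi(\pi^* )+\overline A\pi^*+\overline B$, and define $f:[\hat\pi,1]\to\mathbb R$ by $$f(x)=\begin{cases}2c(1-2x)\log\frac{x}{1-x}+\overline Ax+\overline B,&\hat\pi\le x\le\pi^*,\\ 1-x,&\pi^*\le x\le1.\end{cases}$$ For $x\in[\hat\pi,1]$ let $$V^r_{\hat\pi}(x)=\inf_{\tau\in\mathcal T}E_x\left[c\tau+(1-\pi^r_\tau)\right].$$ Then $V^r_{\hat\pi}(x)=f(x)$ for all $x\in[\hat\pi,1]$.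
   Context: $W$ is a standard Brownian motion, $\mathbb F$ the filtration it generates and $\mathcal T$ the set of $\mathbb F$-stopping times. The process $\pi^r$ is the diffusion with reflecting boundary at $\hat\pi$: $\pi^r\ge\hat\pi$ and $$d\pi^r_t=\pi^r_t(1-\pi^r_t)\,dW_t+dA_t,$$ where $A$ is continuous, non-decreasing, $A_0=0$, and $A$ is flat off $\{\pi^r=\hat\pi\}$ (i.e. $\int_0^\infty(\pi^r_s-\hat\pi)\,dA_s=0$). $E_x$ denotes expectation under $P_x$, for which $P_x(\pi^r_0=x)=1$. The cost of a stopping time with $E_x[\tau]=\infty$ is $+\infty$. *)

theory Defs
  imports "HOL-Probability.Probability"
begin

section \<open>Brownian motion and the filtration it generates\<close>

text \<open>
  Processes are functions of a real time \<open>t \<ge> 0\<close>; their values at negative times are irrelevant.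
  Filtrations are indexed by \<open>ennreal\<close>, so that the library's \<^const>\<open>stopping_time\<close>
  (whose index type is the type of the values of the random time) admits the value \<open>\<infinity>\<close>.
\<close>

text \<open>
  The filtration generated by \<open>W\<close>, with the usual augmentation by the null sets of \<open>M\<close>.
\<close>

definition generated_filtration ::
  "'a measure \<Rightarrow> (real \<Rightarrow> 'a \<Rightarrow> real) \<Rightarrow> ennreal \<Rightarrow> 'a measure" where
  "generated_filtration M W u =
     sigma (space M)
       ({W s -` B \<inter> space M | s B. 0 \<le> s \<and> ennreal s \<le> u \<and> B \<in> sets borel} \<union> null_sets M)"

definition adapted_process ::
  "(ennreal \<Rightarrow> 'a measure) \<Rightarrow> (real \<Rightarrow> 'a \<Rightarrow> real) \<Rightarrow> bool" where
  "adapted_process F X \<longleftrightarrow> (\<forall>t\<ge>0. X t \<in> borel_measurable (F (ennreal t)))"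

definition continuous_paths ::
  "'a measure \<Rightarrow> (real \<Rightarrow> 'a \<Rightarrow> real) \<Rightarrow> bool" where
  "continuous_paths M X \<longleftrightarrow> (\<forall>\<omega>\<in>space M. continuous_on {0..} (\<lambda>t. X t \<omega>))"

definition standard_brownian_motion ::
  "'a measure \<Rightarrow> (ennreal \<Rightarrow> 'a measure) \<Rightarrow> (real \<Rightarrow> 'a \<Rightarrow> real) \<Rightarrow> bool" where
  "standard_brownian_motion M F W \<longleftrightarrow>
     prob_space M \<and>
     (\<forall>t\<ge>0. W t \<in> borel_measurable M) \<and>
     adapted_process F W \<and>
     continuous_paths M W \<and>
     (AE \<omega> in M. W 0 \<omega> = 0) \<and>
     (\<forall>s t. 0 \<le> s \<and> s < t \<longrightarrow>
        distributed M lborel (\<lambda>\<omega>. W t \<omega> - W s \<omega>) (\<lambda>y. ennreal (normal_density 0 (sqrt (t - s)) y)) \<and>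
        prob_space.indep_set M (sets (F (ennreal s)))
          (sets (vimage_algebra (space M) (\<lambda>\<omega>. W t \<omega> - W s \<omega>) borel)))"


section \<open>The Ito integral\<close>

text \<open>
  A simple integrand \<open>\<Sum>i<n. \<xi>\<^sub>i 1\<^bsub>(p\<^sub>i, p\<^sub>i\<^sub>+\<^sub>1]\<^esub>\<close> is given by the triple \<open>(n, p, \<xi>)\<close>.
\<close>

definition simple_integrand ::
  "'a measure \<Rightarrow> (ennreal \<Rightarrow> 'a measure) \<Rightarrow> nat \<Rightarrow> (nat \<Rightarrow> real) \<Rightarrow> (nat \<Rightarrow> 'a \<Rightarrow> real) \<Rightarrow> bool" where
  "simple_integrand M F n p \<xi> \<longleftrightarrow>
     0 \<le> p 0 \<and> (\<forall>i<n. p i \<le> p (Suc i)) \<and>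
     (\<forall>i<n. \<xi> i \<in> borel_measurable (F (ennreal (p i)))) \<and>
     (\<exists>C. \<forall>i<n. \<forall>\<omega>\<in>space M. \<bar>\<xi> i \<omega>\<bar> \<le> C)"

definition simple_process ::
  "nat \<Rightarrow> (nat \<Rightarrow> real) \<Rightarrow> (nat \<Rightarrow> 'a \<Rightarrow> real) \<Rightarrow> real \<Rightarrow> 'a \<Rightarrow> real" where
  "simple_process n p \<xi> s \<omega> = (\<Sum>i<n. \<xi> i \<omega> * indicator {p i<..p (Suc i)} s)"

definition simple_ito_integral ::
  "(real \<Rightarrow> 'a \<Rightarrow> real) \<Rightarrow> nat \<Rightarrow> (nat \<Rightarrow> real) \<Rightarrow> (nat \<Rightarrow> 'a \<Rightarrow> real) \<Rightarrow> real \<Rightarrow> 'a \<Rightarrow> real" where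
  "simple_ito_integral W n p \<xi> t \<omega> =
     (\<Sum>i<n. \<xi> i \<omega> * (W (min (p (Suc i)) t) \<omega> - W (min (p i) t) \<omega>))"

definition progressively_measurable ::
  "(ennreal \<Rightarrow> 'a measure) \<Rightarrow> (real \<Rightarrow> 'a \<Rightarrow> real) \<Rightarrow> bool" where
  "progressively_measurable F H \<longleftrightarrow>
     (\<forall>t\<ge>0. (\<lambda>(s, \<omega>). H s \<omega>)
        \<in> borel_measurable (restrict_space borel {0..t} \<Otimes>\<^sub>M F (ennreal t)))"

text \<open>
  \<open>Y\<close> is (a version of) \<open>\<integral>\<^sub>0\<^sup>t H\<^sub>s dW\<^sub>s\<close>: the mean-square limit of the integrals of simple
  integrands that approximate \<open>H\<close> in mean square on \<open>[0, t]\<close>. The approximation condition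
  entails \<open>E \<integral>\<^sub>0\<^sup>t H\<^sub>s\<^sup>2 ds < \<infinity>\<close>.
\<close>

definition has_ito_integral ::
  "'a measure \<Rightarrow> (ennreal \<Rightarrow> 'a measure) \<Rightarrow> (real \<Rightarrow> 'a \<Rightarrow> real) \<Rightarrow> (real \<Rightarrow> 'a \<Rightarrow> real) \<Rightarrow>
     real \<Rightarrow> ('a \<Rightarrow> real) \<Rightarrow> bool" where
  "has_ito_integral M F W H t Y \<longleftrightarrow>
     progressively_measurable F H \<and> Y \<in> borel_measurable M \<and>
     (\<exists>n p \<xi>.
        (\<forall>k. simple_integrand M F (n k) (p k) (\<xi> k)) \<and>
        (\<lambda>k. \<integral>\<^sup>+\<omega>. (\<integral>\<^sup>+s\<in>{0..t}.
            ennreal ((H s \<omega> - simple_process (n k) (p k) (\<xi> k) s \<omega>)\<^sup>2) \<partial>lborel) \<partial>M)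
          \<longlonglongrightarrow> 0 \<and>
        (\<lambda>k. \<integral>\<^sup>+\<omega>. ennreal ((Y \<omega> - simple_ito_integral W (n k) (p k) (\<xi> k) t \<omega>)\<^sup>2) \<partial>M)
          \<longlonglongrightarrow> 0)"


section \<open>The reflecting diffusion and its stopping problem\<close>

text \<open>
  \<open>X\<close> starts at \<open>x\<close> and solves \<open>dX = X (1 - X) dW + dA\<close> with reflection at \<open>b\<close>. In the flatness
  condition \<open>dA\<close> is the Lebesgue--Stieltjes measure of the path of \<open>A\<close>, which is continued
  to negative times by its value at \<open>0\<close>.
\<close>

definition reflecting_diffusion ::
  "'a measure \<Rightarrow> (real \<Rightarrow> 'a \<Rightarrow> real) \<Rightarrow> real \<Rightarrow> (real \<Rightarrow> 'a \<Rightarrow> real) \<Rightarrow> (real \<Rightarrow> 'a \<Rightarrow> real) \<Rightarrow>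
     real \<Rightarrow> bool" where
  "reflecting_diffusion M W b X A x \<longleftrightarrow>
     (let F = generated_filtration M W in
       standard_brownian_motion M F W \<and>
       adapted_process F X \<and> continuous_paths M X \<and>
       adapted_process F A \<and> continuous_paths M A \<and>
       (AE \<omega> in M. X 0 \<omega> = x) \<and>
       (AE \<omega> in M. \<forall>t\<ge>0. b \<le> X t \<omega>) \<and>
       (AE \<omega> in M. A 0 \<omega> = 0) \<and>
       (AE \<omega> in M. mono_on {0..} (\<lambda>t. A t \<omega>)) \<and>
       (AE \<omega> in M.
          (\<integral>\<^sup>+s\<in>{0..}. ennreal (X s \<omega> - b) \<partial>interval_measure (\<lambda>s. A (max 0 s) \<omega>)) = 0) \<and>
       (\<forall>t\<ge>0. has_ito_integral M F W (\<lambda>s \<omega>. X s \<omega> * (1 - X s \<omega>)) t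
                 (\<lambda>\<omega>. X t \<omega> - X 0 \<omega> - A t \<omega>)))"

text \<open>
  If \<open>\<tau>\<close> has finite mean it is almost surely finite, so in the second case the value of
  \<^const>\<open>enn2real\<close> at \<open>\<infinity>\<close> does not matter.
\<close>

definition expected_cost ::
  "'a measure \<Rightarrow> (real \<Rightarrow> 'a \<Rightarrow> real) \<Rightarrow> real \<Rightarrow> ('a \<Rightarrow> ennreal) \<Rightarrow> ereal" where
  "expected_cost M X c \<tau> =
     (if (\<integral>\<^sup>+\<omega>. \<tau> \<omega> \<partial>M) = \<infinity> then \<infinity>
      else ereal (\<integral>\<omega>. c * enn2real (\<tau> \<omega>) + (1 - X (enn2real (\<tau> \<omega>)) \<omega>) \<partial>M))"

definition reflected_value ::
  "(real \<Rightarrow> 'a measure) \<Rightarrow> (real \<Rightarrow> 'a \<Rightarrow> real) \<Rightarrow> (real \<Rightarrow> 'a \<Rightarrow> real) \<Rightarrow> real \<Rightarrow> real \<Rightarrow> ereal" where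
  "reflected_value P W X c x =
     (INF \<tau>\<in>{\<tau>. stopping_time (generated_filtration (P x) W) \<tau>}. expected_cost (P x) X c \<tau>)"


section \<open>The candidate value function\<close>

definition Psi :: "real \<Rightarrow> real \<Rightarrow> real" where
  "Psi c x = 2 * c * (1 - 2 * x) * ln (x / (1 - x))"

definition A_bar :: "real \<Rightarrow> real \<Rightarrow> real" where
  "A_bar c b = - deriv (Psi c) b"

definition pi_star :: "real \<Rightarrow> real \<Rightarrow> real" where
  "pi_star c b = (THE p. p \<in> {b<..<1} \<and> deriv (Psi c) p + A_bar c b = -1)"

definition B_bar :: "real \<Rightarrow> real \<Rightarrow> real" where
  "B_bar c b = 1 - pi_star c b - Psi c (pi_star c b) - A_bar c b * pi_star c b"

definition f_cand :: "real \<Rightarrow> real \<Rightarrow> real \<Rightarrow> real" where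
  "f_cand c b x =
     (if x \<le> pi_star c b
      then 2 * c * (1 - 2 * x) * ln (x / (1 - x)) + A_bar c b * x + B_bar c b
      else 1 - x)"

end

theory Submission
  imports Defs
begin

text \<open>
  The function \<open>f\<close> is \<open>C\<^sup>1\<close> and concave with \<open>f' (\<pi>\<^sub>0) = 0\<close> at the reflecting boundary \<open>\<pi>\<^sub>0\<close>, it lies
  below \<open>1 - x\<close>, and \<open>L f = - c\<close> on the continuation region while \<open>L f \<ge> - c\<close> elsewhere, where
  \<open>L f (x) = x\<^sup>2 (1 - x)\<^sup>2 f'' (x) / 2\<close>. By Ito's formula \<open>f (X\<^sub>t) + c t\<close> is therefore a submartingale, the
  reflection term vanishing because \<open>f' (\<pi>\<^sub>0) = 0\<close>; this gives the lower bound. Up to the first time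
  that \<open>X\<close> reaches \<open>\<pi>\<^sup>*\<close> it is a martingale, so that time attains the bound.

  Ito's formula is only needed in mean and at bounded stopping times. It is obtained by expanding \<open>f (X)\<close> to
  second order along uniform grids, using the martingale property and the conditional isometry of the
  stochastic integral. Continuing \<open>f\<close> by \<open>1 - x\<close> beyond \<open>1\<close> makes a proof of \<open>X \<le> 1\<close> unnecessary; the
  integrability of \<open>X\<close> comes from Doob's inequality and from Fatou's lemma applied to \<open>1 - \<pi>\<^sub>0 - f (X)\<close>.
\<close>

section \<open>Moments of Brownian increments\<close>

text \<open>\<open>Psi\<close> is a particular solution of \<open>L u = - c\<close>, and
  \<open>L\<close> annihilates affine functions. \<open>A_bar\<close> is fixed by the zero slope at
  the reflecting boundary, \<open>pi_star\<close> by smooth fit with slope -1, \<open>B_bar\<close>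
  by continuity there. The obstacle is that the stochastic integral is given only as a mean-square
  limit, for each time separately, and its integrand \<open>X (1 - X)\<close> comes without a bound.
  Everything is therefore stated in mean, against bounded weights known at the left end of an
  increment. First-order terms then have mean zero and second-order terms become time integrals by
  isometry. The hard term is the remainder, a vanishing weight times squared increments whose sums
  are bounded only in mean; it vanishes because the squared increments are uniformly integrable. The
  expansion asks for a Lipschitz second derivative, whereas \<open>f''\<close> jumps at
  \<open>pi_star\<close>. Hence \<open>f\<close> is replaced by smoother test functions below
  \<open>1 - x\<close>, which fall below \<open>f\<close> by an arbitrarily small amount on
  \<open>[b, 1]\<close> and agree with it up to \<open>pi_star\<close>.\<close>

locale brownian_filtration = prob_space M + filtration "space M" F
  for M :: "'a measure" and F :: "ennreal \<Rightarrow> 'a measure" +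
  fixes W :: "real \<Rightarrow> 'a \<Rightarrow> real"
  assumes sets_F_le: "sets (F u) \<subseteq> sets M"
    and bm: "standard_brownian_motion M F W"
begin

text \<open>These test variables stand in for conditional expectation: an identity given the past at
  \<open>s\<close> is expressed as an equality of means after multiplication by every such
  weight.\<close>

definition bounded_at :: "real \<Rightarrow> ('a \<Rightarrow> real) \<Rightarrow> bool" where
  "bounded_at s \<zeta> \<longleftrightarrow> \<zeta> \<in> borel_measurable (F (ennreal s)) \<and> (\<exists>C. \<forall>\<omega>\<in>space M. \<bar>\<zeta> \<omega>\<bar> \<le> C)"

lemma measurable_F_M: "\<zeta> \<in> measurable (F u) N \<Longrightarrow> \<zeta> \<in> measurable M N"
  using sets_F_le[of u] space_F[of u] by (auto simp: measurable_def)

lemma measurable_F_mono: "u \<le> v \<Longrightarrow> \<zeta> \<in> measurable (F u) N \<Longrightarrow> \<zeta> \<in> measurable (F v) N"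
  using sets_F_mono[of u v] space_F[of u] space_F[of v] by (auto simp: measurable_def)

lemma bounded_at_mono: "bounded_at s \<zeta> \<Longrightarrow> s \<le> t \<Longrightarrow> bounded_at t \<zeta>"
  unfolding bounded_at_def using measurable_F_mono[of "ennreal s" "ennreal t" \<zeta>]
  by (auto intro: ennreal_leI)

lemma bounded_at_measurable: "bounded_at s \<zeta> \<Longrightarrow> \<zeta> \<in> borel_measurable M"
  unfolding bounded_at_def using measurable_F_M by blast

lemma bounded_at_bound:
  assumes "bounded_at s \<zeta>"
  obtains C where "C \<ge> 0" "\<And>\<omega>. \<omega> \<in> space M \<Longrightarrow> \<bar>\<zeta> \<omega>\<bar> \<le> C"
proof -
  from assms obtain C where "\<forall>\<omega>\<in>space M. \<bar>\<zeta> \<omega>\<bar> \<le> C" unfolding bounded_at_def by blast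
  then show ?thesis by (intro that[of "max 0 C"]) (auto simp: le_max_iff_disj)
qed

lemma bounded_at_const: "bounded_at s (\<lambda>_. k)"
  unfolding bounded_at_def by auto

lemma bounded_at_mult:
  assumes "bounded_at s \<zeta>" "bounded_at s \<xi>"
  shows "bounded_at s (\<lambda>\<omega>. \<zeta> \<omega> * \<xi> \<omega>)"
proof -
  obtain C where C: "C \<ge> 0" "\<And>\<omega>. \<omega> \<in> space M \<Longrightarrow> \<bar>\<zeta> \<omega>\<bar> \<le> C"
    using bounded_at_bound[OF assms(1)] by blast
  obtain D where D: "D \<ge> 0" "\<And>\<omega>. \<omega> \<in> space M \<Longrightarrow> \<bar>\<xi> \<omega>\<bar> \<le> D"
    using bounded_at_bound[OF assms(2)] by blast
  have "\<bar>\<zeta> \<omega> * \<xi> \<omega>\<bar> \<le> C * D" if "\<omega> \<in> space M" for \<omega>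
    unfolding abs_mult using C D that by (intro mult_mono) auto
  with assms show ?thesis unfolding bounded_at_def by auto
qed

lemma integrable_bounded_mult:
  fixes g :: "'a \<Rightarrow> real"
  assumes "bounded_at s \<zeta>" "integrable M g"
  shows "integrable M (\<lambda>\<omega>. \<zeta> \<omega> * g \<omega>)"
proof -
  obtain C where C: "C \<ge> 0" "\<And>\<omega>. \<omega> \<in> space M \<Longrightarrow> \<bar>\<zeta> \<omega>\<bar> \<le> C"
    using bounded_at_bound[OF assms(1)] by blast
  show ?thesis
  proof (rule Bochner_Integration.integrable_bound[where f="\<lambda>\<omega>. C * \<bar>g \<omega>\<bar>"])
    show "(\<lambda>\<omega>. \<zeta> \<omega> * g \<omega>) \<in> borel_measurable M"
      using bounded_at_measurable[OF assms(1)] assms(2) by auto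
    show "AE \<omega> in M. norm (\<zeta> \<omega> * g \<omega>) \<le> norm (C * \<bar>g \<omega>\<bar>)"
      using C by (intro AE_I2) (auto simp: abs_mult intro!: mult_right_mono)
  qed (use assms in auto)
qed

lemma bounded_at_integrable: "bounded_at s \<zeta> \<Longrightarrow> integrable M \<zeta>"
  using integrable_bounded_mult[of s \<zeta> "\<lambda>_. 1"] by simp

lemma W_measurable: "0 \<le> t \<Longrightarrow> W t \<in> borel_measurable M"
  and W_adapted: "0 \<le> t \<Longrightarrow> W t \<in> borel_measurable (F (ennreal t))"
  using bm unfolding standard_brownian_motion_def adapted_process_def by auto

text \<open>The power is carried along so that one independence statement serves the first and the
  second moment of an increment.\<close>

lemma increment_indep:
  assumes "0 \<le> s" "s < t" "\<zeta> \<in> borel_measurable (F (ennreal s))"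
  shows "indep_var borel \<zeta> borel (\<lambda>\<omega>. (W t \<omega> - W s \<omega>) ^ k)"
proof -
  have "indep_set (sets (F (ennreal s)))
          (sets (vimage_algebra (space M) (\<lambda>\<omega>. W t \<omega> - W s \<omega>) borel))"
    using bm assms unfolding standard_brownian_motion_def by blast
  then have "indep_sets (case_bool (sets (F (ennreal s)))
          (sets (vimage_algebra (space M) (\<lambda>\<omega>. W t \<omega> - W s \<omega>) borel))) UNIV"
    unfolding indep_set_def .
  then have *: "indep_set {\<zeta> -` A \<inter> space M |A. A \<in> sets borel}
     {(\<lambda>\<omega>. (W t \<omega> - W s \<omega>) ^ k) -` A \<inter> space M |A. A \<in> sets borel}"
    unfolding indep_set_def
  proof (rule indep_sets_mono_sets)
    fix i :: bool
    have "\<zeta> -` A \<inter> space M \<in> sets (F (ennreal s))" if "A \<in> sets borel" for A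
      using measurable_sets[OF assms(3) that] by (simp add: space_F)
    moreover have "(\<lambda>\<omega>. (W t \<omega> - W s \<omega>) ^ k) -` A \<inter> space M
        \<in> sets (vimage_algebra (space M) (\<lambda>\<omega>. W t \<omega> - W s \<omega>) borel)" if "A \<in> sets borel" for A
    proof -
      have "(\<lambda>x::real. x ^ k) -` A \<inter> space borel \<in> sets borel"
        using that by (intro measurable_sets[of _ borel borel]) auto
      moreover have "(\<lambda>\<omega>. (W t \<omega> - W s \<omega>) ^ k) -` A \<inter> space M =
          (\<lambda>\<omega>. W t \<omega> - W s \<omega>) -` ((\<lambda>x::real. x ^ k) -` A \<inter> space borel) \<inter> space M"
        by auto
      ultimately show ?thesis by (auto intro: in_vimage_algebra)
    qed
    ultimately show "(case i of True \<Rightarrow> {\<zeta> -` A \<inter> space M |A. A \<in> sets borel}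
       | False \<Rightarrow> {(\<lambda>\<omega>. (W t \<omega> - W s \<omega>) ^ k) -` A \<inter> space M |A. A \<in> sets borel})
      \<subseteq> (case i of True \<Rightarrow> sets (F (ennreal s))
       | False \<Rightarrow> sets (vimage_algebra (space M) (\<lambda>\<omega>. W t \<omega> - W s \<omega>) borel))"
      by (auto split: bool.split)
  qed
  have m: "\<zeta> \<in> borel_measurable M" "(\<lambda>\<omega>. (W t \<omega> - W s \<omega>) ^ k) \<in> borel_measurable M"
    using assms W_measurable measurable_F_M by (auto intro!: borel_measurable_power borel_measurable_diff)
  \<comment> \<open>The preimages of Borel sets already form a sigma-algebra, so the generated
    sigma-algebras in \<open>indep_var_eq\<close> are the two families treated above.\<close>
  have st: "sigma_sets (space M) {f -` A \<inter> space M |A. A \<in> sets borel} = {f -` A \<inter> space M |A. A \<in> sets borel}"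
    for f :: "'a \<Rightarrow> real"
    using sets.sigma_sets_eq[of "vimage_algebra (space M) f borel"] sets_vimage_algebra2[of f "space M" borel]
    by simp
  show ?thesis unfolding indep_var_eq using m * by (simp add: st)
qed

lemma increment_moment:
  assumes "0 \<le> s" "s < t"
  shows "integrable M (\<lambda>\<omega>. (W t \<omega> - W s \<omega>) ^ k)"
    and "expectation (\<lambda>\<omega>. (W t \<omega> - W s \<omega>) ^ k) =
      (\<integral>y. normal_density 0 (sqrt (t - s)) y * y ^ k \<partial>lborel)"
proof -
  have D: "distributed M lborel (\<lambda>\<omega>. W t \<omega> - W s \<omega>) (\<lambda>y. ennreal (normal_density 0 (sqrt (t - s)) y))"
    using bm assms unfolding standard_brownian_motion_def by blast
  have "0 < sqrt (t - s)" using assms by simp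
  from integrable_normal_moment[OF this, of 0 k]
  show "integrable M (\<lambda>\<omega>. (W t \<omega> - W s \<omega>) ^ k)"
    by (subst distributed_integrable[OF D, symmetric]) auto
  show "expectation (\<lambda>\<omega>. (W t \<omega> - W s \<omega>) ^ k) =
      (\<integral>y. normal_density 0 (sqrt (t - s)) y * y ^ k \<partial>lborel)"
    by (subst distributed_integral[OF D]) auto
qed

lemma increment_moment_1: "0 \<le> s \<Longrightarrow> s < t \<Longrightarrow> expectation (\<lambda>\<omega>. W t \<omega> - W s \<omega>) = 0"
  and increment_moment_2: "0 \<le> s \<Longrightarrow> s < t \<Longrightarrow> expectation (\<lambda>\<omega>. (W t \<omega> - W s \<omega>)\<^sup>2) = t - s"
  and increment_moment_4: "0 \<le> s \<Longrightarrow> s < t \<Longrightarrow> expectation (\<lambda>\<omega>. (W t \<omega> - W s \<omega>)^4) = 3 * (t - s)\<^sup>2"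
proof -
  assume st: "0 \<le> s" "s < t"
  then have p: "0 < sqrt (t - s)" by simp
  show "expectation (\<lambda>\<omega>. W t \<omega> - W s \<omega>) = 0"
    using increment_moment(2)[OF st, of 1] integral_normal_moment_odd[OF p, of 0 0] by simp
  show "expectation (\<lambda>\<omega>. (W t \<omega> - W s \<omega>)\<^sup>2) = t - s"
    using increment_moment(2)[OF st, of 2] integral_normal_moment_even[OF p, of 0 1] st
    by simp
  show "expectation (\<lambda>\<omega>. (W t \<omega> - W s \<omega>)^4) = 3 * (t - s)\<^sup>2"
    using increment_moment(2)[OF st, of 4] integral_normal_moment_even[OF p, of 0 2] st
    by (simp add: fact_numeral power_divide)
qed

lemma increment_power_integrable:
  assumes "0 \<le> s" "s \<le> t"
  shows "integrable M (\<lambda>\<omega>. (W t \<omega> - W s \<omega>) ^ k)"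
  using assms increment_moment(1)[of s t k] by (cases "s = t") (auto simp: power_0_left)

lemma increment_mult:
  assumes "0 \<le> s" "s \<le> t" "\<zeta> \<in> borel_measurable (F (ennreal s))" "integrable M \<zeta>" "0 < k"
  shows "integrable M (\<lambda>\<omega>. \<zeta> \<omega> * (W t \<omega> - W s \<omega>) ^ k)"
    and "expectation (\<lambda>\<omega>. \<zeta> \<omega> * (W t \<omega> - W s \<omega>) ^ k) =
      expectation \<zeta> * expectation (\<lambda>\<omega>. (W t \<omega> - W s \<omega>) ^ k)"
  \<comment> \<open>At \<open>s = t\<close> the increment is 0, and \<open>0 < k\<close> makes its
    power vanish, so both sides are 0.\<close>
  using assms increment_indep[of s t \<zeta> k] increment_moment(1)[of s t k]
    indep_var_integrable[of \<zeta> "\<lambda>\<omega>. (W t \<omega> - W s \<omega>) ^ k"]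
    indep_var_lebesgue_integral[of \<zeta> "\<lambda>\<omega>. (W t \<omega> - W s \<omega>) ^ k"]
  by (cases "s = t"; simp add: power_0_left)+

lemma increment_mult_1:
  assumes "0 \<le> s" "s \<le> t" "\<zeta> \<in> borel_measurable (F (ennreal s))" "integrable M \<zeta>"
  shows "expectation (\<lambda>\<omega>. \<zeta> \<omega> * (W t \<omega> - W s \<omega>)) = 0"
  using increment_mult(2)[OF assms, of 1] increment_moment_1[of s t] assms by (cases "s = t") auto

lemma increment_mult_2:
  assumes "0 \<le> s" "s \<le> t" "\<zeta> \<in> borel_measurable (F (ennreal s))" "integrable M \<zeta>"
  shows "expectation (\<lambda>\<omega>. \<zeta> \<omega> * (W t \<omega> - W s \<omega>)\<^sup>2) = expectation \<zeta> * (t - s)"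
  using increment_mult(2)[OF assms, of 2] increment_moment_2[of s t] assms by (cases "s = t") auto

end

section \<open>Integrals of simple processes\<close>

context brownian_filtration
begin

lemma integrable_increment_product:
  assumes "0 \<le> a" "a \<le> b" "0 \<le> a'" "a' \<le> b'" "bounded_at r \<zeta>"
  shows "integrable M (\<lambda>\<omega>. \<zeta> \<omega> * ((W b \<omega> - W a \<omega>) * (W b' \<omega> - W a' \<omega>)))"
proof (rule integrable_bounded_mult[OF assms(5)])
  show "integrable M (\<lambda>\<omega>. (W b \<omega> - W a \<omega>) * (W b' \<omega> - W a' \<omega>))"
  proof (rule Bochner_Integration.integrable_bound[where f="\<lambda>\<omega>. (W b \<omega> - W a \<omega>)\<^sup>2 + (W b' \<omega> - W a' \<omega>)\<^sup>2"])
    show "integrable M (\<lambda>\<omega>. (W b \<omega> - W a \<omega>)\<^sup>2 + (W b' \<omega> - W a' \<omega>)\<^sup>2)"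
      using assms by (intro Bochner_Integration.integrable_add increment_power_integrable)
    show "(\<lambda>\<omega>. (W b \<omega> - W a \<omega>) * (W b' \<omega> - W a' \<omega>)) \<in> borel_measurable M"
      using W_measurable[OF order_trans[OF assms(1,2)]] W_measurable[OF assms(1)]
        W_measurable[OF order_trans[OF assms(3,4)]] W_measurable[OF assms(3)] by simp
    have "\<bar>x * y\<bar> \<le> \<bar>x\<^sup>2 + y\<^sup>2\<bar>" for x y :: real
      using sum_squares_bound[of "\<bar>x\<bar>" "\<bar>y\<bar>"] mult_nonneg_nonneg[of "\<bar>x\<bar>" "\<bar>y\<bar>"]
      unfolding abs_mult power2_abs by linarith
    then show "AE \<omega> in M. norm ((W b \<omega> - W a \<omega>) * (W b' \<omega> - W a' \<omega>))
        \<le> norm ((W b \<omega> - W a \<omega>)\<^sup>2 + (W b' \<omega> - W a' \<omega>)\<^sup>2)"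
      by (intro AE_I2) auto
  qed
qed

text \<open>The earlier increment and \<open>\<zeta>\<close> are both known at time
  \<open>a'\<close>, so their product is independent of the later increment, whose mean is
  0.\<close>

lemma increment_orthogonal:
  assumes "0 \<le> a" "a \<le> b" "b \<le> a'" "a' \<le> b'" "bounded_at a' \<zeta>"
  shows "expectation (\<lambda>\<omega>. \<zeta> \<omega> * ((W b \<omega> - W a \<omega>) * (W b' \<omega> - W a' \<omega>))) = 0"
proof -
  have m: "W a \<in> borel_measurable (F (ennreal a'))" "W b \<in> borel_measurable (F (ennreal a'))"
    by (rule measurable_F_mono[OF ennreal_leI W_adapted], use assms in linarith, use assms in linarith)+
  have "expectation (\<lambda>\<omega>. (\<zeta> \<omega> * (W b \<omega> - W a \<omega>)) * (W b' \<omega> - W a' \<omega>)) = 0"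
  proof (rule increment_mult_1)
    have "\<zeta> \<in> borel_measurable (F (ennreal a'))" using assms(5) by (simp add: bounded_at_def)
    then show "(\<lambda>\<omega>. \<zeta> \<omega> * (W b \<omega> - W a \<omega>)) \<in> borel_measurable (F (ennreal a'))"
      by (rule borel_measurable_times[OF _ borel_measurable_diff[OF m(2,1)]])
    show "integrable M (\<lambda>\<omega>. \<zeta> \<omega> * (W b \<omega> - W a \<omega>))"
      using integrable_bounded_mult[OF assms(5) increment_power_integrable[of a b 1]] assms by simp
  qed (use assms in auto)
  then show ?thesis by (simp add: mult.assoc)
qed

text \<open>Cutting both intervals at \<open>a'\<close> and at the smaller right end leaves one
  common piece; products over disjoint pieces average out. The assumption \<open>a \<le> a'\<close>
  makes the weight known when the common piece starts.\<close>

lemma increment_pair_aux: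
  assumes "0 \<le> a" "a \<le> b" "a \<le> a'" "a' \<le> b'" "bounded_at a' \<zeta>"
  shows "expectation (\<lambda>\<omega>. \<zeta> \<omega> * ((W b \<omega> - W a \<omega>) * (W b' \<omega> - W a' \<omega>))) =
    expectation \<zeta> * measure lborel ({a<..b} \<inter> {a'<..b'})"
proof (cases "b \<le> a'")
  case True
  then have *: "{a<..b} \<inter> {a'<..b'} = {}" by auto
  show ?thesis unfolding * using increment_orthogonal[OF assms(1,2) True assms(4,5)] by simp
next
  case False
  \<comment> \<open>\<open>m\<close> ends the overlap and \<open>m'\<close> the union, which makes
    the decomposition below the same for \<open>b \<le> b'\<close> and
    \<open>b' < b\<close>.\<close>
  define m m' where "m = min b b'" and "m' = max b b'"
  have m: "a' \<le> m" "m \<le> m'" "0 \<le> a'" using assms False by (auto simp: m_def m'_def)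
  have eq: "\<zeta> \<omega> * ((W b \<omega> - W a \<omega>) * (W b' \<omega> - W a' \<omega>)) =
      \<zeta> \<omega> * ((W a' \<omega> - W a \<omega>) * (W b' \<omega> - W a' \<omega>)) +
      \<zeta> \<omega> * (W m \<omega> - W a' \<omega>)\<^sup>2 + \<zeta> \<omega> * ((W m \<omega> - W a' \<omega>) * (W m' \<omega> - W m \<omega>))" for \<omega>
    by (cases "b \<le> b'") (simp_all add: m_def m'_def algebra_simps power2_eq_square)
  have set: "{a<..b} \<inter> {a'<..b'} = {a'<..m}" using assms by (auto simp: m_def)
  have \<zeta>: "\<zeta> \<in> borel_measurable (F (ennreal a'))" using assms(5) by (simp add: bounded_at_def)
  have i1: "integrable M (\<lambda>\<omega>. \<zeta> \<omega> * ((W a' \<omega> - W a \<omega>) * (W b' \<omega> - W a' \<omega>)))"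
    using assms m by (intro integrable_increment_product) auto
  have i2: "integrable M (\<lambda>\<omega>. \<zeta> \<omega> * (W m \<omega> - W a' \<omega>)\<^sup>2)"
    using assms m by (intro integrable_bounded_mult[OF assms(5)] increment_power_integrable) auto
  have i3: "integrable M (\<lambda>\<omega>. \<zeta> \<omega> * ((W m \<omega> - W a' \<omega>) * (W m' \<omega> - W m \<omega>)))"
    using assms m by (intro integrable_increment_product) auto
  have "expectation (\<lambda>\<omega>. \<zeta> \<omega> * ((W b \<omega> - W a \<omega>) * (W b' \<omega> - W a' \<omega>))) =
     expectation (\<lambda>\<omega>. \<zeta> \<omega> * ((W a' \<omega> - W a \<omega>) * (W b' \<omega> - W a' \<omega>))) +
      expectation (\<lambda>\<omega>. \<zeta> \<omega> * (W m \<omega> - W a' \<omega>)\<^sup>2) +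
      expectation (\<lambda>\<omega>. \<zeta> \<omega> * ((W m \<omega> - W a' \<omega>) * (W m' \<omega> - W m \<omega>)))"
    unfolding eq using i1 i2 i3 by simp
  also have "expectation (\<lambda>\<omega>. \<zeta> \<omega> * ((W a' \<omega> - W a \<omega>) * (W b' \<omega> - W a' \<omega>))) = 0"
    using assms m by (intro increment_orthogonal) auto
  also have "expectation (\<lambda>\<omega>. \<zeta> \<omega> * ((W m \<omega> - W a' \<omega>) * (W m' \<omega> - W m \<omega>))) = 0"
    using assms m bounded_at_mono[OF assms(5) m(1)] by (intro increment_orthogonal) auto
  also have "expectation (\<lambda>\<omega>. \<zeta> \<omega> * (W m \<omega> - W a' \<omega>)\<^sup>2) = expectation \<zeta> * (m - a')"
    using assms m \<zeta> by (intro increment_mult_2) (auto intro: bounded_at_integrable)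
  finally show ?thesis unfolding set using m by simp
qed

lemma increment_pair:
  assumes "0 \<le> a" "a \<le> b" "0 \<le> a'" "a' \<le> b'" "bounded_at (max a a') \<zeta>"
  shows "expectation (\<lambda>\<omega>. \<zeta> \<omega> * ((W b \<omega> - W a \<omega>) * (W b' \<omega> - W a' \<omega>))) =
    expectation \<zeta> * measure lborel ({a<..b} \<inter> {a'<..b'})"
proof (cases "a \<le> a'")
  case True
  then show ?thesis using assms increment_pair_aux[of a b a' b' \<zeta>] by (simp add: max_def)
next
  case False
  then have "bounded_at a \<zeta>" "a' \<le> a" using assms by (simp_all add: max_def)
  with increment_pair_aux[of a' b' a b \<zeta>] assms show ?thesis
    by (simp add: mult.commute Int_commute)
qed

text \<open>Projection onto \<open>[s, t]\<close>: it turns an increment over \<open>(p, q]\<close> into one over \<open>(p, q] \<inter> (s, t]\<close>.\<close>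

definition clamp_time :: "real \<Rightarrow> real \<Rightarrow> real \<Rightarrow> real" where
  "clamp_time s t q = max s (min t q)"

lemma simple_ito_increment:
  assumes "s \<le> t"
  shows "simple_ito_integral W n p \<xi> t \<omega> - simple_ito_integral W n p \<xi> s \<omega> =
    (\<Sum>i<n. \<xi> i \<omega> * (W (clamp_time s t (p (Suc i))) \<omega> - W (clamp_time s t (p i)) \<omega>))"
proof -
  have "W (min q t) \<omega> - W (min q s) \<omega> = W (clamp_time s t q) \<omega> - W s \<omega>" for q
    using assms by (cases "s = t"; cases "q \<le> s"; cases "q \<le> t") (simp_all add: clamp_time_def min_def max_def)
  then have "\<xi> i \<omega> * (W (min (p (Suc i)) t) \<omega> - W (min (p i) t) \<omega>) - \<xi> i \<omega> * (W (min (p (Suc i)) s) \<omega> - W (min (p i) s) \<omega>) =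
     \<xi> i \<omega> * (W (clamp_time s t (p (Suc i))) \<omega> - W (clamp_time s t (p i)) \<omega>)" for i
    by (smt (verit, best) right_diff_distrib)
  then show ?thesis
    unfolding simple_ito_integral_def sum_subtractf[symmetric] by simp
qed

lemma simple_integrand_nonneg:
  assumes "simple_integrand M F n p \<xi>" "i \<le> n"
  shows "0 \<le> p i"
  using assms(2)
proof (induction i)
  case 0
  then show ?case using assms(1) by (simp add: simple_integrand_def)
next
  case (Suc i)
  then show ?case using assms(1) unfolding simple_integrand_def
    by (meson Suc_leD Suc_le_lessD order_trans)
qed

lemma simple_integrand_bounded_at:
  assumes "simple_integrand M F n p \<xi>" "i < n"
  shows "bounded_at (p i) (\<xi> i)"
  using assms unfolding simple_integrand_def bounded_at_def by blast

section \<open>The isometry for simple integrands, weighted by the past\<close>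

definition NN :: "('a \<times> real) measure" where
  "NN = M \<Otimes>\<^sub>M lborel"

lemma product_integral:
  assumes "bounded_at s g" "A \<in> sets lborel" "emeasure lborel A < \<infinity>"
  shows "integrable NN (\<lambda>z. g (fst z) * indicator A (snd z))"
    and "(\<integral>z. g (fst z) * indicator A (snd z) \<partial>NN) = expectation g * measure lborel A"
proof -
  interpret pair_sigma_finite M lborel ..
  obtain C where C: "C \<ge> 0" "\<And>\<omega>. \<omega> \<in> space M \<Longrightarrow> \<bar>g \<omega>\<bar> \<le> C"
    using bounded_at_bound[OF assms(1)] by blast
  have g: "g \<in> borel_measurable M" using bounded_at_measurable[OF assms(1)] .
  show int: "integrable NN (\<lambda>z. g (fst z) * indicator A (snd z))"
    unfolding NN_def
  proof (rule Bochner_Integration.integrable_bound[where f="\<lambda>z. C * indicator (space M \<times> A) z"])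
    have "emeasure (M \<Otimes>\<^sub>M lborel) (space M \<times> A) < \<infinity>"
      using assms by (subst lborel.emeasure_pair_measure_Times) (auto simp: emeasure_space_1)
    then show "integrable (M \<Otimes>\<^sub>M lborel) (\<lambda>z. C * indicator (space M \<times> A) z :: real)"
      using assms by (intro integrable_mult_right integrable_real_indicator) auto
    show "(\<lambda>z. g (fst z) * indicator A (snd z)) \<in> borel_measurable (M \<Otimes>\<^sub>M lborel)"
      using g assms(2) by measurable
    show "AE z in M \<Otimes>\<^sub>M lborel. norm (g (fst z) * indicator A (snd z)) \<le> norm (C * indicator (space M \<times> A) z)"
      using C by (intro AE_I2) (auto simp: space_pair_measure indicator_def)
  qed
  have "(\<integral>z. g (fst z) * indicator A (snd z) \<partial>NN) = (\<integral>\<omega>. (\<integral>u. g \<omega> * indicator A u \<partial>lborel) \<partial>M)"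
    using integral_fst'[of "\<lambda>z. g (fst z) * indicator A (snd z)"] int unfolding NN_def by simp
  also have "\<dots> = expectation g * measure lborel A"
    by simp
  finally show "(\<integral>z. g (fst z) * indicator A (snd z) \<partial>NN) = expectation g * measure lborel A" .
qed

text \<open>One pair of summands of the isometry below. Clamping to \<open>[s, t]\<close> intersects
  each cell with \<open>(s, t]\<close>, which on the product space is the factor
  \<open>indicator {s<..t}\<close>.\<close>

lemma clamped_pair:
  assumes "0 \<le> s" "s \<le> t" "bounded_at s \<zeta>"
    and "0 \<le> a" "a \<le> b" "bounded_at a \<xi>" and "0 \<le> a'" "a' \<le> b'" "bounded_at a' \<eta>"
  defines "J \<equiv> \<lambda>\<omega>. \<zeta> \<omega> * (\<xi> \<omega> * (W (clamp_time s t b) \<omega> - W (clamp_time s t a) \<omega>)) *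
     (\<eta> \<omega> * (W (clamp_time s t b') \<omega> - W (clamp_time s t a') \<omega>))"
    and "G \<equiv> \<lambda>z. \<zeta> (fst z) * indicator {s<..t} (snd z) *
       (\<xi> (fst z) * indicator {a<..b} (snd z)) * (\<eta> (fst z) * indicator {a'<..b'} (snd z))"
  shows "integrable M J" "integrable NN G" "expectation J = (\<integral>z. G z \<partial>NN)"
proof -
  let ?c = "clamp_time s t"
  let ?A = "{s<..t} \<inter> ({a<..b} \<inter> {a'<..b'})"
  have c: "0 \<le> ?c a" "?c a \<le> ?c b" "0 \<le> ?c a'" "?c a' \<le> ?c b'" "s \<le> ?c a" "s \<le> ?c a'"
    using assms by (auto simp: clamp_time_def)
  have \<zeta>\<xi>\<eta>: "bounded_at (max s (max a a')) (\<lambda>\<omega>. \<zeta> \<omega> * (\<xi> \<omega> * \<eta> \<omega>))"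
    using assms by (intro bounded_at_mult) (auto intro: bounded_at_mono)
  have J: "J = (\<lambda>\<omega>. \<zeta> \<omega> * (\<xi> \<omega> * \<eta> \<omega>) * ((W (?c b) \<omega> - W (?c a) \<omega>) * (W (?c b') \<omega> - W (?c a') \<omega>)))"
    unfolding J_def by (auto simp: fun_eq_iff)
  have G: "G = (\<lambda>z. (\<zeta> (fst z) * (\<xi> (fst z) * \<eta> (fst z))) * indicator ?A (snd z))"
    unfolding G_def by (auto simp: fun_eq_iff indicator_def)
  show "integrable M J" unfolding J using c \<zeta>\<xi>\<eta> by (intro integrable_increment_product)
  have "emeasure lborel ?A \<le> emeasure lborel {s<..t}" by (intro emeasure_mono) auto
  also have "\<dots> < \<infinity>" using assms(2) by simp
  finally have fin: "emeasure lborel ?A < \<infinity>" .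
  show "integrable NN G" unfolding G using fin by (intro product_integral(1)[OF \<zeta>\<xi>\<eta>]) auto
  have RHS: "(\<integral>z. G z \<partial>NN) = expectation (\<lambda>\<omega>. \<zeta> \<omega> * (\<xi> \<omega> * \<eta> \<omega>)) * measure lborel ?A"
    unfolding G using fin by (intro product_integral(2)[OF \<zeta>\<xi>\<eta>]) auto
  show "expectation J = (\<integral>z. G z \<partial>NN)"
  \<comment> \<open>If a cell starts at or after \<open>t\<close>, its coefficient need not be known
    by time \<open>t\<close>, but its clamped increment is 0. Otherwise the weight is known at the
    later of the two clamped left ends, as \<open>increment_pair\<close> requires.\<close>
  proof (cases "t \<le> a \<or> t \<le> a'")
    case True
    then have A: "?A = {}" by auto
    have "?c a = ?c b \<or> ?c a' = ?c b'"
      using True assms by (auto simp: clamp_time_def)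
    then have "J = (\<lambda>_. 0)" unfolding J by auto
    then show ?thesis unfolding RHS A by simp
  next
    case False
    then have mx: "max s (max a a') = max (?c a) (?c a')" using assms by (auto simp: clamp_time_def)
    have A: "{?c a<..?c b} \<inter> {?c a'<..?c b'} = ?A"
      using False assms by (auto simp: clamp_time_def)
    show ?thesis unfolding RHS unfolding J A[symmetric]
      using \<zeta>\<xi>\<eta> c by (intro increment_pair) (auto simp: mx)
  qed
qed

text \<open>Bilinear in two integrands with unrelated partitions: the covariance of two increments
  depends only on the overlap of their intervals, so the sums can be multiplied out term by term
  instead of passing to a common refinement.\<close>

lemma simple_isometry:
  assumes sx: "simple_integrand M F n p \<xi>" and sy: "simple_integrand M F n' p' \<xi>'"
    and st: "0 \<le> s" "s \<le> t" and z: "bounded_at s \<zeta>"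
  defines "J \<equiv> \<lambda>\<omega>. \<zeta> \<omega> * (simple_ito_integral W n p \<xi> t \<omega> - simple_ito_integral W n p \<xi> s \<omega>) *
     (simple_ito_integral W n' p' \<xi>' t \<omega> - simple_ito_integral W n' p' \<xi>' s \<omega>)"
    and "G \<equiv> \<lambda>z. \<zeta> (fst z) * indicator {s<..t} (snd z) *
       simple_process n p \<xi> (snd z) (fst z) * simple_process n' p' \<xi>' (snd z) (fst z)"
  shows "integrable M J" "integrable NN G" "expectation J = (\<integral>z. G z \<partial>NN)"
proof -
  let ?c = "clamp_time s t"
  let ?J = "\<lambda>i j \<omega>. \<zeta> \<omega> * (\<xi> i \<omega> * (W (?c (p (Suc i))) \<omega> - W (?c (p i)) \<omega>)) *
     (\<xi>' j \<omega> * (W (?c (p' (Suc j))) \<omega> - W (?c (p' j)) \<omega>))"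
  let ?G = "\<lambda>i j z. \<zeta> (fst z) * indicator {s<..t} (snd z) *
       (\<xi> i (fst z) * indicator {p i<..p (Suc i)} (snd z)) * (\<xi>' j (fst z) * indicator {p' j<..p' (Suc j)} (snd z))"
  have dist: "z * (\<Sum>i<n. f i) * (\<Sum>j<n'. g j) = (\<Sum>i<n. \<Sum>j<n'. z * f i * g j)" for z :: real and f g
    by (simp only: mult.assoc sum_product) (simp only: sum_distrib_left mult.assoc)
  have J: "J = (\<lambda>\<omega>. \<Sum>i<n. \<Sum>j<n'. ?J i j \<omega>)"
    unfolding J_def simple_ito_increment[OF st(2)] by (simp only: dist)
  have G: "G = (\<lambda>z. \<Sum>i<n. \<Sum>j<n'. ?G i j z)"
    unfolding G_def simple_process_def by (simp only: dist)
  have *: "integrable M (?J i j)" "integrable NN (?G i j)" "expectation (?J i j) = (\<integral>z. ?G i j z \<partial>NN)"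
    if "i \<in> {..<n}" "j \<in> {..<n'}" for i j
  proof -
    have "0 \<le> p i" "p i \<le> p (Suc i)" "0 \<le> p' j" "p' j \<le> p' (Suc j)"
      using that sx sy simple_integrand_nonneg[OF sx, of i] simple_integrand_nonneg[OF sy, of j]
      by (auto simp: simple_integrand_def)
    note pp = this
    have b: "bounded_at (p i) (\<xi> i)" "bounded_at (p' j) (\<xi>' j)"
      using that simple_integrand_bounded_at[OF sx, of i] simple_integrand_bounded_at[OF sy, of j] by auto
    note c = clamped_pair[OF st z pp(1,2) b(1) pp(3,4) b(2)]
    show "integrable M (?J i j)" using c(1) .
    show "integrable NN (?G i j)" using c(2) .
    show "expectation (?J i j) = (\<integral>z. ?G i j z \<partial>NN)" using c(3) .
  qed
  show "integrable M J" unfolding J using * by (intro Bochner_Integration.integrable_sum)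
  show "integrable NN G" unfolding G using * by (intro Bochner_Integration.integrable_sum)
  have i1: "integrable M (\<lambda>\<omega>. \<Sum>j<n'. ?J i j \<omega>)" "integrable NN (\<lambda>z. \<Sum>j<n'. ?G i j z)" if "i \<in> {..<n}" for i
    using * that by (auto intro!: Bochner_Integration.integrable_sum)
  have "expectation J = (\<Sum>i<n. \<Sum>j<n'. expectation (?J i j))"
    unfolding J using i1(1) *(1) by (simp add: Bochner_Integration.integral_sum)
  also have "\<dots> = (\<Sum>i<n. \<Sum>j<n'. \<integral>z. ?G i j z \<partial>NN)"
    using *(3) by (intro sum.cong refl) auto
  also have "\<dots> = (\<integral>z. G z \<partial>NN)"
    unfolding G using i1(2) *(2) by (simp add: Bochner_Integration.integral_sum)
  finally show "expectation J = (\<integral>z. G z \<partial>NN)" .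
qed

text \<open>Each coefficient \<open>\<zeta> \<omega> * \<xi> i \<omega>\<close> is known at the left
  end of its clamped cell, unless the cell starts at or after \<open>t\<close> and its increment
  vanishes.\<close>

lemma simple_martingale:
  assumes sx: "simple_integrand M F n p \<xi>" and st: "0 \<le> s" "s \<le> t" and z: "bounded_at s \<zeta>"
  defines "J \<equiv> \<lambda>\<omega>. \<zeta> \<omega> * (simple_ito_integral W n p \<xi> t \<omega> - simple_ito_integral W n p \<xi> s \<omega>)"
  shows "integrable M J" "expectation J = 0"
proof -
  let ?c = "clamp_time s t"
  let ?J = "\<lambda>i \<omega>. \<zeta> \<omega> * \<xi> i \<omega> * (W (?c (p (Suc i))) \<omega> - W (?c (p i)) \<omega>)"
  have J: "J = (\<lambda>\<omega>. \<Sum>i<n. ?J i \<omega>)"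
    unfolding J_def simple_ito_increment[OF st(2)] by (auto simp: fun_eq_iff sum_distrib_left mult.assoc)
  have *: "integrable M (?J i)" "expectation (?J i) = 0" if "i \<in> {..<n}" for i
  proof -
    have p: "0 \<le> p i" "p i \<le> p (Suc i)" using that simple_integrand_nonneg[OF sx, of i] sx
      by (auto simp: simple_integrand_def)
    have b: "bounded_at (max s (p i)) (\<lambda>\<omega>. \<zeta> \<omega> * \<xi> i \<omega>)"
      using that z simple_integrand_bounded_at[OF sx, of i]
      by (intro bounded_at_mult) (auto intro: bounded_at_mono)
    have c: "0 \<le> ?c (p i)" "?c (p i) \<le> ?c (p (Suc i))" using p st by (auto simp: clamp_time_def)
    show "integrable M (?J i)"
      using integrable_bounded_mult[OF b increment_power_integrable[OF c, of 1]] by simp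
    show "expectation (?J i) = 0"
    proof (cases "t \<le> p i")
      case True
      then have "?c (p i) = ?c (p (Suc i))" using p st by (auto simp: clamp_time_def)
      then show ?thesis by simp
    next
      case False
      then have "max s (p i) = ?c (p i)" using st by (auto simp: clamp_time_def)
      with b have "bounded_at (?c (p i)) (\<lambda>\<omega>. \<zeta> \<omega> * \<xi> i \<omega>)" by simp
      then have "(\<lambda>\<omega>. \<zeta> \<omega> * \<xi> i \<omega>) \<in> borel_measurable (F (ennreal (?c (p i))))"
        by (simp add: bounded_at_def)
      then show ?thesis using bounded_at_integrable[OF b] c by (intro increment_mult_1)
    qed
  qed
  show "integrable M J" unfolding J using * by (intro Bochner_Integration.integrable_sum)
  show "expectation J = 0" unfolding J using * by (simp add: Bochner_Integration.integral_sum)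
qed

text \<open>The Cauchy-Schwarz inequality, applied twice.\<close>

lemma sum_power4_le: "(\<Sum>i\<in>I. f i :: real) ^ 4 \<le> real (card I) ^ 3 * (\<Sum>i\<in>I. f i ^ 4)"
proof -
  have "((\<Sum>i\<in>I. f i)\<^sup>2)\<^sup>2 \<le> ((\<Sum>i\<in>I. (f i)\<^sup>2) * real (card I))\<^sup>2"
    by (intro power_mono sum_squared_le_sum_of_squares) auto
  also have "\<dots> = (\<Sum>i\<in>I. (f i)\<^sup>2)\<^sup>2 * (real (card I))\<^sup>2" by (simp add: power_mult_distrib)
  also have "\<dots> \<le> ((\<Sum>i\<in>I. ((f i)\<^sup>2)\<^sup>2) * real (card I)) * (real (card I))\<^sup>2"
    by (intro mult_right_mono sum_squared_le_sum_of_squares) auto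
  finally show ?thesis by (simp add: eval_nat_numeral mult_ac)
qed

text \<open>Crude in the number of cells and the size of the coefficients. What matters is one
  constant for all \<open>s\<close> and \<open>t\<close>, with the order \<open>(t - s)^2\<close>
  inherited from the Gaussian fourth moment.\<close>

lemma simple_fourth_moment:
  assumes sx: "simple_integrand M F n p \<xi>"
  obtains C where "C \<ge> 0"
    "\<And>s t. 0 \<le> s \<Longrightarrow> s \<le> t \<Longrightarrow>
      integrable M (\<lambda>\<omega>. (simple_ito_integral W n p \<xi> t \<omega> - simple_ito_integral W n p \<xi> s \<omega>) ^ 4) \<and>
      expectation (\<lambda>\<omega>. (simple_ito_integral W n p \<xi> t \<omega> - simple_ito_integral W n p \<xi> s \<omega>) ^ 4) \<le> C * (t - s)\<^sup>2"
proof -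
  obtain C0 where C0: "\<And>i \<omega>. i < n \<Longrightarrow> \<omega> \<in> space M \<Longrightarrow> \<bar>\<xi> i \<omega>\<bar> \<le> C0"
    using sx unfolding simple_integrand_def by blast
  define C where "C = real n ^ 3 * (\<Sum>i<n. C0 ^ 4 * 3)"
  have "C \<ge> 0" unfolding C_def by (auto intro!: mult_nonneg_nonneg sum_nonneg)
  moreover have "integrable M (\<lambda>\<omega>. (simple_ito_integral W n p \<xi> t \<omega> - simple_ito_integral W n p \<xi> s \<omega>) ^ 4) \<and>
      expectation (\<lambda>\<omega>. (simple_ito_integral W n p \<xi> t \<omega> - simple_ito_integral W n p \<xi> s \<omega>) ^ 4) \<le> C * (t - s)\<^sup>2"
    if st: "0 \<le> s" "s \<le> t" for s t
  proof -
    let ?c = "clamp_time s t"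
    let ?D = "\<lambda>i \<omega>. W (?c (p (Suc i))) \<omega> - W (?c (p i)) \<omega>"
    let ?I = "\<lambda>\<omega>. simple_ito_integral W n p \<xi> t \<omega> - simple_ito_integral W n p \<xi> s \<omega>"
    let ?B = "\<lambda>\<omega>. real n ^ 3 * (\<Sum>i<n. C0 ^ 4 * ?D i \<omega> ^ 4)"
    have c: "0 \<le> ?c (p i)" "?c (p i) \<le> ?c (p (Suc i))" "?c (p (Suc i)) - ?c (p i) \<le> t - s" if "i < n" for i
      using that simple_integrand_nonneg[OF sx, of i] sx st by (auto simp: clamp_time_def simple_integrand_def)
    have iD: "integrable M (\<lambda>\<omega>. ?D i \<omega> ^ 4)" if "i < n" for i
      using c[OF that] by (intro increment_power_integrable)
    have iB: "integrable M ?B"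
      using iD by (intro integrable_mult_right Bochner_Integration.integrable_sum) auto
    have le: "?I \<omega> ^ 4 \<le> ?B \<omega>" if "\<omega> \<in> space M" for \<omega>
    proof -
      have "?I \<omega> ^ 4 \<le> real n ^ 3 * (\<Sum>i<n. (\<xi> i \<omega> * ?D i \<omega>) ^ 4)"
        unfolding simple_ito_increment[OF st(2)] using sum_power4_le[of "\<lambda>i. \<xi> i \<omega> * ?D i \<omega>" "{..<n}"] by simp
      also have "\<dots> \<le> ?B \<omega>"
      proof (intro mult_left_mono sum_mono)
        fix i assume "i \<in> {..<n}"
        then have "\<bar>\<xi> i \<omega>\<bar> ^ 4 \<le> C0 ^ 4" using C0[of i \<omega>] that by (intro power_mono) auto
        then show "(\<xi> i \<omega> * ?D i \<omega>) ^ 4 \<le> C0 ^ 4 * ?D i \<omega> ^ 4"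
          unfolding power_mult_distrib by (intro mult_right_mono) (auto simp: power_even_abs)
      qed auto
      finally show ?thesis .
    qed
    have meas: "(\<lambda>\<omega>. ?I \<omega> ^ 4) \<in> borel_measurable M"
    proof -
      have "(\<lambda>\<omega>. \<zeta> \<omega> * (simple_ito_integral W n p \<xi> t \<omega> - simple_ito_integral W n p \<xi> s \<omega>)) \<in> borel_measurable M"
        if "bounded_at s \<zeta>" for \<zeta>
        using simple_martingale(1)[OF sx st that] by auto
      from this[OF bounded_at_const[of _ 1]] show ?thesis by (intro borel_measurable_power) simp
    qed
    have int: "integrable M (\<lambda>\<omega>. ?I \<omega> ^ 4)"
      using le by (intro Bochner_Integration.integrable_bound[OF iB meas] AE_I2) (auto intro: order_trans[OF _ abs_ge_self])
    have "expectation (\<lambda>\<omega>. ?I \<omega> ^ 4) \<le> expectation ?B"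
      using le by (intro integral_mono int iB)
    also have "\<dots> = real n ^ 3 * (\<Sum>i<n. C0 ^ 4 * expectation (\<lambda>\<omega>. ?D i \<omega> ^ 4))"
      using iD by (simp add: Bochner_Integration.integral_sum)
    also have "\<dots> \<le> real n ^ 3 * (\<Sum>i<n. C0 ^ 4 * (3 * (t - s)\<^sup>2))"
    proof (intro mult_left_mono sum_mono)
      fix i assume i: "i \<in> {..<n}"
      show "expectation (\<lambda>\<omega>. ?D i \<omega> ^ 4) \<le> 3 * (t - s)\<^sup>2"
      proof (cases "?c (p i) = ?c (p (Suc i))")
        case False
        then have "expectation (\<lambda>\<omega>. ?D i \<omega> ^ 4) = 3 * (?c (p (Suc i)) - ?c (p i))\<^sup>2"
          using c[of i] i by (intro increment_moment_4) auto
        also have "\<dots> \<le> 3 * (t - s)\<^sup>2" using c[of i] i by (intro mult_left_mono power_mono) auto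
        finally show ?thesis .
      qed auto
    qed auto
    also have "\<dots> = C * (t - s)\<^sup>2" unfolding C_def by (simp add: sum_distrib_right mult_ac)
    finally show ?thesis using int by simp
  qed
  ultimately show ?thesis using that by blast
qed

end

section \<open>Mean-square limits of simple integrals\<close>

text \<open>Young's inequality with parameter \<open>\<eta>\<close>, applied to the cross term of
  \<open>(a + d)^2\<close>.\<close>

lemma abs_diff_squares_le:
  fixes a b \<eta> :: real
  assumes "0 < \<eta>"
  shows "\<bar>b\<^sup>2 - a\<^sup>2\<bar> \<le> (1 + 1 / \<eta>) * (a - b)\<^sup>2 + \<eta> * a\<^sup>2"
proof -
  define d where "d = b - a"
  have "0 \<le> (\<bar>a\<bar> * \<eta> - \<bar>d\<bar>)\<^sup>2 / \<eta>" using assms by simp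
  also have "\<dots> = \<eta> * a\<^sup>2 - 2 * \<bar>a * d\<bar> + d\<^sup>2 / \<eta>"
    using assms by (simp add: field_simps power2_eq_square abs_mult)
  finally have "2 * \<bar>a * d\<bar> \<le> \<eta> * a\<^sup>2 + d\<^sup>2 / \<eta>" by simp
  moreover have "b\<^sup>2 - a\<^sup>2 = 2 * (a * d) + d\<^sup>2" by (simp add: d_def power2_eq_square algebra_simps)
  moreover have "\<bar>2 * (a * d) + d\<^sup>2\<bar> \<le> 2 * \<bar>a * d\<bar> + d\<^sup>2"
    by (smt (verit, best) zero_le_power2)
  moreover have "(a - b)\<^sup>2 = d\<^sup>2" by (simp add: d_def power2_commute)
  ultimately show ?thesis by (simp add: algebra_simps)
qed

text \<open>Lets an isometry pass to the limit: it is applied on the probability space to the left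
  side and on the product space to the right side. The weight may have either sign, so differences
  of squares are estimated rather than norms.\<close>

lemma L2_limit:
  fixes g :: "'b \<Rightarrow> real"
  assumes [measurable]: "\<And>k. f k \<in> borel_measurable N" "g \<in> borel_measurable N" "\<zeta> \<in> borel_measurable N"
    and int: "\<And>k. integrable N (\<lambda>x. (f k x)\<^sup>2)"
    and lim: "(\<lambda>k. \<integral>\<^sup>+x. ennreal ((g x - f k x)\<^sup>2) \<partial>N) \<longlonglongrightarrow> 0"
    and bound: "\<And>x. x \<in> space N \<Longrightarrow> \<bar>\<zeta> x\<bar> \<le> C"
  shows "integrable N (\<lambda>x. (g x)\<^sup>2)"
    and "integrable N (\<lambda>x. \<zeta> x * (g x)\<^sup>2)"
    and "(\<lambda>k. \<integral>x. \<zeta> x * (f k x)\<^sup>2 \<partial>N) \<longlonglongrightarrow> (\<integral>x. \<zeta> x * (g x)\<^sup>2 \<partial>N)"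
proof -
  define d where "d k = (\<integral>\<^sup>+x. ennreal ((g x - f k x)\<^sup>2) \<partial>N)" for k
  have ev: "eventually (\<lambda>k. d k < 1) sequentially"
    using lim unfolding d_def by (rule order_tendstoD) simp
  have idiff: "integrable N (\<lambda>x. (g x - f k x)\<^sup>2)" if "d k < 1" for k
    using that unfolding d_def by (intro integrableI_bounded) (auto intro: less_trans)
  obtain k0 where "d k0 < 1" using ev eventually_happens'[of sequentially] by auto
  show ig: "integrable N (\<lambda>x. (g x)\<^sup>2)"
  proof (rule Bochner_Integration.integrable_bound[where f="\<lambda>x. 2 * (g x - f k0 x)\<^sup>2 + 2 * (f k0 x)\<^sup>2"])
    show "integrable N (\<lambda>x. 2 * (g x - f k0 x)\<^sup>2 + 2 * (f k0 x)\<^sup>2)"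
      using idiff[OF \<open>d k0 < 1\<close>] int by simp
    have "a\<^sup>2 \<le> 2 * (a - b)\<^sup>2 + 2 * b\<^sup>2" for a b :: real
      using zero_le_power2[of "a - 2 * b"] by (simp add: power2_eq_square algebra_simps)
    then show "AE x in N. norm ((g x)\<^sup>2) \<le> norm (2 * (g x - f k0 x)\<^sup>2 + 2 * (f k0 x)\<^sup>2)"
      by (intro AE_I2) auto
  qed simp
  have C0: "\<bar>\<zeta> x\<bar> \<le> \<bar>C\<bar>" if "x \<in> space N" for x using bound[OF that] by simp
  have iz: "integrable N (\<lambda>x. \<zeta> x * h x)" if "integrable N h" for h :: "'b \<Rightarrow> real"
  proof (rule Bochner_Integration.integrable_bound[where f="\<lambda>x. \<bar>C\<bar> * \<bar>h x\<bar>"])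
    show "integrable N (\<lambda>x. \<bar>C\<bar> * \<bar>h x\<bar>)" using that by simp
    show "(\<lambda>x. \<zeta> x * h x) \<in> borel_measurable N" using that by auto
    show "AE x in N. norm (\<zeta> x * h x) \<le> norm (\<bar>C\<bar> * \<bar>h x\<bar>)"
      using C0 by (intro AE_I2) (auto simp: abs_mult intro!: mult_right_mono)
  qed
  show "integrable N (\<lambda>x. \<zeta> x * (g x)\<^sup>2)" using iz[OF ig] .
  define G where "G = (\<integral>x. (g x)\<^sup>2 \<partial>N)"
  have G: "G \<ge> 0" unfolding G_def by simp
  have d0: "(\<lambda>k. enn2real (d k)) \<longlonglongrightarrow> 0"
    using lim unfolding d_def by (intro tendsto_enn2real) simp_all
  have dr: "(\<integral>x. (g x - f k x)\<^sup>2 \<partial>N) = enn2real (d k)" for k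
    unfolding d_def by (intro integral_eq_nn_integral) auto
  show "(\<lambda>k. \<integral>x. \<zeta> x * (f k x)\<^sup>2 \<partial>N) \<longlonglongrightarrow> (\<integral>x. \<zeta> x * (g x)\<^sup>2 \<partial>N)"
  proof (rule tendstoI)
    fix e :: real assume e: "0 < e"
    \<comment> \<open>Chosen so that the part \<open>\<bar>C\<bar> * (\<eta> * G)\<close>, which
      does not shrink with \<open>k\<close>, is at most \<open>e / 2\<close>; the added ones avoid
      division by 0.\<close>
    define \<eta> where "\<eta> = e / (2 * (\<bar>C\<bar> + 1) * (G + 1))"
    have \<eta>: "\<eta> > 0" unfolding \<eta>_def using e G by auto
    have "\<bar>C\<bar> * (\<eta> * G) \<le> (\<bar>C\<bar> + 1) * (\<eta> * (G + 1))"
      using \<eta> G by (intro mult_mono) auto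
    also have "\<dots> = e / 2"
    proof -
      have "x * (e / (2 * x * y) * y) = e / 2" if "x > 0" "y > 0" for x y
        using that by (simp add: field_simps)
      from this[of "\<bar>C\<bar> + 1" "G + 1"] show ?thesis unfolding \<eta>_def using G by simp
    qed
    finally have half: "\<bar>C\<bar> * (\<eta> * G) \<le> e / 2" .
    have "(\<lambda>k. \<bar>C\<bar> * (1 + 1 / \<eta>) * enn2real (d k)) \<longlonglongrightarrow> \<bar>C\<bar> * (1 + 1 / \<eta>) * 0"
      by (intro tendsto_mult tendsto_const d0)
    then have "eventually (\<lambda>k. \<bar>C\<bar> * (1 + 1 / \<eta>) * enn2real (d k) < e / 2) sequentially"
      using e by (intro order_tendstoD(2)) auto
    with ev show "eventually (\<lambda>k. dist (\<integral>x. \<zeta> x * (f k x)\<^sup>2 \<partial>N) (\<integral>x. \<zeta> x * (g x)\<^sup>2 \<partial>N) < e) sequentially"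
    proof eventually_elim
      case (elim k)
      have "\<bar>(\<integral>x. \<zeta> x * (f k x)\<^sup>2 \<partial>N) - (\<integral>x. \<zeta> x * (g x)\<^sup>2 \<partial>N)\<bar> = \<bar>\<integral>x. \<zeta> x * ((f k x)\<^sup>2 - (g x)\<^sup>2) \<partial>N\<bar>"
        using iz[OF ig] iz[OF int[of k]] by (simp add: right_diff_distrib)
      also have "\<dots> \<le> (\<integral>x. \<bar>\<zeta> x * ((f k x)\<^sup>2 - (g x)\<^sup>2)\<bar> \<partial>N)"
        by (rule integral_abs_bound)
      also have "\<dots> \<le> (\<integral>x. \<bar>C\<bar> * ((1 + 1 / \<eta>) * (g x - f k x)\<^sup>2 + \<eta> * (g x)\<^sup>2) \<partial>N)"
      proof (rule integral_mono)
        show "integrable N (\<lambda>x. \<bar>\<zeta> x * ((f k x)\<^sup>2 - (g x)\<^sup>2)\<bar>)"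
          using iz[of "\<lambda>x. (f k x)\<^sup>2 - (g x)\<^sup>2"] int ig by simp
        show "integrable N (\<lambda>x. \<bar>C\<bar> * ((1 + 1 / \<eta>) * (g x - f k x)\<^sup>2 + \<eta> * (g x)\<^sup>2))"
          using idiff[OF elim(1)] ig by simp
        show "\<bar>\<zeta> x * ((f k x)\<^sup>2 - (g x)\<^sup>2)\<bar> \<le> \<bar>C\<bar> * ((1 + 1 / \<eta>) * (g x - f k x)\<^sup>2 + \<eta> * (g x)\<^sup>2)"
          if "x \<in> space N" for x
          unfolding abs_mult using C0[OF that] abs_diff_squares_le[OF \<eta>, of "f k x" "g x"]
          by (intro mult_mono) auto
      qed
      also have "\<dots> = \<bar>C\<bar> * (1 + 1 / \<eta>) * enn2real (d k) + \<bar>C\<bar> * (\<eta> * G)"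
        using idiff[OF elim(1)] ig by (simp add: dr G_def algebra_simps)
      also have "\<dots> < e" using half elim(2) by linarith
      finally show ?case by (simp add: dist_real_def)
    qed
  qed
qed

lemma tendsto_0_twice_sum:
  fixes f g h :: "nat \<Rightarrow> ennreal"
  assumes "f \<longlonglongrightarrow> 0" "g \<longlonglongrightarrow> 0" "\<And>k. h k \<le> 2 * f k + 2 * g k"
  shows "h \<longlonglongrightarrow> 0"
proof (rule tendsto_sandwich[where f="\<lambda>_. 0" and h="\<lambda>k. 2 * f k + 2 * g k"])
  have "(\<lambda>k. 2 * f k + 2 * g k) \<longlonglongrightarrow> 2 * 0 + 2 * 0"
    using assms by (intro tendsto_add ennreal_tendsto_cmult) auto
  then show "(\<lambda>k. 2 * f k + 2 * g k) \<longlonglongrightarrow> 0" by simp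
qed (use assms in auto)

lemma nn_integral_sq_triangle:
  fixes f g h :: "'b \<Rightarrow> real"
  assumes [measurable]: "f \<in> borel_measurable N" "g \<in> borel_measurable N"
    and "\<And>x. x \<in> space N \<Longrightarrow> \<bar>h x\<bar> \<le> \<bar>f x\<bar> + \<bar>g x\<bar>"
  shows "(\<integral>\<^sup>+x. ennreal ((h x)\<^sup>2) \<partial>N) \<le> 2 * (\<integral>\<^sup>+x. ennreal ((f x)\<^sup>2) \<partial>N) + 2 * (\<integral>\<^sup>+x. ennreal ((g x)\<^sup>2) \<partial>N)"
proof -
  have "(\<integral>\<^sup>+x. ennreal ((h x)\<^sup>2) \<partial>N) \<le> (\<integral>\<^sup>+x. 2 * ennreal ((f x)\<^sup>2) + 2 * ennreal ((g x)\<^sup>2) \<partial>N)"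
  proof (rule nn_integral_mono)
    fix x assume x: "x \<in> space N"
    have "(h x)\<^sup>2 \<le> (\<bar>f x\<bar> + \<bar>g x\<bar>)\<^sup>2"
      using assms(3)[OF x] by (metis abs_ge_zero power2_abs power_mono)
    also have "\<dots> \<le> 2 * (f x)\<^sup>2 + 2 * (g x)\<^sup>2"
      using sum_squares_bound[of "\<bar>f x\<bar>" "\<bar>g x\<bar>"] by (simp add: power2_sum)
    finally have "ennreal ((h x)\<^sup>2) \<le> ennreal (2 * (f x)\<^sup>2 + 2 * (g x)\<^sup>2)" by (rule ennreal_leI)
    also have "\<dots> = 2 * ennreal ((f x)\<^sup>2) + 2 * ennreal ((g x)\<^sup>2)"
      by (simp add: ennreal_plus ennreal_mult)
    finally show "ennreal ((h x)\<^sup>2) \<le> 2 * ennreal ((f x)\<^sup>2) + 2 * ennreal ((g x)\<^sup>2)" .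
  qed
  also have "\<dots> = 2 * (\<integral>\<^sup>+x. ennreal ((f x)\<^sup>2) \<partial>N) + 2 * (\<integral>\<^sup>+x. ennreal ((g x)\<^sup>2) \<partial>N)"
    by (simp add: nn_integral_add nn_integral_cmult)
  finally show ?thesis .
qed

context brownian_filtration
begin

lemma simple_ito_measurable:
  assumes "simple_integrand M F n p \<xi>" "0 \<le> t"
  shows "simple_ito_integral W n p \<xi> t \<in> borel_measurable M"
proof -
  have "(\<lambda>\<omega>. \<xi> i \<omega> * (W (min (p (Suc i)) t) \<omega> - W (min (p i) t) \<omega>)) \<in> borel_measurable M"
    if "i \<in> {..<n}" for i
    using that assms simple_integrand_nonneg[OF assms(1), of i] simple_integrand_nonneg[OF assms(1), of "Suc i"]
      bounded_at_measurable[OF simple_integrand_bounded_at[OF assms(1), of i]]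
      W_measurable[of "min (p (Suc i)) t"] W_measurable[of "min (p i) t"]
    by simp
  then have "(\<lambda>\<omega>. simple_ito_integral W n p \<xi> t \<omega>) \<in> borel_measurable M"
    unfolding simple_ito_integral_def by (rule borel_measurable_sum)
  then show ?thesis by simp
qed

lemma simple_process_measurable:
  assumes "simple_integrand M F n p \<xi>"
  shows "(\<lambda>z. simple_process n p \<xi> (snd z) (fst z)) \<in> borel_measurable NN"
proof -
  have "(\<lambda>z. \<xi> i (fst z) * indicator {p i<..p (Suc i)} (snd z)) \<in> borel_measurable (M \<Otimes>\<^sub>M lborel)"
    if "i \<in> {..<n}" for i
  proof -
    have [measurable]: "\<xi> i \<in> borel_measurable M"
      using that bounded_at_measurable[OF simple_integrand_bounded_at[OF assms, of i]] by simp
    show ?thesis by measurable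
  qed
  then show ?thesis unfolding simple_process_def NN_def by (rule borel_measurable_sum)
qed

lemma simple_ito_0:
  assumes "simple_integrand M F n p \<xi>"
  shows "simple_ito_integral W n p \<xi> 0 \<omega> = 0"
  unfolding simple_ito_integral_def
  using simple_integrand_nonneg[OF assms] by (intro sum.neutral) (simp add: min_absorb2)

lemma simple_isometry_diff:
  assumes sx: "simple_integrand M F n p \<xi>" and sy: "simple_integrand M F n' p' \<xi>'"
    and st: "0 \<le> s" "s \<le> t" and z: "bounded_at s \<zeta>"
  defines "I \<equiv> \<lambda>\<omega>. simple_ito_integral W n p \<xi> t \<omega> - simple_ito_integral W n p \<xi> s \<omega>"
    and "I' \<equiv> \<lambda>\<omega>. simple_ito_integral W n' p' \<xi>' t \<omega> - simple_ito_integral W n' p' \<xi>' s \<omega>"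
    and "G \<equiv> \<lambda>z. simple_process n p \<xi> (snd z) (fst z)"
    and "G' \<equiv> \<lambda>z. simple_process n' p' \<xi>' (snd z) (fst z)"
  shows "integrable M (\<lambda>\<omega>. \<zeta> \<omega> * (I \<omega> - I' \<omega>)\<^sup>2)"
    and "integrable NN (\<lambda>z. \<zeta> (fst z) * (indicator {s<..t} (snd z) * (G z - G' z))\<^sup>2)"
    and "expectation (\<lambda>\<omega>. \<zeta> \<omega> * (I \<omega> - I' \<omega>)\<^sup>2) =
      (\<integral>z. \<zeta> (fst z) * (indicator {s<..t} (snd z) * (G z - G' z))\<^sup>2 \<partial>NN)"
proof -
  note iso = simple_isometry[OF sx sx st z] simple_isometry[OF sy sy st z] simple_isometry[OF sx sy st z]
  have i: "integrable M (\<lambda>\<omega>. \<zeta> \<omega> * I \<omega> * I \<omega>)" "integrable M (\<lambda>\<omega>. \<zeta> \<omega> * I' \<omega> * I' \<omega>)"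
      "integrable M (\<lambda>\<omega>. \<zeta> \<omega> * I \<omega> * I' \<omega>)"
    unfolding I_def I'_def by (rule iso)+
  have g: "integrable NN (\<lambda>z. \<zeta> (fst z) * indicator {s<..t} (snd z) * G z * G z)"
      "integrable NN (\<lambda>z. \<zeta> (fst z) * indicator {s<..t} (snd z) * G' z * G' z)"
      "integrable NN (\<lambda>z. \<zeta> (fst z) * indicator {s<..t} (snd z) * G z * G' z)"
    unfolding G_def G'_def by (rule iso)+
  have eq: "expectation (\<lambda>\<omega>. \<zeta> \<omega> * I \<omega> * I \<omega>) = (\<integral>z. \<zeta> (fst z) * indicator {s<..t} (snd z) * G z * G z \<partial>NN)"
      "expectation (\<lambda>\<omega>. \<zeta> \<omega> * I' \<omega> * I' \<omega>) = (\<integral>z. \<zeta> (fst z) * indicator {s<..t} (snd z) * G' z * G' z \<partial>NN)"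
      "expectation (\<lambda>\<omega>. \<zeta> \<omega> * I \<omega> * I' \<omega>) = (\<integral>z. \<zeta> (fst z) * indicator {s<..t} (snd z) * G z * G' z \<partial>NN)"
    unfolding G_def G'_def I_def I'_def by (rule iso)+
  have e1: "(\<lambda>\<omega>. \<zeta> \<omega> * (I \<omega> - I' \<omega>)\<^sup>2) =
    (\<lambda>\<omega>. \<zeta> \<omega> * I \<omega> * I \<omega> + \<zeta> \<omega> * I' \<omega> * I' \<omega> - 2 * (\<zeta> \<omega> * I \<omega> * I' \<omega>))"
    by (simp add: fun_eq_iff power2_eq_square algebra_simps)
  have e2: "(\<lambda>z. \<zeta> (fst z) * (indicator {s<..t} (snd z) * (G z - G' z))\<^sup>2) =
    (\<lambda>z. \<zeta> (fst z) * indicator {s<..t} (snd z) * G z * G z + \<zeta> (fst z) * indicator {s<..t} (snd z) * G' z * G' z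
        - 2 * (\<zeta> (fst z) * indicator {s<..t} (snd z) * G z * G' z))"
    by (simp add: fun_eq_iff power2_eq_square algebra_simps indicator_def)
  show "integrable M (\<lambda>\<omega>. \<zeta> \<omega> * (I \<omega> - I' \<omega>)\<^sup>2)"
    unfolding e1 using i by simp
  show "integrable NN (\<lambda>z. \<zeta> (fst z) * (indicator {s<..t} (snd z) * (G z - G' z))\<^sup>2)"
    unfolding e2 using g by simp
  show "expectation (\<lambda>\<omega>. \<zeta> \<omega> * (I \<omega> - I' \<omega>)\<^sup>2) =
      (\<integral>z. \<zeta> (fst z) * (indicator {s<..t} (snd z) * (G z - G' z))\<^sup>2 \<partial>NN)"
    unfolding e1 e2 using i g eq by simp
qed

end

section \<open>The Ito integral as a square-integrable martingale\<close>

locale ito_process = brownian_filtration +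
  fixes H Y :: "real \<Rightarrow> 'a \<Rightarrow> real"
  assumes H_measurable: "(\<lambda>z. H (max 0 (snd z)) (fst z)) \<in> borel_measurable NN"
    and ito: "0 \<le> t \<Longrightarrow> has_ito_integral M F W H t (Y t)"
begin

text \<open>Clamping the time at 0 keeps the arbitrary values at negative times out of the product
  space.\<close>

definition Hm :: "'a \<times> real \<Rightarrow> real" where
  "Hm z = H (max 0 (snd z)) (fst z)"

lemma Hm_measurable [measurable]: "Hm \<in> borel_measurable NN"
  unfolding Hm_def[abs_def] by (rule H_measurable)

lemma Y_measurable: "0 \<le> t \<Longrightarrow> Y t \<in> borel_measurable M"
  using ito unfolding has_ito_integral_def by blast

lemma snd_measurable_NN [measurable]: "snd \<in> borel_measurable NN"
  unfolding NN_def by simp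

lemma fst_measurable_NN [measurable]: "fst \<in> measurable NN M"
  unfolding NN_def by simp

text \<open>The definition of the integral, read on the product space. Only an upper bound for the
  approximation error is wanted, so \<open>Hm\<close> and the half-open interval may replace
  \<open>H\<close> and \<open>{0..t}\<close> pointwise.\<close>

lemma ito_approx:
  assumes t: "0 \<le> t"
  obtains n p \<xi> where "\<And>k. simple_integrand M F (n k) (p k) (\<xi> k)"
    and "(\<lambda>k. \<integral>\<^sup>+z. ennreal ((indicator {0<..t} (snd z) * (Hm z - simple_process (n k) (p k) (\<xi> k) (snd z) (fst z)))\<^sup>2) \<partial>NN) \<longlonglongrightarrow> 0"
    and "(\<lambda>k. \<integral>\<^sup>+\<omega>. ennreal ((Y t \<omega> - simple_ito_integral W (n k) (p k) (\<xi> k) t \<omega>)\<^sup>2) \<partial>M) \<longlonglongrightarrow> 0"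
proof -
  obtain n p \<xi> where si: "\<And>k. simple_integrand M F (n k) (p k) (\<xi> k)"
    and lim: "(\<lambda>k. \<integral>\<^sup>+\<omega>. (\<integral>\<^sup>+s\<in>{0..t}.
            ennreal ((H s \<omega> - simple_process (n k) (p k) (\<xi> k) s \<omega>)\<^sup>2) \<partial>lborel) \<partial>M) \<longlonglongrightarrow> 0"
    and lim2: "(\<lambda>k. \<integral>\<^sup>+\<omega>. ennreal ((Y t \<omega> - simple_ito_integral W (n k) (p k) (\<xi> k) t \<omega>)\<^sup>2) \<partial>M) \<longlonglongrightarrow> 0"
    using ito[OF t] unfolding has_ito_integral_def by blast
  have "(\<integral>\<^sup>+z. ennreal ((indicator {0<..t} (snd z) * (Hm z - simple_process (n k) (p k) (\<xi> k) (snd z) (fst z)))\<^sup>2) \<partial>NN)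
      \<le> (\<integral>\<^sup>+\<omega>. (\<integral>\<^sup>+s\<in>{0..t}. ennreal ((H s \<omega> - simple_process (n k) (p k) (\<xi> k) s \<omega>)\<^sup>2) \<partial>lborel) \<partial>M)" for k
  proof -
    have [measurable]: "(\<lambda>z. simple_process (n k) (p k) (\<xi> k) (snd z) (fst z)) \<in> borel_measurable NN"
      by (rule simple_process_measurable[OF si])
    have m: "(\<lambda>z. ennreal ((indicator {0<..t} (snd z) * (Hm z - simple_process (n k) (p k) (\<xi> k) (snd z) (fst z)))\<^sup>2))
       \<in> borel_measurable (M \<Otimes>\<^sub>M lborel)"
      unfolding NN_def[symmetric] by measurable
    have "(\<integral>\<^sup>+z. ennreal ((indicator {0<..t} (snd z) * (Hm z - simple_process (n k) (p k) (\<xi> k) (snd z) (fst z)))\<^sup>2) \<partial>NN)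
      = (\<integral>\<^sup>+\<omega>. (\<integral>\<^sup>+s. ennreal ((indicator {0<..t} s * (Hm (\<omega>, s) - simple_process (n k) (p k) (\<xi> k) s \<omega>))\<^sup>2) \<partial>lborel) \<partial>M)"
      unfolding NN_def using lborel.nn_integral_fst[OF m] by simp
    also have "\<dots> \<le> (\<integral>\<^sup>+\<omega>. (\<integral>\<^sup>+s\<in>{0..t}. ennreal ((H s \<omega> - simple_process (n k) (p k) (\<xi> k) s \<omega>)\<^sup>2) \<partial>lborel) \<partial>M)"
      by (intro nn_integral_mono) (auto simp: indicator_def Hm_def)
    finally show ?thesis .
  qed
  then have "(\<lambda>k. \<integral>\<^sup>+z. ennreal ((indicator {0<..t} (snd z) * (Hm z - simple_process (n k) (p k) (\<xi> k) (snd z) (fst z)))\<^sup>2) \<partial>NN) \<longlonglongrightarrow> 0"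
    by (intro tendsto_sandwich[OF _ _ tendsto_const lim]) auto
  from that[OF si this lim2] show ?thesis .
qed

lemma nn_integral_simple_isometry:
  assumes sx: "simple_integrand M F n p \<xi>" and sy: "simple_integrand M F n' p' \<xi>'" and t: "0 \<le> t"
  shows "(\<integral>\<^sup>+\<omega>. ennreal ((simple_ito_integral W n p \<xi> t \<omega> - simple_ito_integral W n' p' \<xi>' t \<omega>)\<^sup>2) \<partial>M) =
    (\<integral>\<^sup>+z. ennreal ((indicator {0<..t} (snd z) *
       (simple_process n p \<xi> (snd z) (fst z) - simple_process n' p' \<xi>' (snd z) (fst z)))\<^sup>2) \<partial>NN)"
  using simple_isometry_diff[OF sx sy order_refl t bounded_at_const[of 0 1]]
  by (simp add: simple_ito_0[OF sx] simple_ito_0[OF sy] nn_integral_eq_integral)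

text \<open>\<open>has_ito_integral\<close> provides a separate approximating sequence for each
  time. By the isometry, two sequences whose integrands both approximate \<open>Hm\<close> on
  \<open>(0, t]\<close> have integrals that merge at \<open>t\<close>; so the sequence chosen for
  \<open>T\<close> serves all earlier times, and with them the increments of
  \<open>Y\<close>.\<close>

lemma ito_approx_all:
  assumes T: "0 \<le> T"
  obtains n p \<xi> where "\<And>k. simple_integrand M F (n k) (p k) (\<xi> k)"
    and "(\<lambda>k. \<integral>\<^sup>+z. ennreal ((indicator {0<..T} (snd z) * (Hm z - simple_process (n k) (p k) (\<xi> k) (snd z) (fst z)))\<^sup>2) \<partial>NN) \<longlonglongrightarrow> 0"
    and "\<And>s t. 0 \<le> s \<Longrightarrow> s \<le> t \<Longrightarrow> t \<le> T \<Longrightarrow> (\<lambda>k. \<integral>\<^sup>+\<omega>. ennreal (((Y t \<omega> - Y s \<omega>) -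
        (simple_ito_integral W (n k) (p k) (\<xi> k) t \<omega> - simple_ito_integral W (n k) (p k) (\<xi> k) s \<omega>))\<^sup>2) \<partial>M) \<longlonglongrightarrow> 0"
proof -
  obtain n p \<xi> where si: "\<And>k. simple_integrand M F (n k) (p k) (\<xi> k)"
    and lim: "(\<lambda>k. \<integral>\<^sup>+z. ennreal ((indicator {0<..T} (snd z) * (Hm z - simple_process (n k) (p k) (\<xi> k) (snd z) (fst z)))\<^sup>2) \<partial>NN) \<longlonglongrightarrow> 0"
    and lim3: "(\<lambda>k. \<integral>\<^sup>+\<omega>. ennreal ((Y T \<omega> - simple_ito_integral W (n k) (p k) (\<xi> k) T \<omega>)\<^sup>2) \<partial>M) \<longlonglongrightarrow> 0"
    by (rule ito_approx[OF T], rule that)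
  have [measurable]: "(\<lambda>z. simple_process (n k) (p k) (\<xi> k) (snd z) (fst z)) \<in> borel_measurable NN" for k
    by (rule simple_process_measurable[OF si])
  have *: "(\<lambda>k. \<integral>\<^sup>+\<omega>. ennreal ((Y t \<omega> - simple_ito_integral W (n k) (p k) (\<xi> k) t \<omega>)\<^sup>2) \<partial>M) \<longlonglongrightarrow> 0"
    if t: "0 \<le> t" "t \<le> T" for t
  proof -
    obtain n' p' \<xi>' where si': "\<And>k. simple_integrand M F (n' k) (p' k) (\<xi>' k)"
      and lim1: "(\<lambda>k. \<integral>\<^sup>+z. ennreal ((indicator {0<..t} (snd z) * (Hm z - simple_process (n' k) (p' k) (\<xi>' k) (snd z) (fst z)))\<^sup>2) \<partial>NN) \<longlonglongrightarrow> 0"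
      and lim2: "(\<lambda>k. \<integral>\<^sup>+\<omega>. ennreal ((Y t \<omega> - simple_ito_integral W (n' k) (p' k) (\<xi>' k) t \<omega>)\<^sup>2) \<partial>M) \<longlonglongrightarrow> 0"
      by (rule ito_approx[OF t(1)], rule that)
    have [measurable]: "(\<lambda>z. simple_process (n' k) (p' k) (\<xi>' k) (snd z) (fst z)) \<in> borel_measurable NN" for k
      by (rule simple_process_measurable[OF si'])
    have [measurable]: "simple_ito_integral W (n k) (p k) (\<xi> k) t \<in> borel_measurable M"
        "simple_ito_integral W (n' k) (p' k) (\<xi>' k) t \<in> borel_measurable M" for k
      using simple_ito_measurable si si' t by auto
    have [measurable]: "Y t \<in> borel_measurable M" using Y_measurable t by simp
    have a: "(\<integral>\<^sup>+z. ennreal ((indicator {0<..t} (snd z) *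
       (simple_process (n' k) (p' k) (\<xi>' k) (snd z) (fst z) - simple_process (n k) (p k) (\<xi> k) (snd z) (fst z)))\<^sup>2) \<partial>NN)
       \<le> 2 * (\<integral>\<^sup>+z. ennreal ((indicator {0<..t} (snd z) * (Hm z - simple_process (n' k) (p' k) (\<xi>' k) (snd z) (fst z)))\<^sup>2) \<partial>NN)
       + 2 * (\<integral>\<^sup>+z. ennreal ((indicator {0<..T} (snd z) * (Hm z - simple_process (n k) (p k) (\<xi> k) (snd z) (fst z)))\<^sup>2) \<partial>NN)" for k
      using t by (intro nn_integral_sq_triangle) (measurable, measurable, auto simp: indicator_def)
    note l3 = tendsto_0_twice_sum[OF lim1 lim a]
    have b: "(\<integral>\<^sup>+\<omega>. ennreal ((Y t \<omega> - simple_ito_integral W (n k) (p k) (\<xi> k) t \<omega>)\<^sup>2) \<partial>M) \<le>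
       2 * (\<integral>\<^sup>+\<omega>. ennreal ((Y t \<omega> - simple_ito_integral W (n' k) (p' k) (\<xi>' k) t \<omega>)\<^sup>2) \<partial>M) +
       2 * (\<integral>\<^sup>+\<omega>. ennreal ((simple_ito_integral W (n' k) (p' k) (\<xi>' k) t \<omega> - simple_ito_integral W (n k) (p k) (\<xi> k) t \<omega>)\<^sup>2) \<partial>M)" for k
      by (intro nn_integral_sq_triangle) (use si si' t in \<open>auto intro!: borel_measurable_diff simple_ito_measurable Y_measurable\<close>)
    show ?thesis
      by (rule tendsto_0_twice_sum[OF lim2 l3 b[unfolded nn_integral_simple_isometry[OF si' si t(1)]]])
  qed
  have "(\<lambda>k. \<integral>\<^sup>+\<omega>. ennreal (((Y t \<omega> - Y s \<omega>) -
        (simple_ito_integral W (n k) (p k) (\<xi> k) t \<omega> - simple_ito_integral W (n k) (p k) (\<xi> k) s \<omega>))\<^sup>2) \<partial>M) \<longlonglongrightarrow> 0"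
    if st: "0 \<le> s" "s \<le> t" "t \<le> T" for s t
  proof -
    have l: "(\<lambda>k. \<integral>\<^sup>+\<omega>. ennreal ((Y t \<omega> - simple_ito_integral W (n k) (p k) (\<xi> k) t \<omega>)\<^sup>2) \<partial>M) \<longlonglongrightarrow> 0"
        "(\<lambda>k. \<integral>\<^sup>+\<omega>. ennreal ((Y s \<omega> - simple_ito_integral W (n k) (p k) (\<xi> k) s \<omega>)\<^sup>2) \<partial>M) \<longlonglongrightarrow> 0"
      using *[of s] *[of t] st by auto
    have [measurable]: "simple_ito_integral W (n k) (p k) (\<xi> k) t \<in> borel_measurable M"
        "simple_ito_integral W (n k) (p k) (\<xi> k) s \<in> borel_measurable M" for k
      using simple_ito_measurable si st by auto
    have [measurable]: "Y t \<in> borel_measurable M" "Y s \<in> borel_measurable M" using Y_measurable st by auto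
    show ?thesis
      by (rule tendsto_0_twice_sum[OF l], rule nn_integral_sq_triangle) (use si st in \<open>auto intro!: borel_measurable_diff simple_ito_measurable Y_measurable\<close>)
  qed
  from that[OF si lim this] show ?thesis by blast
qed

text \<open>Limit of \<open>simple_isometry_diff\<close> on both sides. A simple integral is
  subtracted because two cases are used: the zero integrand gives the isometry for \<open>Y\<close>,
  and a good approximation measures the part of \<open>Hm\<close> that is not simple.\<close>

lemma ito_isometry:
  assumes sx: "simple_integrand M F m q \<eta>" and st: "0 \<le> s" "s \<le> t" and z: "bounded_at s \<zeta>"
  defines "D \<equiv> \<lambda>\<omega>. (Y t \<omega> - Y s \<omega>) - (simple_ito_integral W m q \<eta> t \<omega> - simple_ito_integral W m q \<eta> s \<omega>)"
    and "G \<equiv> \<lambda>z. indicator {s<..t} (snd z) * (Hm z - simple_process m q \<eta> (snd z) (fst z))"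
  shows "integrable M (\<lambda>\<omega>. (D \<omega>)\<^sup>2)" and "integrable NN (\<lambda>z. \<zeta> (fst z) * (G z)\<^sup>2)"
    and "expectation (\<lambda>\<omega>. \<zeta> \<omega> * (D \<omega>)\<^sup>2) = (\<integral>z. \<zeta> (fst z) * (G z)\<^sup>2 \<partial>NN)"
proof -
  have t0: "0 \<le> t" using st by simp
  obtain n p \<xi> where si: "\<And>k. simple_integrand M F (n k) (p k) (\<xi> k)"
    and lim1: "(\<lambda>k. \<integral>\<^sup>+z. ennreal ((indicator {0<..t} (snd z) * (Hm z - simple_process (n k) (p k) (\<xi> k) (snd z) (fst z)))\<^sup>2) \<partial>NN) \<longlonglongrightarrow> 0"
    and lims: "\<And>r u. 0 \<le> r \<Longrightarrow> r \<le> u \<Longrightarrow> u \<le> t \<Longrightarrow> (\<lambda>k. \<integral>\<^sup>+\<omega>. ennreal (((Y u \<omega> - Y r \<omega>) -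
        (simple_ito_integral W (n k) (p k) (\<xi> k) u \<omega> - simple_ito_integral W (n k) (p k) (\<xi> k) r \<omega>))\<^sup>2) \<partial>M) \<longlonglongrightarrow> 0"
    by (rule ito_approx_all[OF t0], rule that)
  note lim2 = lims[OF st order_refl]
  define J where "J k \<omega> = (simple_ito_integral W (n k) (p k) (\<xi> k) t \<omega> - simple_ito_integral W (n k) (p k) (\<xi> k) s \<omega>)
     - (simple_ito_integral W m q \<eta> t \<omega> - simple_ito_integral W m q \<eta> s \<omega>)" for k \<omega>
  define K where "K k z = indicator {s<..t} (snd z) * (simple_process (n k) (p k) (\<xi> k) (snd z) (fst z) - simple_process m q \<eta> (snd z) (fst z))" for k z
  have [measurable]: "(\<lambda>z. simple_process (n k) (p k) (\<xi> k) (snd z) (fst z)) \<in> borel_measurable NN"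
      "(\<lambda>z. simple_process m q \<eta> (snd z) (fst z)) \<in> borel_measurable NN" for k
    using simple_process_measurable si sx by auto
  have [measurable]: "simple_ito_integral W (n k) (p k) (\<xi> k) t \<in> borel_measurable M"
      "simple_ito_integral W (n k) (p k) (\<xi> k) s \<in> borel_measurable M" for k
    using simple_ito_measurable si st by auto
  have [measurable]: "simple_ito_integral W m q \<eta> t \<in> borel_measurable M"
      "simple_ito_integral W m q \<eta> s \<in> borel_measurable M"
    using simple_ito_measurable sx st by auto
  have [measurable]: "Y t \<in> borel_measurable M" "Y s \<in> borel_measurable M" using Y_measurable st by auto
  have [measurable]: "\<zeta> \<in> borel_measurable M" using bounded_at_measurable[OF z] .
  obtain C where C: "C \<ge> 0" "\<And>\<omega>. \<omega> \<in> space M \<Longrightarrow> \<bar>\<zeta> \<omega>\<bar> \<le> C"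
    using bounded_at_bound[OF z] by blast
  note iso = simple_isometry_diff[OF si sx st z] simple_isometry_diff[OF si sx st bounded_at_const[of _ 1]]
  have iJ: "integrable M (\<lambda>\<omega>. (J k \<omega>)\<^sup>2)" for k
    using iso(4)[of k] unfolding J_def by simp
  have iK: "integrable NN (\<lambda>z. (K k z)\<^sup>2)" for k
    using iso(5)[of k] unfolding K_def by simp
  have mD: "D \<in> borel_measurable M" "G \<in> borel_measurable NN" "\<And>k. J k \<in> borel_measurable M" "\<And>k. K k \<in> borel_measurable NN"
    unfolding D_def G_def J_def[abs_def] K_def[abs_def] by measurable
  have l2: "(\<lambda>k. \<integral>\<^sup>+\<omega>. ennreal ((D \<omega> - J k \<omega>)\<^sup>2) \<partial>M) \<longlonglongrightarrow> 0"
    using lim2 unfolding D_def J_def by (simp add: algebra_simps)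
  have le: "(\<integral>\<^sup>+z. ennreal ((G z - K k z)\<^sup>2) \<partial>NN) \<le>
    (\<integral>\<^sup>+z. ennreal ((indicator {0<..t} (snd z) * (Hm z - simple_process (n k) (p k) (\<xi> k) (snd z) (fst z)))\<^sup>2) \<partial>NN)" for k
    unfolding G_def K_def using st by (intro nn_integral_mono) (auto simp: indicator_def)
  have l1: "(\<lambda>k. \<integral>\<^sup>+z. ennreal ((G z - K k z)\<^sup>2) \<partial>NN) \<longlonglongrightarrow> 0"
    using le by (intro tendsto_sandwich[OF _ _ tendsto_const lim1]) auto
  have sp: "fst z \<in> space M" if "z \<in> space NN" for z
    using that unfolding NN_def space_pair_measure by auto
  note L = L2_limit[OF mD(3) mD(1) \<open>\<zeta> \<in> borel_measurable M\<close> iJ l2 C(2)]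
  have mz: "(\<lambda>z. \<zeta> (fst z)) \<in> borel_measurable NN" by measurable
  note L' = L2_limit[OF mD(4) mD(2) mz iK l1 C(2)[OF sp]]
  show "integrable M (\<lambda>\<omega>. (D \<omega>)\<^sup>2)" using L(1) by simp
  show "integrable NN (\<lambda>z. \<zeta> (fst z) * (G z)\<^sup>2)" using L'(2) by simp
  have "expectation (\<lambda>\<omega>. \<zeta> \<omega> * (J k \<omega>)\<^sup>2) = (\<integral>z. \<zeta> (fst z) * (K k z)\<^sup>2 \<partial>NN)" for k
    using iso(3)[of k] unfolding J_def K_def .
  then have "(\<lambda>k. expectation (\<lambda>\<omega>. \<zeta> \<omega> * (J k \<omega>)\<^sup>2)) \<longlonglongrightarrow> (\<integral>z. \<zeta> (fst z) * (G z)\<^sup>2 \<partial>NN)"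
    using L'(3) by simp
  with L(3) show "expectation (\<lambda>\<omega>. \<zeta> \<omega> * (D \<omega>)\<^sup>2) = (\<integral>z. \<zeta> (fst z) * (G z)\<^sup>2 \<partial>NN)"
    by (intro LIMSEQ_unique) auto
qed

lemma zero_simple_integrand: "simple_integrand M F 0 (\<lambda>_. 0) \<xi>"
  unfolding simple_integrand_def by simp

lemma ito_increment_square:
  assumes st: "0 \<le> s" "s \<le> t" and z: "bounded_at s \<zeta>"
  shows "integrable M (\<lambda>\<omega>. (Y t \<omega> - Y s \<omega>)\<^sup>2)"
    and "integrable NN (\<lambda>z. \<zeta> (fst z) * (indicator {s<..t} (snd z) * Hm z)\<^sup>2)"
    and "expectation (\<lambda>\<omega>. \<zeta> \<omega> * (Y t \<omega> - Y s \<omega>)\<^sup>2) =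
      (\<integral>z. \<zeta> (fst z) * (indicator {s<..t} (snd z) * Hm z)\<^sup>2 \<partial>NN)"
  using ito_isometry[OF zero_simple_integrand st z]
  by (simp_all add: simple_ito_integral_def simple_process_def)

lemma ito_increment_integrable:
  assumes st: "0 \<le> s" "s \<le> t"
  shows "integrable M (\<lambda>\<omega>. Y t \<omega> - Y s \<omega>)"
proof (rule square_integrable_imp_integrable)
  show "(\<lambda>\<omega>. Y t \<omega> - Y s \<omega>) \<in> borel_measurable M" using Y_measurable st by auto
  show "integrable M (\<lambda>\<omega>. (Y t \<omega> - Y s \<omega>)\<^sup>2)" by (rule ito_increment_square(1)[OF st bounded_at_const])
qed

lemma ito_martingale:
  assumes st: "0 \<le> s" "s \<le> t" and z: "bounded_at s \<zeta>"
  shows "expectation (\<lambda>\<omega>. \<zeta> \<omega> * (Y t \<omega> - Y s \<omega>)) = 0"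
proof -
  have t0: "0 \<le> t" using st by simp
  obtain n p \<xi> where si: "\<And>k. simple_integrand M F (n k) (p k) (\<xi> k)"
    and lim1: "(\<lambda>k. \<integral>\<^sup>+z. ennreal ((indicator {0<..t} (snd z) * (Hm z - simple_process (n k) (p k) (\<xi> k) (snd z) (fst z)))\<^sup>2) \<partial>NN) \<longlonglongrightarrow> 0"
    and lims: "\<And>r u. 0 \<le> r \<Longrightarrow> r \<le> u \<Longrightarrow> u \<le> t \<Longrightarrow> (\<lambda>k. \<integral>\<^sup>+\<omega>. ennreal (((Y u \<omega> - Y r \<omega>) -
        (simple_ito_integral W (n k) (p k) (\<xi> k) u \<omega> - simple_ito_integral W (n k) (p k) (\<xi> k) r \<omega>))\<^sup>2) \<partial>M) \<longlonglongrightarrow> 0"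
    by (rule ito_approx_all[OF t0], rule that)
  note lim2 = lims[OF st order_refl]
  define D where "D \<omega> = Y t \<omega> - Y s \<omega>" for \<omega>
  define J where "J k \<omega> = simple_ito_integral W (n k) (p k) (\<xi> k) t \<omega> - simple_ito_integral W (n k) (p k) (\<xi> k) s \<omega>" for k \<omega>
  have mJ [measurable]: "J k \<in> borel_measurable M" for k
    unfolding J_def[abs_def] using simple_ito_measurable[OF si] st by (intro borel_measurable_diff) auto
  have mD [measurable]: "D \<in> borel_measurable M" unfolding D_def[abs_def] using Y_measurable st by auto
  have mz [measurable]: "\<zeta> \<in> borel_measurable M" using bounded_at_measurable[OF z] .
  obtain C where C: "C \<ge> 0" "\<And>\<omega>. \<omega> \<in> space M \<Longrightarrow> \<bar>\<zeta> \<omega>\<bar> \<le> C"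
    using bounded_at_bound[OF z] by blast
  have iJ2: "integrable M (\<lambda>\<omega>. (J k \<omega>)\<^sup>2)" for k
    using simple_isometry(1)[OF si si st bounded_at_const[of _ 1], of k] by (simp add: J_def power2_eq_square)
  have iJ: "integrable M (J k)" for k
    using simple_martingale(1)[OF si st bounded_at_const[of _ 1], of k] by (simp add: J_def[abs_def])
  have EJ: "expectation (\<lambda>\<omega>. \<zeta> \<omega> * J k \<omega>) = 0" for k
    using simple_martingale(2)[OF si st z, of k] by (simp add: J_def)
  have l: "(\<lambda>k. \<integral>\<^sup>+\<omega>. ennreal ((D \<omega> - J k \<omega>)\<^sup>2) \<partial>M) \<longlonglongrightarrow> 0"
    using lim2 unfolding D_def J_def .
  note L = L2_limit[OF mJ mD mz iJ2 l C(2)]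
  \<comment> \<open>\<open>L2_limit\<close> speaks about squares only. Adding 1 before squaring
    brings out the linear term: the weighted limits of \<open>(1 + J)^2\<close> and
    \<open>J^2\<close> are both known, and these squares differ by \<open>1 + 2 J\<close>.\<close>
  have l': "(\<lambda>k. \<integral>\<^sup>+\<omega>. ennreal (((1 + D \<omega>) - (1 + J k \<omega>))\<^sup>2) \<partial>M) \<longlonglongrightarrow> 0"
    using l by simp
  have iJ2': "integrable M (\<lambda>\<omega>. (1 + J k \<omega>)\<^sup>2)" for k
    using iJ[of k] iJ2[of k] by (simp add: power2_sum)
  have m': "(\<lambda>\<omega>. 1 + J k \<omega>) \<in> borel_measurable M" "(\<lambda>\<omega>. 1 + D \<omega>) \<in> borel_measurable M" for k
    by measurable
  note L' = L2_limit[OF m'(1) m'(2) mz iJ2' l' C(2)]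
  have iD: "integrable M D" unfolding D_def[abs_def] by (rule ito_increment_integrable[OF st])
  have split: "expectation (\<lambda>\<omega>. \<zeta> \<omega> * (1 + h \<omega>)\<^sup>2) =
      expectation \<zeta> + 2 * expectation (\<lambda>\<omega>. \<zeta> \<omega> * h \<omega>) + expectation (\<lambda>\<omega>. \<zeta> \<omega> * (h \<omega>)\<^sup>2)"
    if h: "integrable M h" "integrable M (\<lambda>\<omega>. (h \<omega>)\<^sup>2)" for h
  proof -
    have "(\<lambda>\<omega>. \<zeta> \<omega> * (1 + h \<omega>)\<^sup>2) = (\<lambda>\<omega>. \<zeta> \<omega> + 2 * (\<zeta> \<omega> * h \<omega>) + \<zeta> \<omega> * (h \<omega>)\<^sup>2)"
      by (simp add: fun_eq_iff power2_sum algebra_simps)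
    then show ?thesis
      using integrable_bounded_mult[OF z h(1)] integrable_bounded_mult[OF z h(2)] bounded_at_integrable[OF z] by simp
  qed
  have "(\<lambda>k. expectation (\<lambda>\<omega>. \<zeta> \<omega> * (1 + J k \<omega>)\<^sup>2)) \<longlonglongrightarrow> expectation \<zeta> + expectation (\<lambda>\<omega>. \<zeta> \<omega> * (D \<omega>)\<^sup>2)"
    unfolding split[OF iJ iJ2] EJ using tendsto_add[OF tendsto_const[of "expectation \<zeta>"] L(3)] by simp
  from LIMSEQ_unique[OF this L'(3)] have "expectation (\<lambda>\<omega>. \<zeta> \<omega> * D \<omega>) = 0"
    using split[OF iD L(1)] by simp
  then show ?thesis by (simp add: D_def)
qed

text \<open>Uniform integrability of the squared increments: the part of \<open>H\<close> that is not simple is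
  small in mean square, and the simple part has fourth moments of order \<open>(t - s)\<^sup>2\<close>.\<close>

lemma ito_square_weighted:
  assumes T: "0 \<le> T" and \<epsilon>: "0 < \<epsilon>"
  obtains d \<kappa> where "\<And>t. t \<le> T \<Longrightarrow> integrable NN (\<lambda>z. indicator {0<..t} (snd z) * d z)"
    "(\<integral>z. indicator {0<..T} (snd z) * d z \<partial>NN) \<le> \<epsilon>"
    "\<And>s t \<theta>. 0 \<le> s \<Longrightarrow> s \<le> t \<Longrightarrow> t \<le> T \<Longrightarrow> \<theta> \<in> borel_measurable M \<Longrightarrow>
      (\<And>\<omega>. 0 \<le> \<theta> \<omega>) \<Longrightarrow> (\<And>\<omega>. \<theta> \<omega> \<le> 1) \<Longrightarrow>
      expectation (\<lambda>\<omega>. \<theta> \<omega> * (Y t \<omega> - Y s \<omega>)\<^sup>2) \<le>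
        (\<integral>z. indicator {s<..t} (snd z) * d z \<partial>NN) + (\<kappa> * expectation \<theta> + \<epsilon>) * (t - s)"
proof -
  obtain n p \<xi> where si: "\<And>k. simple_integrand M F (n k) (p k) (\<xi> k)"
    and lim: "(\<lambda>k. \<integral>\<^sup>+z. ennreal ((indicator {0<..T} (snd z) * (Hm z - simple_process (n k) (p k) (\<xi> k) (snd z) (fst z)))\<^sup>2) \<partial>NN) \<longlonglongrightarrow> 0"
    and lim3: "(\<lambda>k. \<integral>\<^sup>+\<omega>. ennreal ((Y T \<omega> - simple_ito_integral W (n k) (p k) (\<xi> k) T \<omega>)\<^sup>2) \<partial>M) \<longlonglongrightarrow> 0"
    by (rule ito_approx[OF T], rule that)
  have "eventually (\<lambda>k. (\<integral>\<^sup>+z. ennreal ((indicator {0<..T} (snd z) * (Hm z - simple_process (n k) (p k) (\<xi> k) (snd z) (fst z)))\<^sup>2) \<partial>NN) < ennreal (\<epsilon> / 2)) sequentially"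
    using \<epsilon> by (intro order_tendstoD(2)[OF lim]) simp
  then obtain k where k: "(\<integral>\<^sup>+z. ennreal ((indicator {0<..T} (snd z) * (Hm z - simple_process (n k) (p k) (\<xi> k) (snd z) (fst z)))\<^sup>2) \<partial>NN) < ennreal (\<epsilon> / 2)"
    using eventually_happens'[of sequentially] by auto
  define S where "S t \<omega> = simple_ito_integral W (n k) (p k) (\<xi> k) t \<omega>" for t \<omega>
  define d where "d z = 2 * (Hm z - simple_process (n k) (p k) (\<xi> k) (snd z) (fst z))\<^sup>2" for z
  obtain C where C: "C \<ge> 0" "\<And>s t. 0 \<le> s \<Longrightarrow> s \<le> t \<Longrightarrow> integrable M (\<lambda>\<omega>. (S t \<omega> - S s \<omega>) ^ 4) \<and>
      expectation (\<lambda>\<omega>. (S t \<omega> - S s \<omega>) ^ 4) \<le> C * (t - s)\<^sup>2"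
    by (rule simple_fourth_moment[OF si[of k]], rule that, assumption) (simp add: S_def)
  \<comment> \<open>With this value the fourth-moment term
    \<open>C * (t - s)^2 / (\<kappa> * (t - s))\<close> is at most
    \<open>\<epsilon> * (t - s)\<close>; the 1 keeps \<open>\<kappa>\<close> positive when
    \<open>C = 0\<close>.\<close>
  define \<kappa> where "\<kappa> = (C + 1) / \<epsilon>"
  have \<kappa>: "\<kappa> > 0" unfolding \<kappa>_def using C \<epsilon> by simp
  have iso: "integrable M (\<lambda>\<omega>. ((Y t \<omega> - Y s \<omega>) - (S t \<omega> - S s \<omega>))\<^sup>2)"
      "integrable NN (\<lambda>z. indicator {s<..t} (snd z) * d z)"
      "2 * expectation (\<lambda>\<omega>. ((Y t \<omega> - Y s \<omega>) - (S t \<omega> - S s \<omega>))\<^sup>2) = (\<integral>z. indicator {s<..t} (snd z) * d z \<partial>NN)"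
    if st: "0 \<le> s" "s \<le> t" for s t
  proof -
    have e: "indicator {s<..t} (snd z) * d z = 2 * (indicator {s<..t} (snd z) * (Hm z - simple_process (n k) (p k) (\<xi> k) (snd z) (fst z)))\<^sup>2" for z
      unfolding d_def by (auto simp: indicator_def)
    note i = ito_isometry[OF si[of k] st bounded_at_const[of _ 1]]
    show "integrable M (\<lambda>\<omega>. ((Y t \<omega> - Y s \<omega>) - (S t \<omega> - S s \<omega>))\<^sup>2)"
      using i(1) unfolding S_def .
    show "integrable NN (\<lambda>z. indicator {s<..t} (snd z) * d z)" unfolding e using i(2) by simp
    show "2 * expectation (\<lambda>\<omega>. ((Y t \<omega> - Y s \<omega>) - (S t \<omega> - S s \<omega>))\<^sup>2) = (\<integral>z. indicator {s<..t} (snd z) * d z \<partial>NN)"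
      unfolding e using i(3) unfolding S_def by simp
  qed
  have d\<epsilon>: "(\<integral>z. indicator {0<..T} (snd z) * d z \<partial>NN) \<le> \<epsilon>"
  proof -
    have "(\<integral>z. indicator {0<..T} (snd z) * d z \<partial>NN) =
       2 * (\<integral>z. (indicator {0<..T} (snd z) * (Hm z - simple_process (n k) (p k) (\<xi> k) (snd z) (fst z)))\<^sup>2 \<partial>NN)"
      unfolding d_def by (subst integral_mult_right_zero[symmetric], intro Bochner_Integration.integral_cong) (auto simp: indicator_def)
    also have "(\<integral>z. (indicator {0<..T} (snd z) * (Hm z - simple_process (n k) (p k) (\<xi> k) (snd z) (fst z)))\<^sup>2 \<partial>NN) \<le> \<epsilon> / 2"
    proof -
      have "ennreal (\<integral>z. (indicator {0<..T} (snd z) * (Hm z - simple_process (n k) (p k) (\<xi> k) (snd z) (fst z)))\<^sup>2 \<partial>NN) < ennreal (\<epsilon> / 2)"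
        using k ito_isometry(2)[OF si[of k] order_refl T bounded_at_const[of _ 1]]
        by (subst nn_integral_eq_integral[symmetric]) auto
      then show ?thesis using \<epsilon> by (simp add: ennreal_less_iff)
    qed
    finally show ?thesis by simp
  qed
  have dY: "expectation (\<lambda>\<omega>. \<theta> \<omega> * (Y t \<omega> - Y s \<omega>)\<^sup>2) \<le>
        (\<integral>z. indicator {s<..t} (snd z) * d z \<partial>NN) + (\<kappa> * expectation \<theta> + \<epsilon>) * (t - s)"
    if st: "0 \<le> s" "s \<le> t" "t \<le> T" and \<theta>: "\<theta> \<in> borel_measurable M" "\<And>\<omega>. 0 \<le> \<theta> \<omega>" "\<And>\<omega>. \<theta> \<omega> \<le> 1" for s t \<theta>
  proof (cases "s = t")
    case False
    then have lt: "t - s > 0" using st by simp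
    let ?R = "\<lambda>\<omega>. (Y t \<omega> - Y s \<omega>) - (S t \<omega> - S s \<omega>)"
    \<comment> \<open>The increment is split into its non-simple part \<open>a\<close>, where
      \<open>\<theta> \<le> 1\<close> suffices, and its simple part \<open>b\<close>, where Young's
      inequality divides \<open>2 \<theta> b^2\<close> into a multiple of
      \<open>\<theta>^2 \<le> \<theta>\<close> and a fourth power.\<close>
    have pt: "\<theta> \<omega> * (Y t \<omega> - Y s \<omega>)\<^sup>2 \<le>
        2 * (?R \<omega>)\<^sup>2 + (\<kappa> * (t - s) * \<theta> \<omega> + (S t \<omega> - S s \<omega>) ^ 4 / (\<kappa> * (t - s)))" for \<omega>
    proof -
      define a b where "a = ?R \<omega>" and "b = S t \<omega> - S s \<omega>"
      have "(a + b)\<^sup>2 \<le> 2 * a\<^sup>2 + 2 * b\<^sup>2"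
        using sum_squares_bound[of a b] by (simp add: power2_sum)
      then have "\<theta> \<omega> * (a + b)\<^sup>2 \<le> \<theta> \<omega> * (2 * a\<^sup>2) + \<theta> \<omega> * (2 * b\<^sup>2)"
        unfolding distrib_left[symmetric] by (rule mult_left_mono) (rule \<theta>(2))
      also have "\<theta> \<omega> * (2 * a\<^sup>2) \<le> 2 * a\<^sup>2" using \<theta>(2,3)[of \<omega>] by (intro mult_left_le_one_le) auto
      also have "\<theta> \<omega> * (2 * b\<^sup>2) \<le> \<kappa> * (t - s) * \<theta> \<omega> + b ^ 4 / (\<kappa> * (t - s))"
      proof -
        define l where "l = \<kappa> * (t - s)"
        have l: "l > 0" unfolding l_def using \<kappa> lt by simp
        have "0 \<le> (l * \<theta> \<omega> - b\<^sup>2)\<^sup>2 / l" using l by simp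
        also have "\<dots> = l * (\<theta> \<omega>)\<^sup>2 - \<theta> \<omega> * (2 * b\<^sup>2) + b ^ 4 / l"
          using l by (simp add: field_simps eval_nat_numeral)
        also have "\<dots> \<le> l * \<theta> \<omega> - \<theta> \<omega> * (2 * b\<^sup>2) + b ^ 4 / l"
          using l \<theta>(2,3)[of \<omega>] by (simp add: power2_eq_square mult_left_le_one_le)
        finally show ?thesis unfolding l_def by simp
      qed
      finally show ?thesis unfolding a_def b_def by simp
    qed
    have i\<theta>: "integrable M \<theta>"
      using \<theta> by (intro integrable_const_bound[of _ 1]) auto
    note C' = C(2)[OF st(1,2)]
    have iR: "integrable M (\<lambda>\<omega>. 2 * (?R \<omega>)\<^sup>2 + (\<kappa> * (t - s) * \<theta> \<omega> + (S t \<omega> - S s \<omega>) ^ 4 / (\<kappa> * (t - s))))"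
      using iso(1)[OF st(1,2)] i\<theta> C' by simp
    have mY: "(\<lambda>\<omega>. \<theta> \<omega> * (Y t \<omega> - Y s \<omega>)\<^sup>2) \<in> borel_measurable M"
      using \<theta>(1) Y_measurable[of t] Y_measurable[of s] st by simp
    have "expectation (\<lambda>\<omega>. \<theta> \<omega> * (Y t \<omega> - Y s \<omega>)\<^sup>2) \<le>
       expectation (\<lambda>\<omega>. 2 * (?R \<omega>)\<^sup>2 + (\<kappa> * (t - s) * \<theta> \<omega> + (S t \<omega> - S s \<omega>) ^ 4 / (\<kappa> * (t - s))))"
      using pt \<theta>(2) by (intro integral_mono Bochner_Integration.integrable_bound[OF iR mY] iR AE_I2)
        (auto simp del: power2_diff intro: order_trans[OF _ abs_ge_self])
    also have "\<dots> = (\<integral>z. indicator {s<..t} (snd z) * d z \<partial>NN) + \<kappa> * (t - s) * expectation \<theta> +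
         expectation (\<lambda>\<omega>. (S t \<omega> - S s \<omega>) ^ 4) / (\<kappa> * (t - s))"
      using iso(1,3)[OF st(1,2)] i\<theta> C' by simp
    also have "expectation (\<lambda>\<omega>. (S t \<omega> - S s \<omega>) ^ 4) / (\<kappa> * (t - s)) \<le> C * (t - s)\<^sup>2 / (\<kappa> * (t - s))"
      using C' \<kappa> lt by (intro divide_right_mono) auto
    also have "C * (t - s)\<^sup>2 / (\<kappa> * (t - s)) = C / (C + 1) * \<epsilon> * (t - s)"
    proof -
      have *: "C * l\<^sup>2 / (K / \<epsilon> * l) = C / K * \<epsilon> * l" if "l > 0" "K > 0" for l K
        using that \<epsilon> by (simp add: power2_eq_square field_simps)
      have "C + 1 > 0" using C(1) by simp
      then show ?thesis unfolding \<kappa>_def by (rule *[OF lt])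
    qed
    also have "\<dots> \<le> 1 * \<epsilon> * (t - s)"
      using C \<epsilon> lt by (intro mult_right_mono) auto
    finally show ?thesis by (simp add: algebra_simps)
  qed simp
  have di: "integrable NN (\<lambda>z. indicator {0<..t} (snd z) * d z)" if "t \<le> T" for t
    using iso(2)[of 0 t] by (cases "0 \<le> t") auto
  show ?thesis by (rule that[OF di d\<epsilon> dY])
qed

end

section \<open>Reflected processes and maximal inequalities\<close>

text \<open>Index \<open>n\<close> stands for \<open>Suc n\<close> cells, so the mesh
  \<open>T / real (Suc n)\<close> never divides by 0.\<close>

definition grid :: "real \<Rightarrow> nat \<Rightarrow> nat \<Rightarrow> real" where
  "grid T n i = T * real i / real (Suc n)"

lemma grid_0 [simp]: "grid T n 0 = 0"
  and grid_Suc_n [simp]: "grid T n (Suc n) = T"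
  by (simp_all add: grid_def)

lemma grid_nonneg: "0 \<le> T \<Longrightarrow> 0 \<le> grid T n i"
  by (simp add: grid_def)

lemma grid_mono: "0 \<le> T \<Longrightarrow> i \<le> j \<Longrightarrow> grid T n i \<le> grid T n j"
  unfolding grid_def by (intro divide_right_mono mult_left_mono) auto

lemma grid_le: "0 \<le> T \<Longrightarrow> i \<le> Suc n \<Longrightarrow> grid T n i \<le> T"
  using grid_mono[of T i "Suc n" n] by simp

lemma grid_step: "grid T n (Suc i) - grid T n i = T / real (Suc n)"
  unfolding grid_def of_nat_Suc[of i] by (simp add: distrib_left add_divide_distrib)

lemma mesh_tendsto: "(\<lambda>n. T / real (Suc n)) \<longlonglongrightarrow> 0"
  using tendsto_mult_right_zero[OF LIMSEQ_inverse_real_of_nat, of T] by (simp add: divide_inverse)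

lemma grid_modulus:
  fixes g :: "real \<Rightarrow> real"
  assumes "continuous_on {0..T} g" "0 \<le> T" "0 < e"
  shows "eventually (\<lambda>n. \<forall>i\<le>n. \<forall>u\<in>{grid T n i..grid T n (Suc i)}. \<forall>v\<in>{grid T n i..grid T n (Suc i)}. \<bar>g u - g v\<bar> < e) sequentially"
proof -
  have "uniformly_continuous_on {0..T} g"
    using assms by (intro compact_uniformly_continuous) auto
  then obtain d where d: "d > 0" "\<And>u v. u \<in> {0..T} \<Longrightarrow> v \<in> {0..T} \<Longrightarrow> dist v u < d \<Longrightarrow> dist (g v) (g u) < e"
    unfolding uniformly_continuous_on_def using assms(3) by metis
  have "eventually (\<lambda>n. T / real (Suc n) < d) sequentially"
    using d(1) by (intro order_tendstoD(2)[OF mesh_tendsto]) simp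
  then show ?thesis
  proof eventually_elim
    case (elim n)
    show ?case
    proof (intro allI impI ballI)
      fix i u v assume i: "i \<le> n" and u: "u \<in> {grid T n i..grid T n (Suc i)}" and v: "v \<in> {grid T n i..grid T n (Suc i)}"
      have "0 \<le> grid T n i" "grid T n (Suc i) \<le> T"
        using assms i grid_nonneg[of T n i] grid_le[of T "Suc i" n] by auto
      moreover have "\<bar>u - v\<bar> \<le> T / real (Suc n)" using u v grid_step[of T n i] by auto
      ultimately show "\<bar>g u - g v\<bar> < e" using d(2)[of v u] u v elim by (auto simp: dist_real_def)
    qed
  qed
qed

text \<open>The truncation at \<open>K\<close> keeps the running maximum bounded, so that it can be an integrand.\<close>

fun trunc_max :: "real \<Rightarrow> (nat \<Rightarrow> real) \<Rightarrow> nat \<Rightarrow> real" where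
  "trunc_max K s 0 = min K (s 0)"
| "trunc_max K s (Suc i) = max (trunc_max K s i) (min K (s (Suc i)))"

lemma trunc_max_ge: "i \<le> n \<Longrightarrow> min K (s i) \<le> trunc_max K s n"
  by (induction n) (auto simp: le_Suc_eq)

lemma trunc_max_le: "trunc_max K s n \<le> K"
  by (induction n) auto

lemma trunc_max_nonneg: "0 \<le> K \<Longrightarrow> 0 \<le> s 0 \<Longrightarrow> 0 \<le> trunc_max K s n"
  by (induction n) auto

text \<open>Summation by parts: whenever the truncated maximum rises from \<open>N\<close> to
  \<open>N'\<close>, the new value is at most the current \<open>s\<close>, which gives
  \<open>N'^2 - N^2 \<le> 2 (N' - N) s\<close>. Being pathwise, the estimate becomes a maximal
  inequality on taking means, once the sum is compared with a martingale transform.\<close>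

lemma doob_pathwise:
  "(trunc_max K s n)\<^sup>2 \<le> 2 * trunc_max K s n * s n - 2 * (\<Sum>i<n. trunc_max K s i * (s (Suc i) - s i))"
  if "0 \<le> K" "\<And>i. 0 \<le> s i"
proof (induction n)
  case 0
  have "min K (s 0) * min K (s 0) \<le> min K (s 0) * (2 * s 0)"
    using that(1) that(2)[of 0] by (intro mult_left_mono) auto
  then show ?case by (simp add: power2_eq_square mult_ac)
next
  case (Suc n)
  define N N' where "N = trunc_max K s n" and "N' = trunc_max K s (Suc n)"
  have N: "0 \<le> N" unfolding N_def using that by (intro trunc_max_nonneg)
  have "N'\<^sup>2 - N\<^sup>2 \<le> 2 * (N' - N) * s (Suc n)"
  proof (cases "N' = N")
    case False
    then have "N < N'" "N' \<le> s (Suc n)" unfolding N_def N'_def by auto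
    then have "(N' - N) * (N' + N) \<le> (N' - N) * (2 * s (Suc n))" by (intro mult_left_mono) auto
    then show ?thesis by (simp add: power2_eq_square algebra_simps)
  qed simp
  with Suc show ?case unfolding N_def[symmetric] N'_def[symmetric] sum.lessThan_Suc
    by (simp add: algebra_simps)
qed

section \<open>Square-integrable bounds for the reflected path and its reflection term\<close>

locale reflected_process = ito_process +
  fixes X A :: "real \<Rightarrow> 'a \<Rightarrow> real" and b x :: real
  assumes X_adapted: "0 \<le> t \<Longrightarrow> X t \<in> borel_measurable (F (ennreal t))"
    and A_adapted: "0 \<le> t \<Longrightarrow> A t \<in> borel_measurable (F (ennreal t))"
    and X_continuous: "\<omega> \<in> space M \<Longrightarrow> continuous_on {0..} (\<lambda>t. X t \<omega>)"
    and A_continuous: "\<omega> \<in> space M \<Longrightarrow> continuous_on {0..} (\<lambda>t. A t \<omega>)"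
    and X_0: "AE \<omega> in M. X 0 \<omega> = x"
    and X_ge: "AE \<omega> in M. \<forall>t\<ge>0. b \<le> X t \<omega>"
    and A_0: "AE \<omega> in M. A 0 \<omega> = 0"
    and A_mono: "AE \<omega> in M. mono_on {0..} (\<lambda>t. A t \<omega>)"
    and A_flat: "AE \<omega> in M. \<forall>s t. 0 \<le> s \<and> s \<le> t \<and> (\<forall>u\<in>{s..t}. b < X u \<omega>) \<longrightarrow> A t \<omega> = A s \<omega>"
    and Y_eq: "Y t \<omega> = X t \<omega> - X 0 \<omega> - A t \<omega>"
    and b_le_x: "b \<le> x"
begin

text \<open>Collects the almost sure properties in one predicate, so that each pathwise argument
  discards a single null set.\<close>

definition good_path :: "'a \<Rightarrow> bool" where
  "good_path \<omega> \<longleftrightarrow> continuous_on {0..} (\<lambda>t. X t \<omega>) \<and> continuous_on {0..} (\<lambda>t. A t \<omega>) \<and> X 0 \<omega> = x \<and>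
     (\<forall>t\<ge>0. b \<le> X t \<omega>) \<and> A 0 \<omega> = 0 \<and> mono_on {0..} (\<lambda>t. A t \<omega>) \<and>
     (\<forall>s t. 0 \<le> s \<and> s \<le> t \<and> (\<forall>u\<in>{s..t}. b < X u \<omega>) \<longrightarrow> A t \<omega> = A s \<omega>)"

lemma AE_good_path: "AE \<omega> in M. good_path \<omega>"
  using X_0 X_ge A_0 A_mono A_flat AE_space unfolding good_path_def
  by eventually_elim (auto intro: X_continuous A_continuous)

lemma good_pathD:
  assumes "good_path \<omega>"
  shows "X 0 \<omega> = x" "A 0 \<omega> = 0" "continuous_on {0..} (\<lambda>t. X t \<omega>)" "continuous_on {0..} (\<lambda>t. A t \<omega>)"
    and good_path_ge: "0 \<le> t \<Longrightarrow> b \<le> X t \<omega>"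
    and good_path_mono: "0 \<le> s \<Longrightarrow> s \<le> t \<Longrightarrow> A s \<omega> \<le> A t \<omega>"
    and good_path_flat: "0 \<le> s \<Longrightarrow> s \<le> t \<Longrightarrow> (\<And>u. u \<in> {s..t} \<Longrightarrow> b < X u \<omega>) \<Longrightarrow> A t \<omega> = A s \<omega>"
proof -
  show "A s \<omega> \<le> A t \<omega>" if "0 \<le> s" "s \<le> t"
    using assms that mono_onD[of "{0..}" "\<lambda>t. A t \<omega>" s t] unfolding good_path_def by simp
  show "A t \<omega> = A s \<omega>" if "0 \<le> s" "s \<le> t" "\<And>u. u \<in> {s..t} \<Longrightarrow> b < X u \<omega>"
    using assms that unfolding good_path_def by blast
qed (use assms in \<open>simp_all add: good_path_def\<close>)

lemma X_measurable: "0 \<le> t \<Longrightarrow> X t \<in> borel_measurable M"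
  and A_measurable: "0 \<le> t \<Longrightarrow> A t \<in> borel_measurable M"
  using X_adapted A_adapted measurable_F_M by blast+

lemma Y_adapted: "0 \<le> t \<Longrightarrow> Y t \<in> borel_measurable (F (ennreal t))"
proof -
  assume t: "0 \<le> t"
  have "(\<lambda>\<omega>. X t \<omega> - X 0 \<omega> - A t \<omega>) \<in> borel_measurable (F (ennreal t))"
    using X_adapted[OF t] A_adapted[OF t] measurable_F_mono[OF _ X_adapted[of 0], of "ennreal t"]
    by simp
  then show ?thesis by (simp add: Y_eq cong: measurable_cong)
qed

lemma Y_continuous: "\<omega> \<in> space M \<Longrightarrow> continuous_on {0..} (\<lambda>t. Y t \<omega>)"
  unfolding Y_eq by (intro continuous_intros X_continuous A_continuous)

text \<open>By convexity the increments of \<open>\<bar>D\<bar>\<close> dominate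
  \<open>sgn D\<close> times those of \<open>D\<close>. The sum in \<open>doob_pathwise\<close> is
  thus bounded below by a martingale transform with the bounded integrand \<open>N * sgn D\<close>,
  whose mean is 0.\<close>

lemma doob_grid:
  fixes n :: nat
  assumes T: "0 \<le> T" and K: "0 \<le> K"
  defines "N \<equiv> \<lambda>i \<omega>. trunc_max K (\<lambda>j. \<bar>Y (grid T n j) \<omega> - Y 0 \<omega>\<bar>) i"
  shows "N (Suc n) \<in> borel_measurable M"
    and "(\<integral>\<^sup>+\<omega>. ennreal ((N (Suc n) \<omega>)\<^sup>2) \<partial>M) \<le> ennreal (4 * expectation (\<lambda>\<omega>. (Y T \<omega> - Y 0 \<omega>)\<^sup>2))"
proof -
  let ?t = "grid T n"
  define D where "D i \<omega> = Y (?t i) \<omega> - Y 0 \<omega>" for i \<omega>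
  have t: "0 \<le> ?t i" "?t i \<le> ?t (Suc i)" for i using T by (auto intro: grid_nonneg grid_mono)
  have Dad: "D j \<in> borel_measurable (F (ennreal (?t i)))" if "j \<le> i" for i j
  proof -
    have "Y (?t j) \<in> borel_measurable (F (ennreal (?t i)))"
      using that T by (intro measurable_F_mono[OF _ Y_adapted] ennreal_leI grid_mono t)
    moreover have "Y 0 \<in> borel_measurable (F (ennreal (?t i)))"
      using t by (intro measurable_F_mono[OF _ Y_adapted] ennreal_leI) auto
    ultimately show ?thesis unfolding D_def[abs_def] by (rule borel_measurable_diff)
  qed
  have Nad: "N j \<in> borel_measurable (F (ennreal (?t i)))" if "j \<le> i" for i j
    using that
  proof (induction j)
    case 0
    then show ?case unfolding N_def using Dad[of 0 i] by (simp add: D_def)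
  next
    case (Suc j)
    have "(\<lambda>\<omega>. max (N j \<omega>) (min K \<bar>D (Suc j) \<omega>\<bar>)) \<in> borel_measurable (F (ennreal (?t i)))"
      using Suc Dad[of "Suc j" i] by (intro borel_measurable_max borel_measurable_min borel_measurable_abs) auto
    then show ?case unfolding N_def D_def by simp
  qed
  have N0: "0 \<le> N i \<omega>" "N i \<omega> \<le> K" for i \<omega>
    unfolding N_def using K by (auto intro: trunc_max_nonneg trunc_max_le)
  have Nb: "bounded_at (?t i) (\<lambda>\<omega>. N i \<omega> * sgn (D i \<omega>))" for i
    unfolding bounded_at_def
  proof
    show "(\<lambda>\<omega>. N i \<omega> * sgn (D i \<omega>)) \<in> borel_measurable (F (ennreal (?t i)))"
      using Nad[of i i] Dad[of i i] by simp
    have "\<bar>N i \<omega> * sgn (D i \<omega>)\<bar> \<le> K" for \<omega>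
      using N0[of i \<omega>] by (auto simp: abs_mult sgn_if)
    then show "\<exists>C. \<forall>\<omega>\<in>space M. \<bar>N i \<omega> * sgn (D i \<omega>)\<bar> \<le> C" by blast
  qed
  have iY: "integrable M (\<lambda>\<omega>. (Y (?t i) \<omega> - Y (?t j) \<omega>))" if "j \<le> i" for i j
    using that T t by (intro ito_increment_integrable) (auto intro: grid_mono)
  have zero: "expectation (\<lambda>\<omega>. N i \<omega> * sgn (D i \<omega>) * (Y (?t (Suc i)) \<omega> - Y (?t i) \<omega>)) = 0"
    and int: "integrable M (\<lambda>\<omega>. N i \<omega> * sgn (D i \<omega>) * (Y (?t (Suc i)) \<omega> - Y (?t i) \<omega>))" for i
    using ito_martingale[OF t Nb] integrable_bounded_mult[OF Nb iY[of i "Suc i"]] by auto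
  have sq: "integrable M (\<lambda>\<omega>. (D (Suc n) \<omega>)\<^sup>2)"
    using ito_increment_square(1)[of 0 T "\<lambda>_. 1"] T bounded_at_const unfolding D_def by simp
  \<comment> \<open>The product \<open>2 N \<bar>D\<bar>\<close> is at most
    \<open>N^2 / 2 + 2 D^2\<close>; absorbing \<open>N^2 / 2\<close> on the left yields Doob's
    constant 4.\<close>
  have pt: "(N (Suc n) \<omega>)\<^sup>2 \<le> 4 * (D (Suc n) \<omega>)\<^sup>2 -
      4 * (\<Sum>i<Suc n. N i \<omega> * sgn (D i \<omega>) * (Y (?t (Suc i)) \<omega> - Y (?t i) \<omega>))" for \<omega>
  proof -
    have "N i \<omega> * sgn (D i \<omega>) * (Y (?t (Suc i)) \<omega> - Y (?t i) \<omega>) \<le> N i \<omega> * (\<bar>D (Suc i) \<omega>\<bar> - \<bar>D i \<omega>\<bar>)" for i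
      unfolding mult.assoc
    proof (rule mult_left_mono[OF _ N0(1)])
      show "sgn (D i \<omega>) * (Y (?t (Suc i)) \<omega> - Y (?t i) \<omega>) \<le> \<bar>D (Suc i) \<omega>\<bar> - \<bar>D i \<omega>\<bar>"
        unfolding D_def by (auto simp: sgn_if)
    qed
    then have "(\<Sum>i<Suc n. N i \<omega> * sgn (D i \<omega>) * (Y (?t (Suc i)) \<omega> - Y (?t i) \<omega>)) \<le>
        (\<Sum>i<Suc n. N i \<omega> * (\<bar>D (Suc i) \<omega>\<bar> - \<bar>D i \<omega>\<bar>))" (is "?a \<le> ?b")
      by (rule sum_mono)
    moreover have "(N (Suc n) \<omega>)\<^sup>2 \<le> 2 * N (Suc n) \<omega> * \<bar>D (Suc n) \<omega>\<bar> - 2 * ?b"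
      using doob_pathwise[where s="\<lambda>j. \<bar>D j \<omega>\<bar>" and n="Suc n", OF K abs_ge_zero] unfolding N_def D_def .
    moreover have "2 * N (Suc n) \<omega> * \<bar>D (Suc n) \<omega>\<bar> \<le> (N (Suc n) \<omega>)\<^sup>2 / 2 + 2 * (D (Suc n) \<omega>)\<^sup>2"
    proof -
      have "0 \<le> (N (Suc n) \<omega> - 2 * \<bar>D (Suc n) \<omega>\<bar>)\<^sup>2" by simp
      also have "\<dots> = (N (Suc n) \<omega>)\<^sup>2 + 4 * (D (Suc n) \<omega>)\<^sup>2 - 4 * N (Suc n) \<omega> * \<bar>D (Suc n) \<omega>\<bar>"
        by (simp add: power2_diff power_mult_distrib)
      finally show ?thesis by simp
    qed
    ultimately show ?thesis by linarith
  qed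
  show mN: "N (Suc n) \<in> borel_measurable M" using measurable_F_M[OF Nad[of "Suc n" "Suc n"]] by simp
  have iN: "integrable M (\<lambda>\<omega>. (N (Suc n) \<omega>)\<^sup>2)"
  proof (rule integrable_const_bound[of _ "K\<^sup>2"])
    show "AE \<omega> in M. norm ((N (Suc n) \<omega>)\<^sup>2) \<le> K\<^sup>2"
      using N0 by (intro AE_I2) (auto intro: power_mono)
  qed (use mN in simp)
  have isum: "integrable M (\<lambda>\<omega>. \<Sum>i<Suc n. N i \<omega> * sgn (D i \<omega>) * (Y (?t (Suc i)) \<omega> - Y (?t i) \<omega>))"
    using int by (rule Bochner_Integration.integrable_sum)
  have "expectation (\<lambda>\<omega>. (N (Suc n) \<omega>)\<^sup>2) \<le> expectation (\<lambda>\<omega>. 4 * (D (Suc n) \<omega>)\<^sup>2 -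
      4 * (\<Sum>i<Suc n. N i \<omega> * sgn (D i \<omega>) * (Y (?t (Suc i)) \<omega> - Y (?t i) \<omega>)))"
    using pt sq isum by (intro integral_mono iN Bochner_Integration.integrable_diff integrable_mult_right) auto
  also have "\<dots> = 4 * expectation (\<lambda>\<omega>. (D (Suc n) \<omega>)\<^sup>2) -
      4 * (\<Sum>i<Suc n. expectation (\<lambda>\<omega>. N i \<omega> * sgn (D i \<omega>) * (Y (?t (Suc i)) \<omega> - Y (?t i) \<omega>)))"
    using sq isum int by (simp add: Bochner_Integration.integral_sum del: sum.lessThan_Suc)
  also have "\<dots> = 4 * expectation (\<lambda>\<omega>. (Y T \<omega> - Y 0 \<omega>)\<^sup>2)" unfolding zero by (simp add: D_def)
  finally show "(\<integral>\<^sup>+\<omega>. ennreal ((N (Suc n) \<omega>)\<^sup>2) \<partial>M) \<le> ennreal (4 * expectation (\<lambda>\<omega>. (Y T \<omega> - Y 0 \<omega>)\<^sup>2))"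
    by (simp add: nn_integral_eq_integral[OF iN] ennreal_leI)
qed

lemma grid_approx:
  assumes "0 < T" "u \<in> {0..T}"
  obtains j where "\<And>n. j n \<le> Suc n" "(\<lambda>n. grid T n (j n)) \<longlonglongrightarrow> u"
proof -
  define j where "j n = nat \<lfloor>u * real (Suc n) / T\<rfloor>" for n
  have fl: "real (j n) \<le> u * real (Suc n) / T" "u * real (Suc n) / T < real (j n) + 1" for n
    using assms unfolding j_def by (auto simp: of_nat_nat)
  have "real (j n) \<le> real (Suc n)" for n
  proof -
    have "u * real (Suc n) \<le> T * real (Suc n)" using assms by (intro mult_right_mono) auto
    then have "u * real (Suc n) / T \<le> real (Suc n)" using assms by (simp add: field_simps)
    with fl(1)[of n] show ?thesis by linarith
  qed
  then have j: "j n \<le> Suc n" for n by (simp only: of_nat_le_iff)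
  have "\<bar>grid T n (j n) - u\<bar> \<le> T / real (Suc n)" for n
  proof -
    have "T * real (j n) \<le> u * real (Suc n)" "u * real (Suc n) \<le> T * real (j n) + T"
      using fl[of n] assms by (auto simp: field_simps)
    then have "T * real (j n) / real (Suc n) \<le> u" "u \<le> T * real (j n) / real (Suc n) + T / real (Suc n)"
      unfolding add_divide_distrib[symmetric]
      by (simp_all only: pos_divide_le_eq pos_le_divide_eq of_nat_0_less_iff zero_less_Suc)
    then show ?thesis unfolding grid_def by linarith
  qed
  then have "(\<lambda>n. grid T n (j n) - u) \<longlonglongrightarrow> 0"
    by (intro Lim_null_comparison[OF always_eventually mesh_tendsto[of T]]) simp
  then have "(\<lambda>n. grid T n (j n)) \<longlonglongrightarrow> u" by (rule LIM_zero_cancel)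
  with j show ?thesis by (rule that)
qed

text \<open>Refining the grid and lifting the truncation happen together, at level \<open>n\<close>
  on the \<open>n\<close>-th grid. These grids are not nested, so the maxima need not increase in
  \<open>n\<close>; the bound is built from the lower limit of their squares, integrable by Fatou's
  lemma and above every value of the path by continuity.\<close>

lemma doob_maximal:
  assumes T: "0 < T"
  obtains S where "S \<in> borel_measurable M" "integrable M (\<lambda>\<omega>. (S \<omega>)\<^sup>2)" "\<And>\<omega>. 0 \<le> S \<omega>"
    "AE \<omega> in M. \<forall>u\<in>{0..T}. \<bar>Y u \<omega> - Y 0 \<omega>\<bar> \<le> S \<omega>"
proof -
  define N where "N n \<omega> = trunc_max (real n) (\<lambda>j. \<bar>Y (grid T n j) \<omega> - Y 0 \<omega>\<bar>) (Suc n)" for n \<omega>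
  define S2 where "S2 \<omega> = liminf (\<lambda>n. ennreal ((N n \<omega>)\<^sup>2))" for \<omega>
  note g = doob_grid[OF less_imp_le[OF T] of_nat_0_le_iff]
  have [measurable]: "N n \<in> borel_measurable M" for n
    unfolding N_def[abs_def] by (rule g(1))
  have mS2 [measurable]: "S2 \<in> borel_measurable M" unfolding S2_def[abs_def] by measurable
  have "(\<integral>\<^sup>+\<omega>. S2 \<omega> \<partial>M) \<le> liminf (\<lambda>n. \<integral>\<^sup>+\<omega>. ennreal ((N n \<omega>)\<^sup>2) \<partial>M)"
    unfolding S2_def by (rule nn_integral_liminf) simp
  also have "\<dots> \<le> liminf (\<lambda>n::nat. ennreal (4 * expectation (\<lambda>\<omega>. (Y T \<omega> - Y 0 \<omega>)\<^sup>2)))"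
    using g(2) unfolding N_def by (intro Liminf_mono always_eventually allI) auto
  also have "\<dots> = ennreal (4 * expectation (\<lambda>\<omega>. (Y T \<omega> - Y 0 \<omega>)\<^sup>2))"
    by (rule Liminf_const) simp
  finally have fin: "(\<integral>\<^sup>+\<omega>. S2 \<omega> \<partial>M) < \<infinity>" by (auto intro: le_less_trans)
  then have AEfin: "AE \<omega> in M. S2 \<omega> \<noteq> \<infinity>"
    by (intro nn_integral_noteq_infinite) auto
  have ge: "ennreal (\<bar>Y u \<omega> - Y 0 \<omega>\<bar>\<^sup>2) \<le> S2 \<omega>" if \<omega>: "\<omega> \<in> space M" and u: "u \<in> {0..T}" for u \<omega>
  proof -
    obtain j where j: "\<And>n. j n \<le> Suc n" "(\<lambda>n. grid T n (j n)) \<longlonglongrightarrow> u"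
      by (rule grid_approx[OF T u], rule that)
    have "(\<lambda>n. Y (grid T n (j n)) \<omega>) \<longlonglongrightarrow> Y u \<omega>"
      using u T by (intro continuous_on_tendsto_compose[OF Y_continuous[OF \<omega>] j(2)])
        (auto intro!: always_eventually grid_nonneg)
    then have lim: "(\<lambda>n. \<bar>Y (grid T n (j n)) \<omega> - Y 0 \<omega>\<bar>) \<longlonglongrightarrow> \<bar>Y u \<omega> - Y 0 \<omega>\<bar>"
      by (intro tendsto_intros)
    have "eventually (\<lambda>n. \<bar>Y (grid T n (j n)) \<omega> - Y 0 \<omega>\<bar> < \<bar>Y u \<omega> - Y 0 \<omega>\<bar> + 1) sequentially"
      by (rule order_tendstoD(2)[OF lim]) simp
    then have ev: "eventually (\<lambda>n. \<bar>Y (grid T n (j n)) \<omega> - Y 0 \<omega>\<bar>\<^sup>2 \<le> (N n \<omega>)\<^sup>2) sequentially"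
      using eventually_ge_at_top[of "nat \<lceil>\<bar>Y u \<omega> - Y 0 \<omega>\<bar> + 1\<rceil>"]
    proof eventually_elim
      case (elim n)
      have "\<bar>Y u \<omega> - Y 0 \<omega>\<bar> + 1 \<le> real n" using elim(2) by (simp only: nat_ceiling_le_eq)
      then have "\<bar>Y (grid T n (j n)) \<omega> - Y 0 \<omega>\<bar> = min (real n) \<bar>Y (grid T n (j n)) \<omega> - Y 0 \<omega>\<bar>"
        using elim(1) by simp
      also have "\<dots> \<le> N n \<omega>"
        unfolding N_def by (rule trunc_max_ge[OF j(1), where s="\<lambda>j. \<bar>Y (grid T n j) \<omega> - Y 0 \<omega>\<bar>"])
      finally show ?case by (intro power_mono) auto
    qed
    have "(\<lambda>n. ennreal (\<bar>Y (grid T n (j n)) \<omega> - Y 0 \<omega>\<bar>\<^sup>2)) \<longlonglongrightarrow> ennreal (\<bar>Y u \<omega> - Y 0 \<omega>\<bar>\<^sup>2)"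
      by (intro tendsto_ennrealI tendsto_power lim)
    then have "ennreal (\<bar>Y u \<omega> - Y 0 \<omega>\<bar>\<^sup>2) = liminf (\<lambda>n. ennreal (\<bar>Y (grid T n (j n)) \<omega> - Y 0 \<omega>\<bar>\<^sup>2))"
      by (intro lim_imp_Liminf[symmetric]) auto
    also have "\<dots> \<le> S2 \<omega>" unfolding S2_def using ev by (intro Liminf_mono) (auto elim!: eventually_mono intro: ennreal_leI)
    finally show ?thesis .
  qed
  show ?thesis
  proof (rule that[of "\<lambda>\<omega>. sqrt (enn2real (S2 \<omega>))"])
    have "integrable M (\<lambda>\<omega>. enn2real (S2 \<omega>))"
    proof (rule integrableI_bounded)
      have "(\<integral>\<^sup>+\<omega>. ennreal (norm (enn2real (S2 \<omega>))) \<partial>M) \<le> (\<integral>\<^sup>+\<omega>. S2 \<omega> \<partial>M)"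
        by (intro nn_integral_mono) (simp add: ennreal_enn2real_if)
      with fin show "(\<integral>\<^sup>+\<omega>. ennreal (norm (enn2real (S2 \<omega>))) \<partial>M) < \<infinity>" by (auto intro: le_less_trans)
    qed simp
    then show "integrable M (\<lambda>\<omega>. (sqrt (enn2real (S2 \<omega>)))\<^sup>2)" by simp
    show "AE \<omega> in M. \<forall>u\<in>{0..T}. \<bar>Y u \<omega> - Y 0 \<omega>\<bar> \<le> sqrt (enn2real (S2 \<omega>))"
      using AEfin AE_space
    proof eventually_elim
      case (elim \<omega>)
      show ?case
      proof
        fix u assume "u \<in> {0..T}"
        have "S2 \<omega> < top" using elim(1) by (simp add: less_top)
        from enn2real_mono[OF ge[OF elim(2) \<open>u \<in> {0..T}\<close>] this]
        have "\<bar>Y u \<omega> - Y 0 \<omega>\<bar>\<^sup>2 \<le> enn2real (S2 \<omega>)" by simp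
        then show "\<bar>Y u \<omega> - Y 0 \<omega>\<bar> \<le> sqrt (enn2real (S2 \<omega>))" by (rule real_le_rsqrt)
      qed
    qed
  qed auto
qed

text \<open>As in Skorokhod's reflection problem: after the last visit \<open>u\<close> of
  \<open>X\<close> to \<open>b\<close> the process \<open>A\<close> is constant, and at
  \<open>u\<close> it equals \<open>b - x - Y u \<omega>\<close>, which is at most
  \<open>- Y u \<omega>\<close> because \<open>b \<le> x\<close>. With no visit, \<open>A\<close>
  stays at 0.\<close>

lemma A_le_running_sup:
  assumes g: "good_path \<omega>" and T: "0 < T" and S: "\<forall>u\<in>{0..T}. \<bar>Y u \<omega> - Y 0 \<omega>\<bar> \<le> S"
  shows "A T \<omega> \<le> S"
proof -
  have S0: "0 \<le> S" using bspec[OF S, of 0] T by simp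
  have Y0: "Y 0 \<omega> = 0" using good_pathD(1,2)[OF g] unfolding Y_eq by simp
  define Z where "Z = {u \<in> {0..T}. X u \<omega> = b}"
  have cX: "continuous_on {0..T} (\<lambda>t. X t \<omega>)"
    using good_pathD(3,4)[OF g] by (auto intro: continuous_on_subset)
  show ?thesis
  proof (cases "Z = {}")
    case True
    have "b < X u \<omega>" if "u \<in> {0..T}" for u
    proof -
      have "X u \<omega> \<noteq> b" using True that unfolding Z_def by blast
      moreover have "b \<le> X u \<omega>" using good_path_ge[OF g] that by simp
      ultimately show ?thesis by simp
    qed
    then have "A T \<omega> = A 0 \<omega>" using T by (intro good_path_flat[OF g]) auto
    then show ?thesis using good_pathD(2)[OF g] S0 by simp
  next
    case False
    have "closed Z"
    proof -
      have "closed ({0..T} \<inter> (\<lambda>t. X t \<omega>) -` {b})"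
        using cX by (intro continuous_closed_preimage) auto
      moreover have "Z = {0..T} \<inter> (\<lambda>t. X t \<omega>) -` {b}" unfolding Z_def by auto
      ultimately show ?thesis by simp
    qed
    moreover have bdd: "bdd_above Z" unfolding Z_def by (intro bdd_aboveI[of _ T]) auto
    ultimately have uZ: "Sup Z \<in> Z" using False by (intro closed_contains_Sup)
    define u where "u = Sup Z"
    have u: "0 \<le> u" "u \<le> T" "X u \<omega> = b" using uZ unfolding u_def Z_def by auto
    have eq: "A v \<omega> = A T \<omega>" if v: "u < v" "v \<le> T" for v
    proof -
      have "b < X w \<omega>" if w: "w \<in> {v..T}" for w
      proof -
        have "w \<notin> Z" using cSup_upper[OF _ bdd, of w] w v unfolding u_def by auto
        then have "X w \<omega> \<noteq> b" using w v u unfolding Z_def by auto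
        moreover have "b \<le> X w \<omega>" using good_path_ge[OF g, of w] w v u by simp
        ultimately show ?thesis by simp
      qed
      then show ?thesis using v u by (intro good_path_flat[OF g, symmetric]) auto
    qed
    \<comment> \<open>Flatness needs \<open>X > b\<close> on a closed interval, which fails at
      \<open>u\<close> itself; times decreasing to \<open>u\<close> and continuity close the
      gap.\<close>
    have "A u \<omega> = A T \<omega>"
    proof (cases "u = T")
      case False
      have "(\<lambda>n. u + (T - u) * inverse (real (Suc n))) \<longlonglongrightarrow> u + (T - u) * 0"
        by (intro tendsto_intros LIMSEQ_inverse_real_of_nat)
      then have "(\<lambda>n. A (u + (T - u) * inverse (real (Suc n))) \<omega>) \<longlonglongrightarrow> A u \<omega>"
        using u good_pathD(4)[OF g]
        by (intro continuous_on_tendsto_compose[of "{0..}" "\<lambda>t. A t \<omega>"]) (auto intro!: always_eventually)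
      moreover have "A (u + (T - u) * inverse (real (Suc n))) \<omega> = A T \<omega>" for n
      proof (rule eq)
        show "u < u + (T - u) * inverse (real (Suc n))" using False u by simp
        have "(T - u) * inverse (real (Suc n)) \<le> (T - u) * 1"
          using u by (intro mult_left_mono) (auto simp: field_simps)
        then show "u + (T - u) * inverse (real (Suc n)) \<le> T" by simp
      qed
      ultimately show ?thesis by (simp only: LIMSEQ_const_iff)
    qed simp
    also have "A u \<omega> = b - x - Y u \<omega>" using u good_pathD(1)[OF g] unfolding Y_eq by simp
    finally show ?thesis using bspec[OF S, of u] u b_le_x Y0 by auto
  qed
qed

lemma path_bound:
  assumes T: "0 < T"
  obtains R where "R \<in> borel_measurable M" "integrable M (\<lambda>\<omega>. (R \<omega>)\<^sup>2)" "\<And>\<omega>. 0 \<le> R \<omega>"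
    "AE \<omega> in M. \<forall>u\<in>{0..T}. \<bar>X u \<omega>\<bar> \<le> R \<omega> \<and> \<bar>A u \<omega>\<bar> \<le> R \<omega>"
proof -
  obtain S where S: "S \<in> borel_measurable M" "integrable M (\<lambda>\<omega>. (S \<omega>)\<^sup>2)" "\<And>\<omega>. 0 \<le> S \<omega>"
    "AE \<omega> in M. \<forall>u\<in>{0..T}. \<bar>Y u \<omega> - Y 0 \<omega>\<bar> \<le> S \<omega>"
    by (rule doob_maximal[OF T], rule that)
  note [measurable] = S(1)
  show ?thesis
  proof (rule that[of "\<lambda>\<omega>. \<bar>x\<bar> + 2 * S \<omega>"])
    show "integrable M (\<lambda>\<omega>. (\<bar>x\<bar> + 2 * S \<omega>)\<^sup>2)"
      using S(2) square_integrable_imp_integrable[OF S(1,2)] by (simp add: power2_sum power_mult_distrib)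
    show "AE \<omega> in M. \<forall>u\<in>{0..T}. \<bar>X u \<omega>\<bar> \<le> \<bar>x\<bar> + 2 * S \<omega> \<and> \<bar>A u \<omega>\<bar> \<le> \<bar>x\<bar> + 2 * S \<omega>"
      using S(4) AE_good_path
    proof eventually_elim
      case (elim \<omega>)
      have AT: "A T \<omega> \<le> S \<omega>" by (rule A_le_running_sup[OF elim(2) T elim(1)])
      show ?case
      proof
        fix u assume u: "u \<in> {0..T}"
        have "A 0 \<omega> \<le> A u \<omega>" "A u \<omega> \<le> A T \<omega>" "A 0 \<omega> = 0" "X 0 \<omega> = x"
          using good_pathD(1,2)[OF elim(2)] good_path_mono[OF elim(2), of 0 u] good_path_mono[OF elim(2), of u T] u by auto
        moreover have "\<bar>X u \<omega> - x - A u \<omega>\<bar> \<le> S \<omega>"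
          using elim(1) u calculation unfolding Y_eq by auto
        ultimately show "\<bar>X u \<omega>\<bar> \<le> \<bar>x\<bar> + 2 * S \<omega> \<and> \<bar>A u \<omega>\<bar> \<le> \<bar>x\<bar> + 2 * S \<omega>"
          using AT S(3)[of \<omega>] by auto
      qed
    qed
  qed (use S(1,3) in auto)
qed

text \<open>The reflection contributes nothing at first order: \<open>A\<close> grows only in grid intervals in which
  \<open>X\<close> visits \<open>b\<close>.\<close>

lemma reflection_sum_tendsto:
  assumes g: "good_path \<omega>" and T: "0 < T"
  shows "(\<lambda>n. \<Sum>i<Suc n. (A (grid T n (Suc i)) \<omega> - A (grid T n i) \<omega>) *
     (\<bar>X (grid T n i) \<omega> - b\<bar> + \<bar>X (grid T n (Suc i)) \<omega> - X (grid T n i) \<omega>\<bar> +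
      (A (grid T n (Suc i)) \<omega> - A (grid T n i) \<omega>))) \<longlonglongrightarrow> 0" (is "?V \<longlonglongrightarrow> 0")
proof (rule tendstoI)
  fix e :: real assume e: "0 < e"
  have AT: "0 \<le> A T \<omega>" using good_path_mono[OF g, of 0 T] good_pathD(2)[OF g] T by simp
  \<comment> \<open>A cell in which \<open>A\<close> grows contributes its increment of
    \<open>A\<close> times three terms below \<open>\<eta>\<close>, and the increments of
    \<open>A\<close> sum to \<open>A T \<omega>\<close>.\<close>
  define \<eta> where "\<eta> = e / (3 * (A T \<omega> + 1))"
  have \<eta>: "\<eta> > 0" unfolding \<eta>_def using e AT by simp
  have c: "continuous_on {0..T} (\<lambda>t. X t \<omega>)" "continuous_on {0..T} (\<lambda>t. A t \<omega>)"
    using good_pathD(3,4)[OF g] by (auto intro: continuous_on_subset)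
  show "eventually (\<lambda>n. dist (?V n) 0 < e) sequentially"
    using grid_modulus[OF c(1) less_imp_le[OF T] \<eta>] grid_modulus[OF c(2) less_imp_le[OF T] \<eta>]
  proof eventually_elim
    case (elim n)
    let ?t = "grid T n"
    have t: "0 \<le> ?t i" "?t i \<le> ?t (Suc i)" for i using T by (auto intro: grid_nonneg grid_mono)
    have dA: "0 \<le> A (?t (Suc i)) \<omega> - A (?t i) \<omega>" for i
      using good_path_mono[OF g t] by simp
    have summand: "(A (?t (Suc i)) \<omega> - A (?t i) \<omega>) *
     (\<bar>X (?t i) \<omega> - b\<bar> + \<bar>X (?t (Suc i)) \<omega> - X (?t i) \<omega>\<bar> + (A (?t (Suc i)) \<omega> - A (?t i) \<omega>))
      \<le> (A (?t (Suc i)) \<omega> - A (?t i) \<omega>) * (3 * \<eta>)" if i: "i < Suc n" for i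
    proof (cases "A (?t (Suc i)) \<omega> = A (?t i) \<omega>")
      case False
      then obtain u where u: "u \<in> {?t i..?t (Suc i)}" "\<not> b < X u \<omega>"
        using good_path_flat[OF g t] by blast
      have "b \<le> X u \<omega>" using good_path_ge[OF g, of u] u(1) t(1)[of i] by simp
      with u(2) have Xu: "X u \<omega> = b" by simp
      have i': "i \<le> n" "?t i \<in> {?t i..?t (Suc i)}" "?t (Suc i) \<in> {?t i..?t (Suc i)}" using i t(2)[of i] by auto
      have "\<bar>X (?t i) \<omega> - b\<bar> < \<eta>" using elim(1)[rule_format, OF i'(1,2) u(1)] Xu by simp
      moreover have "\<bar>X (?t (Suc i)) \<omega> - X (?t i) \<omega>\<bar> < \<eta>" by (rule elim(1)[rule_format, OF i'(1,3,2)])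
      moreover have "\<bar>A (?t (Suc i)) \<omega> - A (?t i) \<omega>\<bar> < \<eta>" by (rule elim(2)[rule_format, OF i'(1,3,2)])
      ultimately show ?thesis by (intro mult_left_mono dA) linarith
    qed simp
    have nn: "0 \<le> ?V n" by (intro sum_nonneg mult_nonneg_nonneg add_nonneg_nonneg dA) auto
    have "?V n \<le> (\<Sum>i<Suc n. (A (?t (Suc i)) \<omega> - A (?t i) \<omega>) * (3 * \<eta>))"
      using summand by (intro sum_mono) auto
    also have "\<dots> = A T \<omega> * (3 * \<eta>)"
      unfolding sum_distrib_right[symmetric] sum_lessThan_telescope[of "\<lambda>i. A (?t i) \<omega>"]
      using good_pathD(2)[OF g] by simp
    also have "\<dots> < (A T \<omega> + 1) * (3 * \<eta>)" using \<eta> by simp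
    also have "\<dots> = e" unfolding \<eta>_def using AT by (simp add: field_simps)
    finally show ?case using nn by (simp add: dist_real_def)
  qed
qed

end

section \<open>Ito's formula in mean at a bounded stopping time\<close>

text \<open>The index \<open>j\<close> rounds \<open>r\<close> up to the grid. The condition
  \<open>grid T n i < r\<close> is evaluated at the left end of each cell, hence is known there when
  \<open>r\<close> is a stopping time, and the sum still telescopes.\<close>

lemma grid_stop:
  assumes T: "0 \<le> T" and r: "0 \<le> r" "r \<le> T"
  obtains j where "j \<le> Suc n" "\<bar>grid T n j - r\<bar> \<le> T / real (Suc n)"
    "\<And>h :: nat \<Rightarrow> real. (\<Sum>i<Suc n. of_bool (grid T n i < r) * (h (Suc i) - h i)) = h j - h 0"
proof -
  define j where "j = (LEAST j. r \<le> grid T n j)"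
  have ex: "r \<le> grid T n (Suc n)" using r by simp
  have j: "r \<le> grid T n j" unfolding j_def by (rule LeastI[of "\<lambda>j. r \<le> grid T n j", OF ex])
  have j_le: "j \<le> Suc n" unfolding j_def by (rule Least_le[of "\<lambda>j. r \<le> grid T n j", OF ex])
  have less: "grid T n i < r" if "i < j" for i
    using not_less_Least[of i "\<lambda>j. r \<le> grid T n j"] that unfolding j_def by simp
  have ge: "\<not> grid T n i < r" if "j \<le> i" for i
    using grid_mono[OF T that, of n] j by simp
  have sum: "(\<Sum>i<Suc n. of_bool (grid T n i < r) * (h (Suc i) - h i)) = h j - h 0" for h :: "nat \<Rightarrow> real"
  proof -
    have "(\<Sum>i<Suc n. of_bool (grid T n i < r) * (h (Suc i) - h i)) = (\<Sum>i<j. of_bool (grid T n i < r) * (h (Suc i) - h i))"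
      using j_le ge by (intro sum.mono_neutral_right) auto
    also have "\<dots> = (\<Sum>i<j. h (Suc i) - h i)" using less by (intro sum.cong) auto
    also have "\<dots> = h j - h 0" by (rule sum_lessThan_telescope)
    finally show ?thesis .
  qed
  have "\<bar>grid T n j - r\<bar> \<le> T / real (Suc n)"
  proof (cases j)
    case 0
    then show ?thesis using j r T by simp
  next
    case (Suc i)
    then show ?thesis using less[of i] j grid_step[of T n i] by simp
  qed
  from that[OF j_le this sum] show ?thesis .
qed

text \<open>The half-open cells partition \<open>(0, T]\<close>, so a sum against their indicators
  keeps exactly one term.\<close>

lemma grid_cell:
  assumes T: "0 \<le> T" and u: "0 < u" "u \<le> T"
  obtains i where "i \<le> n" "grid T n i < u" "u \<le> grid T n (Suc i)"
    "\<And>c :: nat \<Rightarrow> real. (\<Sum>k<Suc n. c k * indicator {grid T n k<..grid T n (Suc k)} u) = c i"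
proof -
  define j where "j = (LEAST j. u \<le> grid T n j)"
  have ex: "u \<le> grid T n (Suc n)" using u by simp
  have j: "u \<le> grid T n j" unfolding j_def by (rule LeastI[of "\<lambda>j. u \<le> grid T n j", OF ex])
  have j_le: "j \<le> Suc n" unfolding j_def by (rule Least_le[of "\<lambda>j. u \<le> grid T n j", OF ex])
  have "j \<noteq> 0" using j u by (intro notI) simp
  then obtain i where i: "j = Suc i" using not0_implies_Suc by blast
  have less: "grid T n i < u"
    using not_less_Least[of i "\<lambda>j. u \<le> grid T n j"] i unfolding j_def by simp
  have ind: "c k * indicator {grid T n k<..grid T n (Suc k)} u = (if k = i then c i else 0)" for k and c :: "nat \<Rightarrow> real"
  proof (cases "k = i")
    case True
    then show ?thesis using less j i by simp
  next
    case False
    then have "Suc k \<le> i \<or> Suc i \<le> k" by auto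
    then have "u \<notin> {grid T n k<..grid T n (Suc k)}"
      using grid_mono[OF T, of "Suc k" i n] grid_mono[OF T, of "Suc i" k n] less j i by auto
    with False show ?thesis by simp
  qed
  have "(\<Sum>k<Suc n. c k * indicator {grid T n k<..grid T n (Suc k)} u) = c i" for c :: "nat \<Rightarrow> real"
    unfolding ind using i j_le by (subst sum.delta) auto
  with i j_le less j show ?thesis by (intro that[of i]) auto
qed

context reflected_process
begin

text \<open>Capped at 1 so that its mean tends to 0 by dominated convergence, and to match the
  factor \<open>min 1\<close> in the Taylor remainder.\<close>

definition osc :: "real \<Rightarrow> nat \<Rightarrow> 'a \<Rightarrow> real" where
  "osc T n \<omega> = min 1 (Max ((\<lambda>i. \<bar>X (grid T n (Suc i)) \<omega> - X (grid T n i) \<omega>\<bar>) ` {..<Suc n}))"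

lemma osc_ge:
  assumes "i \<le> n"
  shows "min 1 \<bar>X (grid T n (Suc i)) \<omega> - X (grid T n i) \<omega>\<bar> \<le> osc T n \<omega>"
  unfolding osc_def using assms by (intro min.mono Max_ge) auto

lemma osc_bounds: "0 \<le> osc T n \<omega>" "osc T n \<omega> \<le> 1"
proof -
  have "0 \<le> min 1 \<bar>X (grid T n (Suc 0)) \<omega> - X (grid T n 0) \<omega>\<bar>" by simp
  also have "\<dots> \<le> osc T n \<omega>" by (rule osc_ge) simp
  finally show "0 \<le> osc T n \<omega>" .
  show "osc T n \<omega> \<le> 1" unfolding osc_def by simp
qed

lemma osc_measurable: "0 \<le> T \<Longrightarrow> osc T n \<in> borel_measurable M"
  unfolding osc_def[abs_def]
  by (intro borel_measurable_min borel_measurable_Max borel_measurable_abs borel_measurable_diff X_measurable borel_measurable_const)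
    (auto intro: grid_nonneg)

lemma osc_tendsto:
  assumes "\<omega> \<in> space M" "0 \<le> T"
  shows "(\<lambda>n. osc T n \<omega>) \<longlonglongrightarrow> 0"
proof (rule tendstoI)
  fix e :: real assume e: "0 < e"
  have "continuous_on {0..T} (\<lambda>t. X t \<omega>)"
    using X_continuous[OF assms(1)] by (rule continuous_on_subset) auto
  from grid_modulus[OF this assms(2) e]
  show "eventually (\<lambda>n. dist (osc T n \<omega>) 0 < e) sequentially"
  proof eventually_elim
    case (elim n)
    have "\<bar>X (grid T n (Suc i)) \<omega> - X (grid T n i) \<omega>\<bar> < e" if "i \<le> n" for i
      using grid_mono[OF assms(2), of i "Suc i" n] by (intro elim[rule_format, OF that]) auto
    then have "Max ((\<lambda>i. \<bar>X (grid T n (Suc i)) \<omega> - X (grid T n i) \<omega>\<bar>) ` {..<Suc n}) < e"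
      by (subst Max_less_iff) auto
    then show ?case using osc_bounds[of T n \<omega>] unfolding osc_def by (simp add: dist_real_def)
  qed
qed

text \<open>The weight tends to 0 only pathwise and the sum of squares is bounded only in mean, so
  \<open>ito_square_weighted\<close> is needed: the parts coming from \<open>d\<close> telescope to
  at most \<open>\<epsilon>\<close>, and the rest is governed by the mean of the weight.\<close>

lemma quadratic_remainder_tendsto:
  assumes T: "0 < T"
  shows "(\<lambda>n. \<Sum>i<Suc n. expectation (\<lambda>\<omega>. osc T n \<omega> * (Y (grid T n (Suc i)) \<omega> - Y (grid T n i) \<omega>)\<^sup>2)) \<longlonglongrightarrow> 0"
    (is "?Q \<longlonglongrightarrow> 0")
proof (rule tendstoI)
  fix e :: real assume e: "0 < e"
  \<comment> \<open>One half of \<open>e\<close> pays for the integral of \<open>d\<close> and the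
    terms \<open>\<epsilon> * (t - s)\<close>, together at most \<open>\<epsilon> * (1 + T)\<close>;
    the other pays for \<open>\<kappa> * T\<close> times the mean oscillation, with
    \<open>\<kappa>\<close> fixed before \<open>n\<close> grows.\<close>
  define \<epsilon> where "\<epsilon> = e / (2 * (1 + T))"
  have \<epsilon>: "\<epsilon> > 0" unfolding \<epsilon>_def using e T by simp
  show "eventually (\<lambda>n. dist (?Q n) 0 < e) sequentially"
  proof (rule ito_square_weighted[OF less_imp_le[OF T] \<epsilon>])
    fix d and \<kappa> :: real
    assume di: "\<And>t. t \<le> T \<Longrightarrow> integrable NN (\<lambda>z. indicator {0<..t} (snd z) * d z)"
      and d\<epsilon>: "(\<integral>z. indicator {0<..T} (snd z) * d z \<partial>NN) \<le> \<epsilon>"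
      and dY: "\<And>s t \<theta>. 0 \<le> s \<Longrightarrow> s \<le> t \<Longrightarrow> t \<le> T \<Longrightarrow> \<theta> \<in> borel_measurable M \<Longrightarrow>
        (\<And>\<omega>. 0 \<le> \<theta> \<omega>) \<Longrightarrow> (\<And>\<omega>. \<theta> \<omega> \<le> 1) \<Longrightarrow>
        expectation (\<lambda>\<omega>. \<theta> \<omega> * (Y t \<omega> - Y s \<omega>)\<^sup>2) \<le>
          (\<integral>z. indicator {s<..t} (snd z) * d z \<partial>NN) + (\<kappa> * expectation \<theta> + \<epsilon>) * (t - s)"
    have "(\<lambda>n. expectation (osc T n)) \<longlonglongrightarrow> expectation (\<lambda>\<omega>. 0)"
      by (rule integral_dominated_convergence[where w="\<lambda>_. 1"])
        (use T osc_bounds osc_tendsto in \<open>auto intro: osc_measurable\<close>)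
    then have "(\<lambda>n. \<kappa> * T * expectation (osc T n)) \<longlonglongrightarrow> \<kappa> * T * 0"
      by (intro tendsto_mult tendsto_const) simp
    then have "eventually (\<lambda>n. \<kappa> * T * expectation (osc T n) < e / 2) sequentially"
      using e by (intro order_tendstoD(2)) auto
    then show "eventually (\<lambda>n. dist (?Q n) 0 < e) sequentially"
    proof eventually_elim
      case (elim n)
      let ?t = "grid T n"
      have t: "0 \<le> ?t i" "?t i \<le> ?t (Suc i)" for i using T by (auto intro: grid_nonneg grid_mono)
      define D where "D t = (\<integral>z. indicator {0<..t} (snd z) * d z \<partial>NN)" for t
      have cell: "(\<integral>z. indicator {?t i<..?t (Suc i)} (snd z) * d z \<partial>NN) = D (?t (Suc i)) - D (?t i)" if "i \<le> n" for i
      proof -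
        have "indicator {?t i<..?t (Suc i)} (snd z) * d z = indicator {0<..?t (Suc i)} (snd z) * d z - indicator {0<..?t i} (snd z) * d z" for z
          using t[of i] by (auto simp: indicator_def)
        then show ?thesis unfolding D_def
          using that T by (subst Bochner_Integration.integral_diff[symmetric]) (auto intro!: di grid_le simp: less_imp_le)
      qed
      have "?Q n \<le> (\<Sum>i<Suc n. (D (?t (Suc i)) - D (?t i)) + (\<kappa> * expectation (osc T n) + \<epsilon>) * (?t (Suc i) - ?t i))"
      proof (rule sum_mono)
        fix i assume "i \<in> {..<Suc n}"
        then have i: "i \<le> n" by simp
        show "expectation (\<lambda>\<omega>. osc T n \<omega> * (Y (?t (Suc i)) \<omega> - Y (?t i) \<omega>)\<^sup>2) \<le>
           (D (?t (Suc i)) - D (?t i)) + (\<kappa> * expectation (osc T n) + \<epsilon>) * (?t (Suc i) - ?t i)"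
          unfolding cell[OF i, symmetric]
          by (rule dY) (use t i T osc_bounds in \<open>auto intro!: osc_measurable grid_le\<close>)
      qed
      also have "\<dots> = (D (?t (Suc n)) - D (?t 0)) + (\<kappa> * expectation (osc T n) + \<epsilon>) * (?t (Suc n) - ?t 0)"
        unfolding sum.distrib sum_distrib_left[symmetric]
        using sum_lessThan_telescope[of "\<lambda>i. D (?t i)" "Suc n"] sum_lessThan_telescope[of ?t "Suc n"] by simp
      also have "\<dots> = D T + \<epsilon> * T + \<kappa> * T * expectation (osc T n)"
        by (simp add: D_def algebra_simps)
      also have "\<dots> \<le> \<epsilon> * (1 + T) + \<kappa> * T * expectation (osc T n)"
        using d\<epsilon> unfolding D_def by (simp add: algebra_simps)
      also have "\<epsilon> * (1 + T) = e / 2" unfolding \<epsilon>_def using T by (simp add: field_simps)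
      finally have "?Q n < e" using elim by linarith
      moreover have "0 \<le> ?Q n" using osc_bounds by (intro sum_nonneg integral_nonneg) auto
      ultimately show ?case by (simp add: dist_real_def)
    qed
  qed
qed

text \<open>The error terms that carry increments of \<open>A\<close>, in the form in which
  \<open>taylor_step\<close> leaves them.\<close>

definition refl_sum :: "real \<Rightarrow> nat \<Rightarrow> 'a \<Rightarrow> real" where
  "refl_sum T n \<omega> = (\<Sum>i<Suc n. (A (grid T n (Suc i)) \<omega> - A (grid T n i) \<omega>) *
     (\<bar>X (grid T n i) \<omega> - b\<bar> + \<bar>X (grid T n (Suc i)) \<omega> - X (grid T n i) \<omega>\<bar> +
      (A (grid T n (Suc i)) \<omega> - A (grid T n i) \<omega>)))"

lemma refl_sum_measurable: "0 \<le> T \<Longrightarrow> refl_sum T n \<in> borel_measurable M"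
proof -
  assume T: "0 \<le> T"
  have [measurable]: "X (grid T n i) \<in> borel_measurable M" "A (grid T n i) \<in> borel_measurable M" for i
    using T by (auto intro: X_measurable A_measurable grid_nonneg)
  show ?thesis
    unfolding refl_sum_def[abs_def] by (rule borel_measurable_sum) measurable
qed

lemma refl_sum_expectation:
  assumes T: "0 < T"
  shows "integrable M (refl_sum T n)" and "(\<lambda>n. expectation (refl_sum T n)) \<longlonglongrightarrow> 0"
proof -
  obtain R where R: "R \<in> borel_measurable M" "integrable M (\<lambda>\<omega>. (R \<omega>)\<^sup>2)" "\<And>\<omega>. 0 \<le> R \<omega>"
    "AE \<omega> in M. \<forall>u\<in>{0..T}. \<bar>X u \<omega>\<bar> \<le> R \<omega> \<and> \<bar>A u \<omega>\<bar> \<le> R \<omega>"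
    by (rule path_bound[OF T], rule that)
  have "integrable M R" by (rule square_integrable_imp_integrable[OF R(1,2)])
  then have iw: "integrable M (\<lambda>\<omega>. 5 * (R \<omega>)\<^sup>2 + \<bar>b\<bar> * R \<omega>)" using R(2) by simp
  have m: "refl_sum T n \<in> borel_measurable M" for n using refl_sum_measurable T by simp
  \<comment> \<open>The bracket is at most \<open>(R + \<bar>b\<bar>) + 2 R + 2 R\<close>, and the
    increments of \<open>A\<close> in front of it sum to
    \<open>A T \<omega> \<le> R \<omega>\<close>.\<close>
  have bound: "AE \<omega> in M. norm (refl_sum T n \<omega>) \<le> 5 * (R \<omega>)\<^sup>2 + \<bar>b\<bar> * R \<omega>" for n
    using R(4) AE_good_path
  proof eventually_elim
    case (elim \<omega>)
    let ?t = "grid T n"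
    have t: "0 \<le> ?t i" "?t i \<le> ?t (Suc i)" for i using T by (auto intro: grid_nonneg grid_mono)
    have dA: "0 \<le> A (?t (Suc i)) \<omega> - A (?t i) \<omega>" for i
      using good_path_mono[OF elim(2) t] by simp
    have nn: "0 \<le> refl_sum T n \<omega>"
      unfolding refl_sum_def by (intro sum_nonneg mult_nonneg_nonneg add_nonneg_nonneg dA) auto
    have "refl_sum T n \<omega> \<le> (\<Sum>i<Suc n. (A (?t (Suc i)) \<omega> - A (?t i) \<omega>) * (5 * R \<omega> + \<bar>b\<bar>))"
      unfolding refl_sum_def
    proof (intro sum_mono mult_left_mono dA)
      fix i assume i: "i \<in> {..<Suc n}"
      have "\<bar>X (?t i) \<omega>\<bar> \<le> R \<omega>" "\<bar>A (?t i) \<omega>\<bar> \<le> R \<omega>"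
          "\<bar>X (?t (Suc i)) \<omega>\<bar> \<le> R \<omega>" "\<bar>A (?t (Suc i)) \<omega>\<bar> \<le> R \<omega>"
        using bspec[OF elim(1), of "?t i"] bspec[OF elim(1), of "?t (Suc i)"] i t T grid_le[of T _ n] by auto
      then show "\<bar>X (?t i) \<omega> - b\<bar> + \<bar>X (?t (Suc i)) \<omega> - X (?t i) \<omega>\<bar> + (A (?t (Suc i)) \<omega> - A (?t i) \<omega>) \<le> 5 * R \<omega> + \<bar>b\<bar>"
        by linarith
    qed
    also have "\<dots> = A T \<omega> * (5 * R \<omega> + \<bar>b\<bar>)"
      unfolding sum_distrib_right[symmetric] sum_lessThan_telescope[of "\<lambda>i. A (?t i) \<omega>"]
      using good_pathD(2)[OF elim(2)] by simp
    also have "\<dots> \<le> R \<omega> * (5 * R \<omega> + \<bar>b\<bar>)"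
      using bspec[OF elim(1), of T] T R(3)[of \<omega>] by (intro mult_right_mono) auto
    also have "\<dots> = 5 * (R \<omega>)\<^sup>2 + \<bar>b\<bar> * R \<omega>" by (simp add: power2_eq_square algebra_simps)
    finally show ?case using nn by simp
  qed
  have lim: "AE \<omega> in M. (\<lambda>n. refl_sum T n \<omega>) \<longlonglongrightarrow> 0"
    using AE_good_path by eventually_elim (unfold refl_sum_def, rule reflection_sum_tendsto[OF _ T])
  show "integrable M (refl_sum T n)"
  proof (rule Bochner_Integration.integrable_bound[OF iw m])
    show "AE \<omega> in M. norm (refl_sum T n \<omega>) \<le> norm (5 * (R \<omega>)\<^sup>2 + \<bar>b\<bar> * R \<omega>)"
      using bound[of n] by eventually_elim (auto intro: order_trans[OF _ abs_ge_self])
  qed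
  have "(\<lambda>n. expectation (refl_sum T n)) \<longlonglongrightarrow> expectation (\<lambda>_. 0)"
    by (rule integral_dominated_convergence[OF _ m iw lim bound]) simp
  then show "(\<lambda>n. expectation (refl_sum T n)) \<longlonglongrightarrow> 0" by simp
qed

text \<open>Expands \<open>f\<close> in the martingale increment \<open>\<delta>\<close> rather than
  in \<open>z - y = \<delta> + a\<close>, where \<open>a\<close> is the growth of \<open>A\<close>.
  Each correction carries a factor \<open>a\<close>; the first-order one is small because
  \<open>f1\<close> vanishes at \<open>b\<close> at a linear rate.\<close>

lemma taylor_step:
  fixes f f1 f2 :: "real \<Rightarrow> real"
  assumes K: "0 \<le> K" and y: "b \<le> y" and z: "b \<le> z" and a: "0 \<le> a" and \<theta>: "min 1 \<bar>z - y\<bar> \<le> \<theta>" "\<theta> \<le> 1"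
    and taylor: "\<bar>f z - f y - f1 y * (z - y) - f2 y / 2 * (z - y)\<^sup>2\<bar> \<le> K * min 1 \<bar>z - y\<bar> * (z - y)\<^sup>2"
    and f1: "\<bar>f1 y\<bar> \<le> K * (y - b)" and f2: "\<bar>f2 y\<bar> \<le> K"
  defines "\<delta> \<equiv> z - y - a"
  shows "\<bar>f z - f y - f1 y * \<delta> - f2 y / 2 * \<delta>\<^sup>2\<bar> \<le> 2 * K * (\<theta> * \<delta>\<^sup>2) + 3 * K * (a * (\<bar>y - b\<bar> + \<bar>z - y\<bar> + a))"
proof -
  define w where "w = z - y"
  have \<theta>0: "0 \<le> \<theta>" using \<theta>(1) by (smt (verit, best) abs_ge_zero min_def)
  \<comment> \<open>Uses \<open>\<delta> = w - a\<close>, whence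
    \<open>w^2 - \<delta>^2 = a (2 w - a)\<close>.\<close>
  have eq: "f z - f y - f1 y * \<delta> - f2 y / 2 * \<delta>\<^sup>2 =
     (f z - f y - f1 y * w - f2 y / 2 * w\<^sup>2) + f1 y * a + f2 y / 2 * (a * (2 * w - a))"
    unfolding \<delta>_def w_def[symmetric] by (simp add: power2_eq_square field_simps)
  have "\<bar>f z - f y - f1 y * w - f2 y / 2 * w\<^sup>2\<bar> \<le> 2 * K * (\<theta> * \<delta>\<^sup>2) + 2 * K * (a * a)"
  proof -
    have "w\<^sup>2 \<le> 2 * \<delta>\<^sup>2 + 2 * a\<^sup>2"
      using sum_squares_bound[of \<delta> a] unfolding \<delta>_def w_def[symmetric] by (simp add: power2_eq_square algebra_simps)
    then have "\<theta> * w\<^sup>2 \<le> \<theta> * (2 * \<delta>\<^sup>2) + \<theta> * (2 * a\<^sup>2)"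
      unfolding distrib_left[symmetric] by (rule mult_left_mono) (rule \<theta>0)
    also have "\<theta> * (2 * a\<^sup>2) \<le> 2 * a\<^sup>2" using \<theta>0 \<theta>(2) by (intro mult_left_le_one_le) auto
    finally have "\<theta> * w\<^sup>2 \<le> \<theta> * (2 * \<delta>\<^sup>2) + 2 * a\<^sup>2" by simp
    then have "K * (\<theta> * w\<^sup>2) \<le> K * (\<theta> * (2 * \<delta>\<^sup>2) + 2 * a\<^sup>2)" by (rule mult_left_mono) (rule K)
    moreover have "K * min 1 \<bar>w\<bar> * w\<^sup>2 \<le> K * \<theta> * w\<^sup>2"
      using K \<theta>(1) unfolding w_def by (intro mult_right_mono mult_left_mono) auto
    ultimately show ?thesis using taylor unfolding w_def[symmetric]
      by (simp add: power2_eq_square algebra_simps)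
  qed
  moreover have "\<bar>f1 y * a\<bar> \<le> K * (a * \<bar>y - b\<bar>)"
  proof -
    have "\<bar>f1 y\<bar> * a \<le> K * (y - b) * a" using f1 a by (rule mult_right_mono)
    then show ?thesis using a y by (simp add: abs_mult mult_ac)
  qed
  moreover have "\<bar>f2 y / 2 * (a * (2 * w - a))\<bar> \<le> K * (a * \<bar>w\<bar>) + K * (a * a)"
  proof -
    have "\<bar>f2 y / 2 * (a * (2 * w - a))\<bar> = \<bar>f2 y\<bar> / 2 * (a * \<bar>2 * w - a\<bar>)" using a by (simp add: abs_mult)
    also have "\<dots> \<le> K / 2 * (a * (2 * \<bar>w\<bar> + a))"
      using f2 a K by (intro mult_mono mult_left_mono) auto
    also have "\<dots> \<le> K * (a * \<bar>w\<bar>) + K * (a * a)" using K a by (simp add: algebra_simps)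
    finally show ?thesis .
  qed
  moreover have "0 \<le> K * (a * \<bar>w\<bar>)" "0 \<le> K * (a * \<bar>y - b\<bar>)" using K a by auto
  moreover have "3 * K * (a * (\<bar>y - b\<bar> + \<bar>w\<bar> + a)) = 3 * (K * (a * \<bar>y - b\<bar>)) + 3 * (K * (a * \<bar>w\<bar>)) + 3 * (K * (a * a))"
    by (simp add: algebra_simps)
  ultimately show ?thesis unfolding eq w_def[symmetric] by linarith
qed

text \<open>A real number, so that it can be inserted into a process; the truncation at
  \<open>T\<close> makes the conversion from \<open>ennreal\<close> faithful.\<close>

definition stopped_at :: "real \<Rightarrow> ('a \<Rightarrow> ennreal) \<Rightarrow> 'a \<Rightarrow> real" where
  "stopped_at T \<tau> \<omega> = enn2real (min (\<tau> \<omega>) (ennreal T))"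

lemma stopped_at_nonneg: "0 \<le> stopped_at T \<tau> \<omega>"
  and stopped_at_le: "0 \<le> T \<Longrightarrow> stopped_at T \<tau> \<omega> \<le> T"
  and ennreal_stopped_at: "ennreal (stopped_at T \<tau> \<omega>) = min (\<tau> \<omega>) (ennreal T)"
proof -
  have le: "min (\<tau> \<omega>) (ennreal T) \<le> ennreal T" by simp
  show "0 \<le> stopped_at T \<tau> \<omega>" unfolding stopped_at_def by simp
  show "stopped_at T \<tau> \<omega> \<le> T" if "0 \<le> T"
    using enn2real_leI[OF that le] unfolding stopped_at_def .
  show "ennreal (stopped_at T \<tau> \<omega>) = min (\<tau> \<omega>) (ennreal T)"
    using le_less_trans[OF le ennreal_less_top] unfolding stopped_at_def by (rule ennreal_enn2real)
qed

text \<open>Through the isometry the quadratic sum becomes the integral of a function whose weight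
  is constant in time on each cell. It converges pointwise by continuity of the paths and of
  \<open>f2\<close>, dominated by \<open>K * Hm^2\<close> on \<open>(0, T]\<close>.\<close>

lemma cell_integral:
  fixes r :: "'a \<Rightarrow> real"
  assumes T: "0 < T" and r: "\<And>\<omega>. 0 \<le> r \<omega>" "\<And>\<omega>. r \<omega> \<le> T" and f2: "\<And>y. \<bar>f2 y\<bar> \<le> K" "continuous_on UNIV f2"
  defines "G \<equiv> \<lambda>n z. (\<Sum>i<Suc n. of_bool (grid T n i < r (fst z)) * (f2 (X (grid T n i) (fst z)) / 2) *
        (indicator {grid T n i<..grid T n (Suc i)} (snd z) * Hm z)\<^sup>2)"
    and "L \<equiv> \<lambda>z. indicator {0<..r (fst z)} (snd z) * (f2 (X (max 0 (snd z)) (fst z)) / 2 * (Hm z)\<^sup>2)"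
  assumes G_int: "\<And>n. integrable NN (G n)"
  shows "integrable NN L" and "(\<lambda>n. \<integral>z. G n z \<partial>NN) \<longlonglongrightarrow> (\<integral>z. L z \<partial>NN)"
proof -
  have G_eq: "G n z = (\<Sum>i<Suc n. (of_bool (grid T n i < r (fst z)) * (f2 (X (grid T n i) (fst z)) / 2) * (Hm z)\<^sup>2) *
        indicator {grid T n i<..grid T n (Suc i)} (snd z))" for n z
    unfolding G_def by (intro sum.cong refl) (simp add: indicator_def)
  have outside: "G n z = 0" if "\<not> (0 < snd z \<and> snd z \<le> T)" for n z
    unfolding G_eq
  proof (rule sum.neutral, rule ballI)
    fix i assume "i \<in> {..<Suc n}"
    then have "snd z \<notin> {grid T n i<..grid T n (Suc i)}"
      using that T grid_nonneg[of T n i] grid_le[of T "Suc i" n] by auto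
    then show "of_bool (grid T n i < r (fst z)) * (f2 (X (grid T n i) (fst z)) / 2) * (Hm z)\<^sup>2 *
        indicator {grid T n i<..grid T n (Suc i)} (snd z) = 0" by simp
  qed
  have K0: "0 \<le> K" using f2(1)[of 0] by simp
  have lim: "(\<lambda>n. G n z) \<longlonglongrightarrow> L z" if z: "z \<in> space NN" for z
  proof (cases "0 < snd z \<and> snd z \<le> T")
    case False
    then have "L z = 0" unfolding L_def using r[of "fst z"] by (auto simp: indicator_def)
    with outside[OF False] show ?thesis by simp
  next
    case True
    define u \<omega> where "u = snd z" and "\<omega> = fst z"
    have u: "0 < u" "u \<le> T" using True by (auto simp: u_def)
    have \<omega>: "\<omega> \<in> space M" using z unfolding \<omega>_def NN_def space_pair_measure by auto
    have "\<exists>i. grid T n i < u \<and> u \<le> grid T n (Suc i) \<and>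
      G n z = of_bool (grid T n i < r \<omega>) * (f2 (X (grid T n i) \<omega>) / 2) * (Hm z)\<^sup>2" for n
    proof (rule grid_cell[OF less_imp_le[OF T] u, of n])
      fix i assume i: "grid T n i < u" "u \<le> grid T n (Suc i)"
        and S: "\<And>c :: nat \<Rightarrow> real. (\<Sum>k<Suc n. c k * indicator {grid T n k<..grid T n (Suc k)} u) = c i"
      have "G n z = of_bool (grid T n i < r \<omega>) * (f2 (X (grid T n i) \<omega>) / 2) * (Hm z)\<^sup>2"
        unfolding G_eq u_def[symmetric] \<omega>_def[symmetric] by (rule S)
      with i show ?thesis by blast
    qed
    then obtain i where i: "\<And>n. grid T n (i n) < u" "\<And>n. u \<le> grid T n (Suc (i n))"
      "\<And>n. G n z = of_bool (grid T n (i n) < r \<omega>) * (f2 (X (grid T n (i n)) \<omega>) / 2) * (Hm z)\<^sup>2"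
      by metis
    have "\<bar>grid T n (i n) - u\<bar> \<le> T / real (Suc n)" for n
      using i(1,2)[of n] grid_step[of T n "i n"] by linarith
    then have "(\<lambda>n. grid T n (i n) - u) \<longlonglongrightarrow> 0"
      by (intro Lim_null_comparison[OF always_eventually mesh_tendsto[of T]]) simp
    then have gu: "(\<lambda>n. grid T n (i n)) \<longlonglongrightarrow> u" by (rule LIM_zero_cancel)
    have "(\<lambda>n. X (grid T n (i n)) \<omega>) \<longlonglongrightarrow> X u \<omega>"
      using u T by (intro continuous_on_tendsto_compose[OF X_continuous[OF \<omega>] gu])
        (auto intro!: always_eventually grid_nonneg)
    then have f2X: "(\<lambda>n. f2 (X (grid T n (i n)) \<omega>)) \<longlonglongrightarrow> f2 (X u \<omega>)"
      by (intro continuous_on_tendsto_compose[OF f2(2)]) auto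
    \<comment> \<open>The left ends approach \<open>u\<close> strictly from below, so the limit is
      the indicator of \<open>u \<le> r \<omega>\<close>, with value 1 also at
      \<open>u = r \<omega>\<close>.\<close>
    have ob: "(\<lambda>n. of_bool (grid T n (i n) < r \<omega>) :: real) \<longlonglongrightarrow> of_bool (u \<le> r \<omega>)"
    proof (cases "u \<le> r \<omega>")
      case True
      have "grid T n (i n) < r \<omega>" for n using i(1)[of n] True by linarith
      then show ?thesis using True by simp
    next
      case False
      then have "eventually (\<lambda>n. r \<omega> < grid T n (i n)) sequentially"
        by (intro order_tendstoD(1)[OF gu]) simp
      then have "eventually (\<lambda>n. of_bool (grid T n (i n) < r \<omega>) = (0 :: real)) sequentially"
        by eventually_elim simp
      then show ?thesis using False by (simp add: tendsto_eventually)
    qed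
    have "(\<lambda>n. G n z) \<longlonglongrightarrow> of_bool (u \<le> r \<omega>) * (f2 (X u \<omega>) / 2) * (Hm z)\<^sup>2"
      unfolding i(3) by (intro tendsto_intros ob f2X) simp
    also have "of_bool (u \<le> r \<omega>) * (f2 (X u \<omega>) / 2) * (Hm z)\<^sup>2 = L z"
      unfolding L_def u_def[symmetric] \<omega>_def[symmetric] using u by (simp add: indicator_def)
    finally show ?thesis .
  qed
  have iw: "integrable NN (\<lambda>z. K * (indicator {0<..T} (snd z) * Hm z)\<^sup>2)"
    using ito_increment_square(2)[of 0 T "\<lambda>_. 1"] T bounded_at_const by simp
  have bound: "norm (G n z) \<le> K * (indicator {0<..T} (snd z) * Hm z)\<^sup>2" for n z
  proof (cases "0 < snd z \<and> snd z \<le> T")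
    case False
    then show ?thesis using outside[OF False] K0 by simp
  next
    case True
    then have u: "0 < snd z" "snd z \<le> T" by auto
    have "\<exists>i. G n z = of_bool (grid T n i < r (fst z)) * (f2 (X (grid T n i) (fst z)) / 2) * (Hm z)\<^sup>2"
    proof (rule grid_cell[OF less_imp_le[OF T] u, of n])
      fix i assume "\<And>c :: nat \<Rightarrow> real. (\<Sum>k<Suc n. c k * indicator {grid T n k<..grid T n (Suc k)} (snd z)) = c i"
      then have "G n z = of_bool (grid T n i < r (fst z)) * (f2 (X (grid T n i) (fst z)) / 2) * (Hm z)\<^sup>2"
        unfolding G_eq .
      then show ?thesis by blast
    qed
    then obtain i where i: "G n z = of_bool (grid T n i < r (fst z)) * (f2 (X (grid T n i) (fst z)) / 2) * (Hm z)\<^sup>2"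
      by blast
    have "norm (G n z) \<le> \<bar>f2 (X (grid T n i) (fst z)) / 2\<bar> * (Hm z)\<^sup>2"
      unfolding i by (auto simp: abs_mult)
    also have "\<dots> \<le> K * (Hm z)\<^sup>2" using f2(1)[of "X (grid T n i) (fst z)"] by (intro mult_right_mono) auto
    finally show ?thesis using True by simp
  qed
  have mG: "G n \<in> borel_measurable NN" for n using G_int by blast
  have mL: "L \<in> borel_measurable NN" by (rule borel_measurable_LIMSEQ_real[OF lim mG])
  note dc = mL mG iw AE_I2[OF lim] AE_I2[OF bound]
  show "integrable NN L" by (rule integrable_dominated_convergence[OF dc])
  show "(\<lambda>n. \<integral>z. G n z \<partial>NN) \<longlonglongrightarrow> (\<integral>z. L z \<partial>NN)" by (rule integral_dominated_convergence[OF dc])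
qed

text \<open>The first hypothesis on \<open>f1\<close> makes it vanish at \<open>b\<close>, which removes the reflection term from Ito's formula.\<close>

theorem dynkin:
  fixes f f1 f2 :: "real \<Rightarrow> real"
  assumes T: "0 < T" and st: "stopping_time F \<tau>"
    and taylor: "\<And>y z. b \<le> y \<Longrightarrow> b \<le> z \<Longrightarrow>
      \<bar>f z - f y - f1 y * (z - y) - f2 y / 2 * (z - y)\<^sup>2\<bar> \<le> K * min 1 \<bar>z - y\<bar> * (z - y)\<^sup>2"
    and f1: "\<And>y. b \<le> y \<Longrightarrow> \<bar>f1 y\<bar> \<le> K * (y - b)" "\<And>y. \<bar>f1 y\<bar> \<le> K" "f1 \<in> borel_measurable borel"
    and f2: "\<And>y. \<bar>f2 y\<bar> \<le> K" "continuous_on UNIV f2"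
    and f: "\<And>y. \<bar>f y\<bar> \<le> K * (1 + \<bar>y\<bar>)" "continuous_on UNIV f"
  defines "L \<equiv> \<lambda>z. indicator {0<..stopped_at T \<tau> (fst z)} (snd z) * (f2 (X (max 0 (snd z)) (fst z)) / 2 * (Hm z)\<^sup>2)"
  shows "integrable M (\<lambda>\<omega>. f (X (stopped_at T \<tau> \<omega>) \<omega>))" and "integrable NN L"
    and "expectation (\<lambda>\<omega>. f (X (stopped_at T \<tau> \<omega>) \<omega>)) = f x + (\<integral>z. L z \<partial>NN)"
proof -
  have K0: "0 \<le> K" using f2(1)[of 0] by simp
  have T0: "0 \<le> T" using T by simp
  define r where "r = stopped_at T \<tau>"
  have r: "0 \<le> r \<omega>" "r \<omega> \<le> T" for \<omega>
    unfolding r_def using T0 by (auto intro: stopped_at_nonneg stopped_at_le)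
  let ?t = "grid T"
  have t: "0 \<le> ?t n i" "?t n i \<le> ?t n (Suc i)" for n i using T by (auto intro: grid_nonneg grid_mono)
  define \<zeta> where "\<zeta> n i \<omega> = (of_bool (?t n i < r \<omega>) :: real)" for n i \<omega>
  \<comment> \<open>For \<open>i \<le> n\<close> the grid time lies strictly below \<open>T\<close>,
    so truncating \<open>\<tau>\<close> at \<open>T\<close> does not change the event, which belongs
    to the past of that time.\<close>
  have \<zeta>_eq: "(?t n i < r \<omega>) = (ennreal (?t n i) < \<tau> \<omega>)" if "i \<le> n" for n i \<omega>
  proof -
    have "0 < T / real (Suc n)" using T by simp
    then have "?t n i < T" using grid_step[of T n n] grid_mono[OF T0 that, of n] unfolding grid_Suc_n by linarith
    then have "(ennreal (?t n i) < \<tau> \<omega>) = (ennreal (?t n i) < min (\<tau> \<omega>) (ennreal T))"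
      using t by (simp add: ennreal_less_iff)
    also have "min (\<tau> \<omega>) (ennreal T) = ennreal (r \<omega>)"
      unfolding r_def by (rule ennreal_stopped_at[symmetric])
    also have "(ennreal (?t n i) < ennreal (r \<omega>)) = (?t n i < r \<omega>)" using t by (simp add: ennreal_less_iff)
    finally show ?thesis by simp
  qed
  have \<zeta>_meas: "\<zeta> n i \<in> borel_measurable (F (ennreal (?t n i)))" if "i \<le> n" for n i
  proof -
    have [measurable]: "Measurable.pred (F (ennreal (?t n i))) (\<lambda>\<omega>. ennreal (?t n i) < \<tau> \<omega>)"
      by (rule stopping_timeD2[OF st])
    show ?thesis unfolding \<zeta>_def[abs_def] \<zeta>_eq[OF that] by measurable
  qed
  have X_ad: "X (?t n i) \<in> borel_measurable (F (ennreal (?t n i)))" for n i by (rule X_adapted[OF t(1)])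
  have f2_m: "f2 \<in> borel_measurable borel" "f \<in> borel_measurable borel"
    using f2(2) f(2) by (auto intro: borel_measurable_continuous_onI)
  have b1: "bounded_at (?t n i) (\<lambda>\<omega>. \<zeta> n i \<omega> * f1 (X (?t n i) \<omega>))"
    and b2: "bounded_at (?t n i) (\<lambda>\<omega>. \<zeta> n i \<omega> * (f2 (X (?t n i) \<omega>) / 2))" if "i \<le> n" for n i
  proof -
    have z: "bounded_at (?t n i) (\<zeta> n i)" unfolding bounded_at_def
      using \<zeta>_meas[OF that] by (auto simp: \<zeta>_def intro!: exI[of _ 1])
    have "bounded_at (?t n i) (\<lambda>\<omega>. f1 (X (?t n i) \<omega>))" unfolding bounded_at_def
      using f1(2) measurable_compose[OF X_ad f1(3)] by auto
    then show "bounded_at (?t n i) (\<lambda>\<omega>. \<zeta> n i \<omega> * f1 (X (?t n i) \<omega>))" by (rule bounded_at_mult[OF z])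
    have "\<bar>f2 y / 2\<bar> \<le> K" for y using f2(1)[of y] by auto
    moreover have "(\<lambda>\<omega>. f2 (X (?t n i) \<omega>) / 2) \<in> borel_measurable (F (ennreal (?t n i)))"
      using measurable_compose[OF X_ad f2_m(1)] by simp
    ultimately have "bounded_at (?t n i) (\<lambda>\<omega>. f2 (X (?t n i) \<omega>) / 2)" unfolding bounded_at_def by blast
    then show "bounded_at (?t n i) (\<lambda>\<omega>. \<zeta> n i \<omega> * (f2 (X (?t n i) \<omega>) / 2))" by (rule bounded_at_mult[OF z])
  qed
  define \<Delta> where "\<Delta> n i \<omega> = Y (?t n (Suc i)) \<omega> - Y (?t n i) \<omega>" for n i \<omega>
  have i\<Delta>: "integrable M (\<Delta> n i)" "integrable M (\<lambda>\<omega>. (\<Delta> n i \<omega>)\<^sup>2)" for n i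
    unfolding \<Delta>_def[abs_def] using ito_increment_integrable[OF t] ito_increment_square(1)[OF t bounded_at_const] by auto
  \<comment> \<open>\<open>J\<close> telescopes to the change of \<open>f (X)\<close> up to the
    rounded-up time; \<open>P\<close> is its first-order part, of mean 0, and \<open>Q\<close> its
    second-order part, whose mean is the integral of \<open>G\<close>.\<close>
  define J where "J n \<omega> = (\<Sum>i<Suc n. \<zeta> n i \<omega> * (f (X (?t n (Suc i)) \<omega>) - f (X (?t n i) \<omega>)))" for n \<omega>
  define P where "P n \<omega> = (\<Sum>i<Suc n. \<zeta> n i \<omega> * f1 (X (?t n i) \<omega>) * \<Delta> n i \<omega>)" for n \<omega>
  define Q where "Q n \<omega> = (\<Sum>i<Suc n. \<zeta> n i \<omega> * (f2 (X (?t n i) \<omega>) / 2) * (\<Delta> n i \<omega>)\<^sup>2)" for n \<omega>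
  define G where "G n z = (\<Sum>i<Suc n. of_bool (?t n i < r (fst z)) * (f2 (X (?t n i) (fst z)) / 2) *
        (indicator {?t n i<..?t n (Suc i)} (snd z) * Hm z)\<^sup>2)" for n z
  have P: "integrable M (P n)" "expectation (P n) = 0" for n
  proof -
    have a: "integrable M (\<lambda>\<omega>. \<zeta> n i \<omega> * f1 (X (?t n i) \<omega>) * \<Delta> n i \<omega>)"
        "expectation (\<lambda>\<omega>. \<zeta> n i \<omega> * f1 (X (?t n i) \<omega>) * \<Delta> n i \<omega>) = 0" if "i \<in> {..<Suc n}" for i
      using integrable_bounded_mult[OF b1 i\<Delta>(1)] ito_martingale[OF t b1, of i n] that unfolding \<Delta>_def by auto
    show "integrable M (P n)" unfolding P_def[abs_def] using a(1) by (rule Bochner_Integration.integrable_sum)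
    have "expectation (P n) = (\<Sum>i<Suc n. expectation (\<lambda>\<omega>. \<zeta> n i \<omega> * f1 (X (?t n i) \<omega>) * \<Delta> n i \<omega>))"
      unfolding P_def[abs_def] using a(1) by (rule Bochner_Integration.integral_sum)
    then show "expectation (P n) = 0" using a(2) by simp
  qed
  have Q: "integrable M (Q n)" "integrable NN (G n)" "expectation (Q n) = (\<integral>z. G n z \<partial>NN)" for n
  proof -
    have a: "integrable M (\<lambda>\<omega>. \<zeta> n i \<omega> * (f2 (X (?t n i) \<omega>) / 2) * (\<Delta> n i \<omega>)\<^sup>2)"
        "integrable NN (\<lambda>z. \<zeta> n i (fst z) * (f2 (X (?t n i) (fst z)) / 2) * (indicator {?t n i<..?t n (Suc i)} (snd z) * Hm z)\<^sup>2)"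
        "expectation (\<lambda>\<omega>. \<zeta> n i \<omega> * (f2 (X (?t n i) \<omega>) / 2) * (\<Delta> n i \<omega>)\<^sup>2) =
         (\<integral>z. \<zeta> n i (fst z) * (f2 (X (?t n i) (fst z)) / 2) * (indicator {?t n i<..?t n (Suc i)} (snd z) * Hm z)\<^sup>2 \<partial>NN)"
      if "i \<in> {..<Suc n}" for i
    proof -
      have i: "i \<le> n" using that by simp
      show "integrable M (\<lambda>\<omega>. \<zeta> n i \<omega> * (f2 (X (?t n i) \<omega>) / 2) * (\<Delta> n i \<omega>)\<^sup>2)"
        by (rule integrable_bounded_mult[OF b2[OF i] i\<Delta>(2)])
      show "integrable NN (\<lambda>z. \<zeta> n i (fst z) * (f2 (X (?t n i) (fst z)) / 2) * (indicator {?t n i<..?t n (Suc i)} (snd z) * Hm z)\<^sup>2)"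
        by (rule ito_increment_square(2)[OF t b2[OF i]])
      show "expectation (\<lambda>\<omega>. \<zeta> n i \<omega> * (f2 (X (?t n i) \<omega>) / 2) * (\<Delta> n i \<omega>)\<^sup>2) =
         (\<integral>z. \<zeta> n i (fst z) * (f2 (X (?t n i) (fst z)) / 2) * (indicator {?t n i<..?t n (Suc i)} (snd z) * Hm z)\<^sup>2 \<partial>NN)"
        unfolding \<Delta>_def by (rule ito_increment_square(3)[OF t b2[OF i]])
    qed
    show "integrable M (Q n)" unfolding Q_def[abs_def] using a(1) by (rule Bochner_Integration.integrable_sum)
    show "integrable NN (G n)" unfolding G_def[abs_def] \<zeta>_def[symmetric] using a(2) by (rule Bochner_Integration.integrable_sum)
    have "expectation (Q n) = (\<Sum>i<Suc n. expectation (\<lambda>\<omega>. \<zeta> n i \<omega> * (f2 (X (?t n i) \<omega>) / 2) * (\<Delta> n i \<omega>)\<^sup>2))"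
      unfolding Q_def[abs_def] using a(1) by (rule Bochner_Integration.integral_sum)
    also have "\<dots> = (\<Sum>i<Suc n. \<integral>z. \<zeta> n i (fst z) * (f2 (X (?t n i) (fst z)) / 2) * (indicator {?t n i<..?t n (Suc i)} (snd z) * Hm z)\<^sup>2 \<partial>NN)"
      using a(3) by (rule sum.cong[OF refl])
    also have "\<dots> = (\<integral>z. G n z \<partial>NN)"
      unfolding G_def \<zeta>_def[symmetric] using a(2) by (rule Bochner_Integration.integral_sum[symmetric])
    finally show "expectation (Q n) = (\<integral>z. G n z \<partial>NN)" .
  qed
  have L_int: "integrable NN L" and GL: "(\<lambda>n. \<integral>z. G n z \<partial>NN) \<longlonglongrightarrow> (\<integral>z. L z \<partial>NN)"
    using cell_integral[where r=r, OF T r f2 Q(2)[unfolded G_def[abs_def]]]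
    unfolding L_def r_def[symmetric] G_def[abs_def] by simp_all
  show "integrable NN L" by (rule L_int)
  obtain R where R: "R \<in> borel_measurable M" "integrable M (\<lambda>\<omega>. (R \<omega>)\<^sup>2)" "\<And>\<omega>. 0 \<le> R \<omega>"
    "AE \<omega> in M. \<forall>u\<in>{0..T}. \<bar>X u \<omega>\<bar> \<le> R \<omega> \<and> \<bar>A u \<omega>\<bar> \<le> R \<omega>"
    by (rule path_bound[OF T], rule that)
  have iR: "integrable M (\<lambda>\<omega>. 2 * K * (1 + R \<omega>))"
    using square_integrable_imp_integrable[OF R(1,2)] by simp
  have J_eq: "\<exists>j\<le>Suc n. \<bar>?t n j - r \<omega>\<bar> \<le> T / real (Suc n) \<and> J n \<omega> = f (X (?t n j) \<omega>) - f (X 0 \<omega>)" for n \<omega>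
  proof -
    obtain j where j: "j \<le> Suc n" "\<bar>?t n j - r \<omega>\<bar> \<le> T / real (Suc n)"
      and h: "\<And>h :: nat \<Rightarrow> real. (\<Sum>i<Suc n. of_bool (?t n i < r \<omega>) * (h (Suc i) - h i)) = h j - h 0"
      by (rule grid_stop[OF T0 r], rule that)
    have "J n \<omega> = f (X (?t n j) \<omega>) - f (X 0 \<omega>)"
      unfolding J_def \<zeta>_def h[of "\<lambda>i. f (X (?t n i) \<omega>)"] by simp
    with j show ?thesis by blast
  qed
  have J_lim: "(\<lambda>n. J n \<omega>) \<longlonglongrightarrow> f (X (r \<omega>) \<omega>) - f (X 0 \<omega>)" if \<omega>: "\<omega> \<in> space M" for \<omega>
  proof -
    have "\<forall>n. \<exists>j. \<bar>?t n j - r \<omega>\<bar> \<le> T / real (Suc n) \<and> J n \<omega> = f (X (?t n j) \<omega>) - f (X 0 \<omega>)"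
      using J_eq by blast
    from choice[OF this] obtain j where
      j: "\<And>n. \<bar>?t n (j n) - r \<omega>\<bar> \<le> T / real (Suc n)" "\<And>n. J n \<omega> = f (X (?t n (j n)) \<omega>) - f (X 0 \<omega>)"
      by blast
    have "(\<lambda>n. ?t n (j n) - r \<omega>) \<longlonglongrightarrow> 0"
      using j(1) by (intro Lim_null_comparison[OF always_eventually mesh_tendsto[of T]]) simp
    then have gu: "(\<lambda>n. ?t n (j n)) \<longlonglongrightarrow> r \<omega>" by (rule LIM_zero_cancel)
    have "(\<lambda>n. X (?t n (j n)) \<omega>) \<longlonglongrightarrow> X (r \<omega>) \<omega>"
      using r t by (intro continuous_on_tendsto_compose[OF X_continuous[OF \<omega>] gu]) (auto intro!: always_eventually)
    then have "(\<lambda>n. f (X (?t n (j n)) \<omega>)) \<longlonglongrightarrow> f (X (r \<omega>) \<omega>)"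
      by (intro continuous_on_tendsto_compose[OF f(2)]) auto
    then show ?thesis unfolding j(2) by (intro tendsto_intros)
  qed
  have J_meas: "J n \<in> borel_measurable M" for n
    unfolding J_def[abs_def]
  proof (rule borel_measurable_sum)
    fix i assume "i \<in> {..<Suc n}"
    then have "i \<le> n" by simp
    have "\<zeta> n i \<in> borel_measurable M" by (rule measurable_F_M[OF \<zeta>_meas[OF \<open>i \<le> n\<close>]])
    moreover have "(\<lambda>\<omega>. f (X (?t n k) \<omega>)) \<in> borel_measurable M" for k
      by (rule measurable_compose[OF X_measurable[OF t(1)] f2_m(2)])
    ultimately show "(\<lambda>\<omega>. \<zeta> n i \<omega> * (f (X (?t n (Suc i)) \<omega>) - f (X (?t n i) \<omega>))) \<in> borel_measurable M"
      by (intro borel_measurable_times borel_measurable_diff)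
  qed
  have J_bound: "AE \<omega> in M. norm (J n \<omega>) \<le> 2 * K * (1 + R \<omega>)" for n
    using R(4)
  proof eventually_elim
    case (elim \<omega>)
    obtain j where j: "j \<le> Suc n" "J n \<omega> = f (X (?t n j) \<omega>) - f (X 0 \<omega>)" using J_eq by blast
    have b: "\<bar>f (X u \<omega>)\<bar> \<le> K * (1 + R \<omega>)" if "u \<in> {0..T}" for u
    proof -
      have "K * (1 + \<bar>X u \<omega>\<bar>) \<le> K * (1 + R \<omega>)" using bspec[OF elim that] K0 by (intro mult_left_mono) auto
      then show ?thesis using f(1)[of "X u \<omega>"] by linarith
    qed
    have "\<bar>f (X (?t n j) \<omega>)\<bar> \<le> K * (1 + R \<omega>)" "\<bar>f (X 0 \<omega>)\<bar> \<le> K * (1 + R \<omega>)"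
      using j t grid_le[OF T0 j(1)] T0 by (auto intro!: b)
    then show ?case unfolding j(2) by simp
  qed
  have J_int: "integrable M (J n)" for n
    by (rule Bochner_Integration.integrable_bound[OF iR J_meas])
      (use J_bound[of n] in \<open>eventually_elim, auto intro: order_trans[OF _ abs_ge_self]\<close>)
  have fX_meas: "(\<lambda>\<omega>. f (X (r \<omega>) \<omega>) - f (X 0 \<omega>)) \<in> borel_measurable M"
    by (rule borel_measurable_LIMSEQ_real[OF J_lim J_meas])
  note dc = fX_meas J_meas iR AE_I2[OF J_lim] J_bound
  have fX_int: "integrable M (\<lambda>\<omega>. f (X (r \<omega>) \<omega>) - f (X 0 \<omega>))" by (rule integrable_dominated_convergence[OF dc])
  have EJ: "(\<lambda>n. expectation (J n)) \<longlonglongrightarrow> expectation (\<lambda>\<omega>. f (X (r \<omega>) \<omega>) - f (X 0 \<omega>))"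
    by (rule integral_dominated_convergence[OF dc])
  have f0: "AE \<omega> in M. f (X 0 \<omega>) = f x" using X_0 by eventually_elim simp
  have f0_m: "(\<lambda>\<omega>. f (X 0 \<omega>)) \<in> borel_measurable M"
    by (rule measurable_compose[OF X_measurable[OF order_refl] f2_m(2)])
  have f0_int: "integrable M (\<lambda>\<omega>. f (X 0 \<omega>))"
    using integrable_cong_AE[OF f0_m borel_measurable_const f0] by simp
  have f0_E: "expectation (\<lambda>\<omega>. f (X 0 \<omega>)) = f x"
    using integral_cong_AE[OF f0_m borel_measurable_const f0] by (simp add: prob_space)
  have int: "integrable M (\<lambda>\<omega>. f (X (r \<omega>) \<omega>))"
    using Bochner_Integration.integrable_add[OF fX_int f0_int] by simp
  then show "integrable M (\<lambda>\<omega>. f (X (stopped_at T \<tau> \<omega>) \<omega>))" unfolding r_def .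
  have E: "expectation (\<lambda>\<omega>. f (X (r \<omega>) \<omega>) - f (X 0 \<omega>)) = expectation (\<lambda>\<omega>. f (X (r \<omega>) \<omega>)) - f x"
    using int f0_int f0_E by simp
  define \<Theta> where "\<Theta> n \<omega> = (\<Sum>i<Suc n. osc T n \<omega> * (\<Delta> n i \<omega>)\<^sup>2)" for n \<omega>
  have i\<Theta>1: "integrable M (\<lambda>\<omega>. osc T n \<omega> * (\<Delta> n i \<omega>)\<^sup>2)" for n i
  proof (rule Bochner_Integration.integrable_bound[OF i\<Delta>(2)[of n i]])
    show "(\<lambda>\<omega>. osc T n \<omega> * (\<Delta> n i \<omega>)\<^sup>2) \<in> borel_measurable M"
      using osc_measurable[OF T0] i\<Delta>(2)[of n i] by (intro borel_measurable_times) auto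
    show "AE \<omega> in M. norm (osc T n \<omega> * (\<Delta> n i \<omega>)\<^sup>2) \<le> norm ((\<Delta> n i \<omega>)\<^sup>2)"
      using osc_bounds by (intro AE_I2) (auto simp: abs_mult intro!: mult_left_le_one_le)
  qed
  have i\<Theta>: "integrable M (\<Theta> n)" for n
    unfolding \<Theta>_def[abs_def] by (rule Bochner_Integration.integrable_sum) (rule i\<Theta>1)
  have E\<Theta>: "(\<lambda>n. expectation (\<Theta> n)) \<longlonglongrightarrow> 0"
  proof -
    have "expectation (\<Theta> n) = (\<Sum>i<Suc n. expectation (\<lambda>\<omega>. osc T n \<omega> * (\<Delta> n i \<omega>)\<^sup>2))" for n
      unfolding \<Theta>_def[abs_def] by (rule Bochner_Integration.integral_sum) (rule i\<Theta>1)
    then show ?thesis using quadratic_remainder_tendsto[OF T] unfolding \<Delta>_def by simp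
  qed
  \<comment> \<open>Summing \<open>taylor_step\<close> over the cells collects the quadratic errors
    in \<open>\<Theta>\<close> and the reflection errors in \<open>refl_sum\<close>; both vanish in
    mean.\<close>
  have err: "AE \<omega> in M. \<bar>J n \<omega> - P n \<omega> - Q n \<omega>\<bar> \<le> 2 * K * \<Theta> n \<omega> + 3 * K * refl_sum T n \<omega>" for n
    using AE_good_path
  proof eventually_elim
    case (elim \<omega>)
    define y a where "y i = X (?t n i) \<omega>" and "a i = A (?t n (Suc i)) \<omega> - A (?t n i) \<omega>" for i
    have \<Delta>: "\<Delta> n i \<omega> = y (Suc i) - y i - a i" for i unfolding \<Delta>_def Y_eq y_def a_def by simp
    define e where "e i = f (y (Suc i)) - f (y i) - f1 (y i) * \<Delta> n i \<omega> - f2 (y i) / 2 * (\<Delta> n i \<omega>)\<^sup>2" for i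
    have eq: "J n \<omega> - P n \<omega> - Q n \<omega> = (\<Sum>i<Suc n. \<zeta> n i \<omega> * e i)"
      unfolding J_def P_def Q_def e_def y_def sum_subtractf[symmetric] by (intro sum.cong refl) (simp add: algebra_simps)
    have step: "\<bar>\<zeta> n i \<omega> * e i\<bar> \<le> 2 * K * (osc T n \<omega> * (\<Delta> n i \<omega>)\<^sup>2) + 3 * K * (a i * (\<bar>y i - b\<bar> + \<bar>y (Suc i) - y i\<bar> + a i))"
      if i: "i \<le> n" for i
    proof -
      have y: "b \<le> y k" for k unfolding y_def by (rule good_path_ge[OF elim t(1)])
      have a: "0 \<le> a i" unfolding a_def using good_path_mono[OF elim t] by simp
      have \<theta>: "min 1 \<bar>y (Suc i) - y i\<bar> \<le> osc T n \<omega>" unfolding y_def by (rule osc_ge[OF i])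
      have "\<bar>\<zeta> n i \<omega> * e i\<bar> \<le> \<bar>e i\<bar>" unfolding \<zeta>_def by auto
      also have "\<dots> \<le> 2 * K * (osc T n \<omega> * (\<Delta> n i \<omega>)\<^sup>2) + 3 * K * (a i * (\<bar>y i - b\<bar> + \<bar>y (Suc i) - y i\<bar> + a i))"
        using taylor_step[where f=f and ?f1.0=f1 and ?f2.0=f2 and y="y i" and z="y (Suc i)",
            OF K0 y y a \<theta> osc_bounds(2) taylor[OF y y] f1(1)[OF y] f2(1)]
        unfolding e_def \<Delta> .
      finally show ?thesis .
    qed
    have "\<bar>J n \<omega> - P n \<omega> - Q n \<omega>\<bar> \<le> (\<Sum>i<Suc n. \<bar>\<zeta> n i \<omega> * e i\<bar>)"
      unfolding eq by (rule sum_abs)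
    also have "\<dots> \<le> (\<Sum>i<Suc n. 2 * K * (osc T n \<omega> * (\<Delta> n i \<omega>)\<^sup>2) + 3 * K * (a i * (\<bar>y i - b\<bar> + \<bar>y (Suc i) - y i\<bar> + a i)))"
      by (intro sum_mono step) auto
    also have "\<dots> = 2 * K * \<Theta> n \<omega> + 3 * K * refl_sum T n \<omega>"
      unfolding sum.distrib sum_distrib_left[symmetric] \<Theta>_def refl_sum_def y_def a_def by simp
    finally show ?case .
  qed
  have "(\<lambda>n. expectation (\<lambda>\<omega>. J n \<omega> - P n \<omega> - Q n \<omega>)) \<longlonglongrightarrow> 0"
  proof (rule Lim_null_comparison[OF always_eventually], rule allI)
    fix n
    have "\<bar>expectation (\<lambda>\<omega>. J n \<omega> - P n \<omega> - Q n \<omega>)\<bar> \<le> expectation (\<lambda>\<omega>. \<bar>J n \<omega> - P n \<omega> - Q n \<omega>\<bar>)"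
      by (rule integral_abs_bound)
    also have "\<dots> \<le> expectation (\<lambda>\<omega>. 2 * K * \<Theta> n \<omega> + 3 * K * refl_sum T n \<omega>)"
      using J_int[of n] P(1)[of n] Q(1)[of n] i\<Theta>[of n] refl_sum_expectation(1)[OF T, of n]
      by (intro integral_mono_AE err) auto
    also have "\<dots> = 2 * K * expectation (\<Theta> n) + 3 * K * expectation (refl_sum T n)"
      using i\<Theta>[of n] refl_sum_expectation(1)[OF T, of n] by simp
    finally show "norm (expectation (\<lambda>\<omega>. J n \<omega> - P n \<omega> - Q n \<omega>)) \<le> 2 * K * expectation (\<Theta> n) + 3 * K * expectation (refl_sum T n)"
      by simp
  next
    have "(\<lambda>n. 2 * K * expectation (\<Theta> n) + 3 * K * expectation (refl_sum T n)) \<longlonglongrightarrow> 2 * K * 0 + 3 * K * 0"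
      by (intro tendsto_intros E\<Theta> refl_sum_expectation(2)[OF T])
    then show "(\<lambda>n. 2 * K * expectation (\<Theta> n) + 3 * K * expectation (refl_sum T n)) \<longlonglongrightarrow> 0" by simp
  qed
  moreover have "expectation (\<lambda>\<omega>. J n \<omega> - P n \<omega> - Q n \<omega>) = expectation (J n) - (\<integral>z. G n z \<partial>NN)" for n
    using J_int[of n] P[of n] Q[of n] by simp
  ultimately have "(\<lambda>n. expectation (J n) - (\<integral>z. G n z \<partial>NN)) \<longlonglongrightarrow> 0" by simp
  moreover have "(\<lambda>n. expectation (J n) - (\<integral>z. G n z \<partial>NN)) \<longlonglongrightarrow> (expectation (\<lambda>\<omega>. f (X (r \<omega>) \<omega>)) - f x) - (\<integral>z. L z \<partial>NN)"
    using EJ unfolding E by (intro tendsto_diff GL)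
  ultimately have "(expectation (\<lambda>\<omega>. f (X (r \<omega>) \<omega>)) - f x) - (\<integral>z. L z \<partial>NN) = 0"
    using LIMSEQ_unique by blast
  then show "expectation (\<lambda>\<omega>. f (X (stopped_at T \<tau> \<omega>) \<omega>)) = f x + (\<integral>z. L z \<partial>NN)"
    unfolding r_def by simp
qed

end

section \<open>The candidate and its smooth approximations\<close>

definition glue :: "real \<Rightarrow> (real \<Rightarrow> real) \<Rightarrow> (real \<Rightarrow> real) \<Rightarrow> real \<Rightarrow> real" where
  "glue p u v y = (if y \<le> p then u y else v y)"

lemma glue_le [simp]: "y \<le> p \<Longrightarrow> glue p u v y = u y"
  and glue_gt [simp]: "p < y \<Longrightarrow> glue p u v y = v y"
  by (simp_all add: glue_def)

text \<open>At the joint the left and right difference quotients have the same limit by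
  \<open>eq\<close>. The derivative is again a \<open>glue\<close>, so the lemma can be applied to
  it in turn.\<close>

lemma has_real_derivative_glue:
  assumes u: "y \<le> p \<Longrightarrow> (u has_real_derivative u' y) (at y)"
    and v: "p \<le> y \<Longrightarrow> (v has_real_derivative v' y) (at y)"
    and eq: "u p = v p" "u' p = v' p"
  shows "(glue p u v has_real_derivative glue p u' v' y) (at y)"
proof -
  consider "y < p" | "y = p" | "p < y" by linarith
  then show ?thesis
  proof cases
    case 1
    have "eventually (\<lambda>x. x \<in> {..<p}) (nhds y)" using 1 by (intro eventually_nhds_in_open) auto
    then have "eventually (\<lambda>x. glue p u v x = u x) (nhds y)" by eventually_elim simp
    then have "(glue p u v has_real_derivative u' y) (at y)"
      using u 1 by (subst DERIV_cong_ev[OF refl _ refl]) auto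
    then show ?thesis using 1 by simp
  next
    case 3
    have "eventually (\<lambda>x. x \<in> {p<..}) (nhds y)" using 3 by (intro eventually_nhds_in_open) auto
    then have "eventually (\<lambda>x. glue p u v x = v x) (nhds y)" by eventually_elim simp
    then have "(glue p u v has_real_derivative v' y) (at y)"
      using v 3 by (subst DERIV_cong_ev[OF refl _ refl]) auto
    then show ?thesis using 3 by simp
  next
    case 2
    have l: "((\<lambda>x. (u x - u p) / (x - p)) \<longlongrightarrow> u' p) (at_left p)"
      using u 2 unfolding has_field_derivative_iff filterlim_at_split by simp
    have r: "((\<lambda>x. (v x - v p) / (x - p)) \<longlongrightarrow> v' p) (at_right p)"
      using v 2 unfolding has_field_derivative_iff filterlim_at_split by simp
    have "((\<lambda>x. (glue p u v x - glue p u v p) / (x - p)) \<longlongrightarrow> u' p) (at_left p)"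
      by (rule Lim_transform_eventually[OF l]) (simp add: eventually_at_filter)
    moreover have "((\<lambda>x. (glue p u v x - glue p u v p) / (x - p)) \<longlongrightarrow> u' p) (at_right p)"
      by (rule Lim_transform_eventually[OF r[folded eq(2)]]) (simp add: eventually_at_filter eq)
    ultimately have "((\<lambda>x. (glue p u v x - glue p u v p) / (x - p)) \<longlongrightarrow> u' p) (at p)"
      by (rule filterlim_split_at)
    then show ?thesis using 2 unfolding has_field_derivative_iff by simp
  qed
qed

lemma glue_lipschitz:
  assumes u: "\<And>y z. y \<in> S \<Longrightarrow> z \<in> S \<Longrightarrow> y \<le> p \<Longrightarrow> z \<le> p \<Longrightarrow> \<bar>u y - u z\<bar> \<le> K * \<bar>y - z\<bar>"
    and v: "\<And>y z. p \<le> y \<Longrightarrow> p \<le> z \<Longrightarrow> \<bar>v y - v z\<bar> \<le> K * \<bar>y - z\<bar>"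
    and eq: "u p = v p" and p: "p \<in> S" and yz: "y \<in> S" "z \<in> S"
  shows "\<bar>glue p u v y - glue p u v z\<bar> \<le> K * \<bar>y - z\<bar>"
proof -
  have cross: "\<bar>u y - v z\<bar> \<le> K * \<bar>y - z\<bar>" if "y \<le> p" "p < z" "y \<in> S" for y z
  proof -
    have "\<bar>u y - v z\<bar> \<le> \<bar>u y - u p\<bar> + \<bar>v p - v z\<bar>" using eq by linarith
    also have "\<dots> \<le> K * \<bar>y - p\<bar> + K * \<bar>p - z\<bar>" using that p by (intro add_mono u v) auto
    also have "\<dots> = K * \<bar>y - z\<bar>" using that by (simp add: algebra_simps abs_if)
    finally show ?thesis .
  qed
  show ?thesis
    using u[OF yz] v[of y z] cross[of y z] cross[of z y] yz
    by (cases "y \<le> p"; cases "z \<le> p") (auto simp: abs_minus_commute)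
qed

text \<open>Two mean value theorems: the remainder vanishes at \<open>z = y\<close>, and its
  derivative at \<open>\<xi>\<close> is \<open>\<xi> - y\<close> times a difference of values of
  \<open>g2\<close>, which \<open>lip\<close> bounds. All intermediate points stay between
  \<open>y\<close> and \<open>z\<close>, hence above \<open>b\<close>.\<close>

lemma taylor_remainder:
  fixes g g1 g2 :: "real \<Rightarrow> real"
  assumes d1: "\<And>y. b \<le> y \<Longrightarrow> (g has_real_derivative g1 y) (at y)"
    and d2: "\<And>y. b \<le> y \<Longrightarrow> (g1 has_real_derivative g2 y) (at y)"
    and lip: "\<And>y z. b \<le> y \<Longrightarrow> b \<le> z \<Longrightarrow> \<bar>g2 y - g2 z\<bar> \<le> K * min 1 \<bar>y - z\<bar>"
    and yz: "b \<le> y" "b \<le> z"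
  shows "\<bar>g z - g y - g1 y * (z - y) - g2 y / 2 * (z - y)\<^sup>2\<bar> \<le> K * min 1 \<bar>z - y\<bar> * (z - y)\<^sup>2"
proof -
  have K: "0 \<le> K" using lip[of b "b + 1"] by simp
  have mvt: "\<exists>\<xi>. b \<le> \<xi> \<and> \<bar>\<xi> - y\<bar> \<le> \<bar>s - y\<bar> \<and> h s - h y = (s - y) * h' \<xi>"
    if h: "\<And>x. b \<le> x \<Longrightarrow> (h has_real_derivative h' x) (at x)" and s: "b \<le> s" for h h' s
  proof -
    consider "s = y" | "y < s" | "s < y" by linarith
    then show ?thesis
    proof cases
      case 1
      then show ?thesis using s by (intro exI[of _ y]) auto
    next
      case 2
      then obtain \<xi> where "y < \<xi>" "\<xi> < s" "h s - h y = (s - y) * h' \<xi>"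
        using MVT2[of y s h h'] h yz by auto
      then show ?thesis using yz by (intro exI[of _ \<xi>]) auto
    next
      case 3
      then obtain \<xi> where "s < \<xi>" "\<xi> < y" "h y - h s = (y - s) * h' \<xi>"
        using MVT2[of s y h h'] h s by auto
      then show ?thesis using s by (intro exI[of _ \<xi>]) (auto simp: algebra_simps)
    qed
  qed
  define \<phi> where "\<phi> s = g s - g y - g1 y * (s - y) - g2 y / 2 * (s - y)\<^sup>2" for s
  define \<phi>' where "\<phi>' s = g1 s - g1 y - g2 y * (s - y)" for s
  have d\<phi>: "(\<phi> has_real_derivative \<phi>' s) (at s)" if "b \<le> s" for s
    unfolding \<phi>_def[abs_def] \<phi>'_def using d1[OF that]
    by (auto intro!: derivative_eq_intros simp: field_simps)
  obtain \<xi> where \<xi>: "b \<le> \<xi>" "\<bar>\<xi> - y\<bar> \<le> \<bar>z - y\<bar>" "\<phi> z - \<phi> y = (z - y) * \<phi>' \<xi>"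
    using mvt[OF d\<phi> yz(2)] by blast
  obtain \<eta> where \<eta>: "b \<le> \<eta>" "\<bar>\<eta> - y\<bar> \<le> \<bar>\<xi> - y\<bar>" "g1 \<xi> - g1 y = (\<xi> - y) * g2 \<eta>"
    using mvt[OF d2 \<xi>(1)] by blast
  have "\<phi>' \<xi> = (\<xi> - y) * (g2 \<eta> - g2 y)" unfolding \<phi>'_def \<eta>(3) by (simp add: algebra_simps)
  then have "\<bar>\<phi>' \<xi>\<bar> = \<bar>\<xi> - y\<bar> * \<bar>g2 \<eta> - g2 y\<bar>" by (simp add: abs_mult)
  also have "\<dots> \<le> \<bar>z - y\<bar> * (K * min 1 \<bar>z - y\<bar>)"
  proof (rule mult_mono)
    have "\<bar>g2 \<eta> - g2 y\<bar> \<le> K * min 1 \<bar>\<eta> - y\<bar>" by (rule lip[OF \<eta>(1) yz(1)])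
    also have "\<dots> \<le> K * min 1 \<bar>z - y\<bar>" using K \<xi>(2) \<eta>(2) by (intro mult_left_mono) auto
    finally show "\<bar>g2 \<eta> - g2 y\<bar> \<le> K * min 1 \<bar>z - y\<bar>" .
  qed (use \<xi> in auto)
  finally have "\<bar>z - y\<bar> * \<bar>\<phi>' \<xi>\<bar> \<le> \<bar>z - y\<bar> * (\<bar>z - y\<bar> * (K * min 1 \<bar>z - y\<bar>))"
    by (rule mult_left_mono) simp
  also have "\<dots> = K * min 1 \<bar>z - y\<bar> * \<bar>z - y\<bar>\<^sup>2" by (simp add: power2_eq_square)
  finally have "\<bar>(z - y) * \<phi>' \<xi>\<bar> \<le> K * min 1 \<bar>z - y\<bar> * (z - y)\<^sup>2" by (simp add: abs_mult)
  moreover have "\<phi> z = (z - y) * \<phi>' \<xi>" using \<xi>(3) by (simp add: \<phi>_def)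
  ultimately show ?thesis unfolding \<phi>_def by simp
qed

section \<open>The derivatives of \<open>Psi\<close> and the point \<open>pi_star\<close>\<close>

definition dPsi :: "real \<Rightarrow> real \<Rightarrow> real" where
  "dPsi c x = 2 * c * ((2 * x - 2 * (x - 1) * x * ln (x / (1 - x)) - 1) / ((x - 1) * x))"

lemma has_real_derivative_logit:
  assumes "0 < x" "x < 1"
  shows "((\<lambda>x. ln (x / (1 - x))) has_real_derivative 1 / (x * (1 - x))) (at x)"
proof -
  have "((\<lambda>x. x / (1 - x)) has_real_derivative 1 / (1 - x)\<^sup>2) (at x)"
    using assms by (auto intro!: derivative_eq_intros simp: field_simps power2_eq_square)
  moreover have "0 < x / (1 - x)" using assms by simp
  ultimately have "((\<lambda>x. ln (x / (1 - x))) has_real_derivative 1 / (x / (1 - x)) * (1 / (1 - x)\<^sup>2)) (at x)"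
    by (intro DERIV_chain2[OF DERIV_ln_divide])
  also have "1 / (x / (1 - x)) * (1 / (1 - x)\<^sup>2) = 1 / (x * (1 - x))"
  proof -
    have "1 / (x / y) * (1 / y\<^sup>2) = 1 / (x * y)" if "0 < y" for y
      using assms that by (simp add: field_simps power2_eq_square)
    then show ?thesis using assms by simp
  qed
  finally show ?thesis .
qed

lemma dPsi_eq:
  assumes "0 < x" "x < 1"
  shows "dPsi c x = 2 * c * ((1 - 2 * x) / (x * (1 - x)) - 2 * ln (x / (1 - x)))"
  unfolding dPsi_def using assms by (simp add: divide_simps) (simp add: algebra_simps)

lemma Psi_deriv:
  assumes "0 < x" "x < 1"
  shows "(Psi c has_real_derivative dPsi c x) (at x)"
proof -
  have "((\<lambda>x. 2 * c * (1 - 2 * x) * ln (x / (1 - x))) has_real_derivative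
      2 * c * (-2) * ln (x / (1 - x)) + 2 * c * (1 - 2 * x) * (1 / (x * (1 - x)))) (at x)"
    by (rule derivative_eq_intros has_real_derivative_logit[OF assms] refl | simp)+
  also have "2 * c * (-2) * ln (x / (1 - x)) + 2 * c * (1 - 2 * x) * (1 / (x * (1 - x))) = dPsi c x"
  proof -
    have "2 * c * (-2) * l + 2 * c * (1 - 2 * x) * (1 / w) = 2 * c * ((1 - 2 * x) / w - 2 * l)" for l w :: real
      unfolding divide_inverse by (simp add: algebra_simps)
    then show ?thesis unfolding dPsi_eq[OF assms] .
  qed
  finally show ?thesis unfolding Psi_def[abs_def] .
qed

lemma deriv_Psi: "0 < x \<Longrightarrow> x < 1 \<Longrightarrow> deriv (Psi c) x = dPsi c x"
  by (rule DERIV_imp_deriv) (rule Psi_deriv)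

text \<open>This is the equation \<open>x^2 (1 - x)^2 Psi'' (x) / 2 = - c\<close>, the reason for
  the shape of \<open>Psi\<close>.\<close>

lemma dPsi_deriv:
  assumes "0 < x" "x < 1"
  shows "(dPsi c has_real_derivative - (2 * c) / (x * (1 - x))\<^sup>2) (at x)"
proof -
  have nz: "x * (1 - x) \<noteq> 0" using assms by simp
  define l where "l x = ln (x / (1 - x))" for x :: real
  have dl: "(l has_real_derivative 1 / (x * (1 - x))) (at x)"
    unfolding l_def[abs_def] by (rule has_real_derivative_logit[OF assms])
  have "((\<lambda>x. 2 * c * ((1 - 2 * x) / (x * (1 - x)) - 2 * l x)) has_real_derivative
      2 * c * (((-2) * (x * (1 - x)) - (1 - 2 * x) * (1 - 2 * x)) / (x * (1 - x))\<^sup>2 - 2 * (1 / (x * (1 - x))))) (at x)"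
  proof (rule DERIV_cmult[OF DERIV_diff[OF _ DERIV_cmult[OF dl]]])
    show "((\<lambda>x. (1 - 2 * x) / (x * (1 - x))) has_real_derivative
        ((-2) * (x * (1 - x)) - (1 - 2 * x) * (1 - 2 * x)) / (x * (1 - x))\<^sup>2) (at x)"
      using nz by (auto intro!: derivative_eq_intros simp: power2_eq_square)
  qed
  also have "2 * c * (((-2) * (x * (1 - x)) - (1 - 2 * x) * (1 - 2 * x)) / (x * (1 - x))\<^sup>2 - 2 * (1 / (x * (1 - x))))
     = - (2 * c) / (x * (1 - x))\<^sup>2"
  proof -
    \<comment> \<open>In terms of \<open>w\<close> the square \<open>(1 - 2 x)^2\<close> is
      \<open>1 - 4 w\<close>, and the bracket collapses to \<open>-1 / w^2\<close>.\<close>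
    define w where "w = x * (1 - x)"
    have w: "w \<noteq> 0" "(1 - 2 * x) * (1 - 2 * x) = 1 - 4 * w" using nz by (simp_all add: w_def algebra_simps)
    show ?thesis unfolding w_def[symmetric] w(2) using w(1) by (simp add: field_simps power2_eq_square)
  qed
  finally have d: "((\<lambda>x. 2 * c * ((1 - 2 * x) / (x * (1 - x)) - 2 * ln (x / (1 - x)))) has_real_derivative
      - (2 * c) / (x * (1 - x))\<^sup>2) (at x)" unfolding l_def .
  have "eventually (\<lambda>y. y \<in> {0<..<1}) (nhds x)" using assms by (intro eventually_nhds_in_open) auto
  then have "eventually (\<lambda>y. dPsi c y = 2 * c * ((1 - 2 * y) / (y * (1 - y)) - 2 * ln (y / (1 - y)))) (nhds x)"
    by eventually_elim (auto simp: dPsi_eq)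
  then show ?thesis using d by (subst DERIV_cong_ev[OF refl _ refl]) auto
qed

lemma dPsi_less:
  assumes "0 < c" "0 < x" "x < y" "y < 1"
  shows "dPsi c y < dPsi c x"
proof (rule DERIV_neg_imp_decreasing[OF \<open>x < y\<close>])
  fix z assume "x \<le> z" "z \<le> y"
  then have "0 < z" "z < 1" using assms by auto
  then show "\<exists>l. (dPsi c has_real_derivative l) (at z) \<and> l < 0"
    using assms by (intro exI[of _ "- (2 * c) / (z * (1 - z))\<^sup>2"] conjI dPsi_deriv divide_neg_pos) auto
qed

lemma dPsi_unbounded:
  assumes "0 < c" "b < 1"
  obtains x where "b < x" "0 < x" "x < 1" "dPsi c x \<le> L"
proof -
  \<comment> \<open>The point \<open>x = 1 - 1 / s\<close> has \<open>1 / (1 - x) = s\<close>. The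
    summands of \<open>s\<close> ensure in turn \<open>x \<ge> 1 / 2\<close>, where the logarithm is
    nonnegative, a derivative as low as \<open>L\<close>, and \<open>b < x\<close>.\<close>
  define s where "s = 2 + \<bar>L\<bar> / (2 * c) + 1 / (1 - b)"
  have s: "2 \<le> s" "1 / (1 - b) < s" "\<bar>L\<bar> / (2 * c) \<le> s - 2"
    unfolding s_def using assms by (auto simp: add_pos_nonneg)
  define x where "x = 1 - 1 / s"
  have x: "0 < x" "x < 1" "1 / 2 \<le> x" unfolding x_def using s by (auto simp: field_simps)
  have "b < x"
  proof -
    have "1 < s * (1 - b)" using s(2) assms by (simp add: field_simps)
    then have "1 / s < 1 - b" using s(1) by (simp add: field_simps)
    then show ?thesis unfolding x_def by simp
  qed
  have "1 \<le> x / (1 - x)" using x by (simp add: field_simps)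
  then have ln: "0 \<le> ln (x / (1 - x))" by simp
  have "(1 - 2 * x) / (x * (1 - x)) \<le> 2 - s"
  proof -
    have "x * (1 - x) \<le> 1 * (1 - x)" using x by (intro mult_right_mono) auto
    then have "(1 - 2 * x) / (x * (1 - x)) \<le> (1 - 2 * x) / (1 - x)"
      using x by (intro divide_left_mono_neg) auto
    also have "\<dots> = 2 - 1 / (1 - x)" using x by (simp add: field_simps)
    also have "1 / (1 - x) = s" unfolding x_def using s by simp
    finally show ?thesis by simp
  qed
  then have "(1 - 2 * x) / (x * (1 - x)) - 2 * ln (x / (1 - x)) \<le> - (\<bar>L\<bar> / (2 * c))"
    using s(3) ln by linarith
  then have "2 * c * ((1 - 2 * x) / (x * (1 - x)) - 2 * ln (x / (1 - x))) \<le> 2 * c * (- (\<bar>L\<bar> / (2 * c)))"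
    using assms(1) by (intro mult_left_mono) auto
  also have "\<dots> \<le> L" using assms(1) by simp
  finally have "dPsi c x \<le> L" using x by (simp add: dPsi_eq)
  with \<open>b < x\<close> x show ?thesis by (intro that)
qed

text \<open>By the choice of \<open>A_bar\<close> the condition reads
  \<open>dPsi c p = dPsi c b - 1\<close>. Since \<open>dPsi c\<close> is continuous, strictly
  decreasing and takes arbitrarily low values beyond \<open>b\<close>, the intermediate value
  theorem gives a solution and monotonicity its uniqueness.\<close>

lemma pi_star_ex1:
  assumes c: "0 < c" and b: "0 < b" "b < 1"
  shows "\<exists>!p. p \<in> {b<..<1} \<and> deriv (Psi c) p + A_bar c b = -1"
proof -
  have eq: "deriv (Psi c) p + A_bar c b = -1 \<longleftrightarrow> dPsi c p = dPsi c b - 1" if "p \<in> {b<..<1}" for p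
    using that b by (auto simp: A_bar_def deriv_Psi)
  obtain x where x: "b < x" "0 < x" "x < 1" "dPsi c x \<le> dPsi c b - 1"
    using dPsi_unbounded[OF c b(2)] .
  have cont: "\<forall>y. b \<le> y \<and> y \<le> x \<longrightarrow> isCont (dPsi c) y"
    using b x dPsi_deriv DERIV_isCont by (metis le_less_trans less_le_trans)
  obtain p where p: "b \<le> p" "p \<le> x" "dPsi c p = dPsi c b - 1"
    using IVT2[of "dPsi c" x "dPsi c b - 1" b] x cont by auto
  then have "p \<noteq> b" by auto
  then have p': "p \<in> {b<..<1}" using p x by auto
  show ?thesis
  proof (rule ex1I[of _ p])
    show "p \<in> {b<..<1} \<and> deriv (Psi c) p + A_bar c b = -1" using p p' eq by auto
    fix y assume y: "y \<in> {b<..<1} \<and> deriv (Psi c) y + A_bar c b = -1"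
    then have "dPsi c y = dPsi c p" using eq[of y] p by auto
    then show "y = p" using dPsi_less[OF c, of y p] dPsi_less[OF c, of p y] y p' b by (cases y p rule: linorder_cases) auto
  qed
qed

lemma pi_star:
  assumes "0 < c" "0 < b" "b < 1"
  shows "b < pi_star c b" "pi_star c b < 1" "dPsi c (pi_star c b) + A_bar c b = -1"
proof -
  have "pi_star c b \<in> {b<..<1} \<and> deriv (Psi c) (pi_star c b) + A_bar c b = -1"
    unfolding pi_star_def by (rule theI'[OF pi_star_ex1[OF assms]])
  then show "b < pi_star c b" "pi_star c b < 1" "dPsi c (pi_star c b) + A_bar c b = -1"
    using assms by (auto simp: deriv_Psi)
qed

lemma f_cand_le:
  assumes "y \<le> pi_star c b"
  shows "f_cand c b y = Psi c y + A_bar c b * y + B_bar c b"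
  using assms by (simp add: f_cand_def Psi_def)

text \<open>\<open>B_bar\<close> makes the two branches agree at \<open>pi_star\<close>, so the
  second formula also holds there.\<close>

lemma f_cand_ge:
  assumes "pi_star c b \<le> y"
  shows "f_cand c b y = 1 - y"
  using assms by (cases "y = pi_star c b") (auto simp: f_cand_def Psi_def B_bar_def)

text \<open>\<open>y (1 - y)\<close> is concave, so on an interval it is smallest at an end.\<close>

lemma mult_one_minus_ge:
  fixes y :: real
  assumes "b \<le> y" "y \<le> p"
  shows "min (b * (1 - b)) (p * (1 - p)) \<le> y * (1 - y)"
proof (cases "y + b \<le> 1")
  case True
  then have "0 \<le> (y - b) * (1 - y - b)" using assms by (intro mult_nonneg_nonneg) auto
  then have "b * (1 - b) \<le> y * (1 - y)" by (simp add: algebra_simps)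
  then show ?thesis by simp
next
  case False
  then have "0 \<le> (p - y) * (y + p - 1)" using assms by (intro mult_nonneg_nonneg) auto
  then have "p * (1 - p) \<le> y * (1 - y)" by (simp add: algebra_simps)
  then show ?thesis by simp
qed

lemma inverse_square_lipschitz:
  fixes y z :: real
  assumes "0 < b" "p < 1" "b \<le> y" "y \<le> p" "b \<le> z" "z \<le> p"
  defines "m \<equiv> min (b * (1 - b)) (p * (1 - p))"
  shows "\<bar>1 / (y * (1 - y))\<^sup>2 - 1 / (z * (1 - z))\<^sup>2\<bar> \<le> 2 / m ^ 4 * \<bar>y - z\<bar>"
proof -
  define u v where "u = y * (1 - y)" and "v = z * (1 - z)"
  have m: "0 < m" unfolding m_def using assms by auto
  have u: "m \<le> u" "u \<le> 1" and v: "m \<le> v" "v \<le> 1"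
    unfolding u_def v_def m_def using assms mult_one_minus_ge[of b y p] mult_one_minus_ge[of b z p]
    by (auto intro!: mult_le_one)
  have "1 / u\<^sup>2 - 1 / v\<^sup>2 = (v - u) * (v + u) / (u\<^sup>2 * v\<^sup>2)"
    using u v m by (simp add: field_simps power2_eq_square)
  then have "\<bar>1 / u\<^sup>2 - 1 / v\<^sup>2\<bar> = \<bar>v - u\<bar> * (v + u) / (u\<^sup>2 * v\<^sup>2)"
    using u v m by (simp add: abs_mult)
  also have "\<dots> \<le> \<bar>y - z\<bar> * 2 / (m\<^sup>2 * m\<^sup>2)"
  proof (intro frac_le mult_mono power_mono)
    have "v - u = (z - y) * (1 - (y + z))" unfolding u_def v_def by (simp add: algebra_simps)
    then have "\<bar>v - u\<bar> = \<bar>y - z\<bar> * \<bar>1 - (y + z)\<bar>" by (simp add: abs_mult abs_minus_commute)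
    also have "\<dots> \<le> \<bar>y - z\<bar> * 1" using assms by (intro mult_left_mono) auto
    finally show "\<bar>v - u\<bar> \<le> \<bar>y - z\<bar>" by simp
  qed (use u v m in auto)
  finally show ?thesis unfolding u_def v_def by (simp add: eval_nat_numeral mult_ac)
qed

text \<open>\<open>(q + u)^2\<close> exceeds \<open>q^2\<close> by \<open>u (2 q + u)\<close>, while
  the linear factor takes away at least \<open>u q^2 / \<epsilon>\<close>; the loss outweighs the
  gain because \<open>\<epsilon> \<le> q / 3\<close>.\<close>

lemma scaled_square_le:
  fixes q u \<epsilon> :: real
  assumes "0 < q" "0 < \<epsilon>" "\<epsilon> \<le> q / 3" "0 \<le> u" "u \<le> \<epsilon>"
  shows "(q + u)\<^sup>2 * (1 - u / \<epsilon>) \<le> q\<^sup>2"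
proof -
  have "(2 * q + u) * \<epsilon> \<le> (3 * q) * (q / 3)" using assms by (intro mult_mono) auto
  then have *: "2 * q + u \<le> q\<^sup>2 / \<epsilon>" using assms by (simp add: field_simps power2_eq_square)
  have eq: "(q + u)\<^sup>2 = q\<^sup>2 + u * (2 * q + u)" by (simp add: power2_eq_square algebra_simps)
  have "(q + u)\<^sup>2 * (1 - u / \<epsilon>) = q\<^sup>2 + u * (2 * q + u) - (q + u)\<^sup>2 * u / \<epsilon>"
    by (simp add: right_diff_distrib eq)
  also have "\<dots> \<le> q\<^sup>2 + u * (2 * q + u) - u * (q\<^sup>2 / \<epsilon>)"
  proof -
    have "q\<^sup>2 \<le> (q + u)\<^sup>2" using assms by (intro power_mono) auto
    then have "u * (q\<^sup>2 / \<epsilon>) \<le> u * ((q + u)\<^sup>2 / \<epsilon>)" using assms by (intro mult_left_mono divide_right_mono) auto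
    then show ?thesis by (simp add: mult_ac)
  qed
  also have "\<dots> \<le> q\<^sup>2" using mult_left_mono[OF * assms(4)] by simp
  finally show ?thesis .
qed

text \<open>The value function has a jump in its second derivative at \<open>\<pi>\<^sup>*\<close>. The functions \<open>g\<close> below
  replace the jump by a steep linear ramp on \<open>[\<pi>\<^sup>*, \<pi>\<^sup>* + \<epsilon>]\<close>; the condition \<open>\<epsilon> \<le> q / 3\<close> with
  \<open>q = \<pi>\<^sup>* (1 - \<pi>\<^sup>*)\<close> keeps the generator above \<open>- c\<close> on the ramp.\<close>

lemma smooth_candidate:
  assumes c: "0 < c" and b: "0 < b" "b < 1" and \<delta>: "0 < \<delta>"
  defines "p \<equiv> pi_star c b"
  obtains g g1 g2 :: "real \<Rightarrow> real" and K1 K2 K3 where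
    "\<And>y. b \<le> y \<Longrightarrow> (g has_real_derivative g1 y) (at y)"
    "\<And>y. b \<le> y \<Longrightarrow> (g1 has_real_derivative g2 y) (at y)"
    "g1 b = 0"
    "\<And>y. b \<le> y \<Longrightarrow> \<bar>g1 y\<bar> \<le> K1"
    "\<And>y. b \<le> y \<Longrightarrow> \<bar>g2 y\<bar> \<le> K2"
    "\<And>y z. b \<le> y \<Longrightarrow> b \<le> z \<Longrightarrow> \<bar>g2 y - g2 z\<bar> \<le> K3 * \<bar>y - z\<bar>"
    "\<And>y. b \<le> y \<Longrightarrow> y \<le> p \<Longrightarrow> g y = f_cand c b y"
    "\<And>y. b \<le> y \<Longrightarrow> y \<le> p \<Longrightarrow> g2 y / 2 * (y * (1 - y))\<^sup>2 = - c"
    "\<And>y. b \<le> y \<Longrightarrow> - c \<le> g2 y / 2 * (y * (1 - y))\<^sup>2"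
    "\<And>y. b \<le> y \<Longrightarrow> g y \<le> 1 - y"
    "\<And>y. b \<le> y \<Longrightarrow> y \<le> 1 \<Longrightarrow> f_cand c b y - \<delta> \<le> g y"
proof -
  have p: "b < p" "p < 1" "0 < p" "dPsi c p + A_bar c b = -1"
    unfolding p_def using pi_star[OF c b] b by auto
  \<comment> \<open>\<open>- D\<close> is the left-hand second derivative of the candidate at
    \<open>p\<close>, the height of the jump to be bridged.\<close>
  define q D where "q = p * (1 - p)" and "D = 2 * c / q\<^sup>2"
  have q: "0 < q" unfolding q_def using p by simp
  have D: "0 < D" unfolding D_def using c q by simp
  \<comment> \<open>The bound \<open>q / 3\<close> serves the generator; \<open>\<delta> / D\<close>
    limits how far \<open>g\<close> falls below \<open>1 - y\<close> on
    \<open>[p, 1]\<close>.\<close>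
  define \<epsilon> where "\<epsilon> = min (q / 3) (\<delta> / D)"
  have \<epsilon>: "0 < \<epsilon>" "\<epsilon> \<le> q / 3" "D * \<epsilon> \<le> \<delta>"
  proof -
    show "0 < \<epsilon>" unfolding \<epsilon>_def using q D \<delta> by auto
    show "\<epsilon> \<le> q / 3" unfolding \<epsilon>_def by (rule min.cobounded1)
    have "D * \<epsilon> \<le> D * (\<delta> / D)" unfolding \<epsilon>_def using D by (intro mult_left_mono) auto
    then show "D * \<epsilon> \<le> \<delta>" using D by simp
  qed
  have "q \<le> 1 - p" unfolding q_def using p by (intro mult_left_le_one_le) auto
  then have p\<epsilon>: "p + \<epsilon> < 1" "\<epsilon> < 1" using \<epsilon> q p by auto
  define u where "u y = Psi c y + A_bar c b * y + B_bar c b" for y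
  define u1 where "u1 y = dPsi c y + A_bar c b" for y
  define u2 where "u2 y = - (2 * c) / (y * (1 - y))\<^sup>2" for y
  \<comment> \<open>The ramp \<open>v2\<close> rises linearly from \<open>- D\<close> to 0;
    \<open>v1\<close> and \<open>v\<close> are its antiderivatives with slope \<open>-1\<close> and
    value \<open>1 - p\<close> at \<open>p\<close>. Beyond the ramp \<open>w\<close> is the affine
    continuation of \<open>v\<close>.\<close>
  define v where "v y = 1 - y - D * ((y - p)\<^sup>2 / 2 - (y - p) ^ 3 / (6 * \<epsilon>))" for y
  define v1 where "v1 y = - 1 - D * ((y - p) - (y - p)\<^sup>2 / (2 * \<epsilon>))" for y
  define v2 where "v2 y = - D * (1 - (y - p) / \<epsilon>)" for y
  define w where "w y = 1 - y - D * (\<epsilon>\<^sup>2 / 3 + \<epsilon> / 2 * (y - p - \<epsilon>))" for y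
  define w1 where "w1 y = - 1 - D * \<epsilon> / 2" for y :: real
  define w2 where "w2 y = (0 :: real)" for y :: real
  define g where "g = glue p u (glue (p + \<epsilon>) v w)"
  define g1 where "g1 = glue p u1 (glue (p + \<epsilon>) v1 w1)"
  define g2 where "g2 = glue p u2 (glue (p + \<epsilon>) v2 w2)"
  have du: "(u has_real_derivative u1 y) (at y)" "(u1 has_real_derivative u2 y) (at y)" if "0 < y" "y < 1" for y
    unfolding u_def[abs_def] u1_def[abs_def] u2_def using that
    by (auto intro!: derivative_eq_intros Psi_deriv dPsi_deriv)
  have dv: "(v has_real_derivative v1 y) (at y)" "(v1 has_real_derivative v2 y) (at y)" for y
    unfolding v_def[abs_def] v1_def[abs_def] v2_def
    using \<epsilon>(1) by (auto intro!: derivative_eq_intros simp: field_simps)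
  have dw: "(w has_real_derivative w1 y) (at y)" "(w1 has_real_derivative w2 y) (at y)" for y
    unfolding w_def[abs_def] w1_def[abs_def] w2_def by (auto intro!: derivative_eq_intros simp: field_simps)
  have vw: "v (p + \<epsilon>) = w (p + \<epsilon>)" "v1 (p + \<epsilon>) = w1 (p + \<epsilon>)" "v2 (p + \<epsilon>) = w2 (p + \<epsilon>)"
    using \<epsilon>(1) by (simp_all add: v_def w_def v1_def w1_def v2_def w2_def field_simps power2_eq_square eval_nat_numeral)
  have uv: "u p = v p" "u1 p = v1 p" "u2 p = v2 p"
    using p(4) by (simp_all add: u_def v_def u1_def v1_def u2_def v2_def D_def q_def B_bar_def p_def)
  have gp: "glue (p + \<epsilon>) v w p = v p" "glue (p + \<epsilon>) v1 w1 p = v1 p" "glue (p + \<epsilon>) v2 w2 p = v2 p"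
    using \<epsilon>(1) by simp_all
  have dg: "(g has_real_derivative g1 y) (at y)" "(g1 has_real_derivative g2 y) (at y)" if y: "b \<le> y" for y
  proof -
    have "y \<le> p \<Longrightarrow> 0 < y" "y \<le> p \<Longrightarrow> y < 1" using y b p by auto
    then show "(g has_real_derivative g1 y) (at y)" "(g1 has_real_derivative g2 y) (at y)"
      unfolding g_def g1_def g2_def
      by (auto intro!: has_real_derivative_glue du dv dw simp: uv vw gp)
  qed
  have g1b: "g1 b = 0"
    using p(1) b by (simp add: g1_def u1_def A_bar_def deriv_Psi)
  \<comment> \<open>Concavity: the slope decreases from 0 at \<open>b\<close>, by the choice of
    \<open>A_bar\<close>, to \<open>-1\<close> at \<open>p\<close>, by that of
    \<open>pi_star\<close>.\<close>
  have u1: "- 1 \<le> u1 y" "u1 y \<le> 0" if "b \<le> y" "y \<le> p" for y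
  proof -
    have "dPsi c p \<le> dPsi c y" using dPsi_less[OF c, of y p] that b p by (cases "y = p") auto
    then show "- 1 \<le> u1 y" using p(4) by (simp add: u1_def)
    have "dPsi c y \<le> dPsi c b" using dPsi_less[OF c, of b y] that b p by (cases "y = b") auto
    then show "u1 y \<le> 0" using b by (simp add: u1_def A_bar_def deriv_Psi)
  qed
  have s: "0 \<le> (y - p) - (y - p)\<^sup>2 / (2 * \<epsilon>)" "(y - p) - (y - p)\<^sup>2 / (2 * \<epsilon>) \<le> \<epsilon>"
      "0 \<le> (y - p)\<^sup>2 / 2 - (y - p) ^ 3 / (6 * \<epsilon>)" "(y - p)\<^sup>2 / 2 - (y - p) ^ 3 / (6 * \<epsilon>) \<le> \<epsilon>"
      "0 \<le> 1 - (y - p) / \<epsilon>" "1 - (y - p) / \<epsilon> \<le> 1"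
    if y: "p \<le> y" "y \<le> p + \<epsilon>" for y
  proof -
    define s where "s = y - p"
    have s: "0 \<le> s" "s \<le> \<epsilon>" using y by (auto simp: s_def)
    have s2: "s\<^sup>2 \<le> s * \<epsilon>" "0 \<le> s\<^sup>2" "s * \<epsilon> \<le> \<epsilon> * 1"
      using s p\<epsilon> mult_right_mono[of s 1 \<epsilon>] by (auto simp: power2_eq_square intro!: mult_left_mono)
    have s3: "s ^ 3 \<le> s\<^sup>2 * \<epsilon>" "0 \<le> s ^ 3" using s mult_left_mono[of s \<epsilon> "s * s"] by (auto simp: power2_eq_square eval_nat_numeral mult.assoc)
    have d1: "s\<^sup>2 / (2 * \<epsilon>) \<le> s / 2" "0 \<le> s\<^sup>2 / (2 * \<epsilon>)" using s2 \<epsilon>(1) by (simp_all add: field_simps)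
    have d2: "s ^ 3 / (6 * \<epsilon>) \<le> s\<^sup>2 / 6" "0 \<le> s ^ 3 / (6 * \<epsilon>)" using s3 \<epsilon>(1) by (simp_all add: field_simps)
    show "0 \<le> (y - p) - (y - p)\<^sup>2 / (2 * \<epsilon>)" "(y - p) - (y - p)\<^sup>2 / (2 * \<epsilon>) \<le> \<epsilon>"
      unfolding s_def[symmetric] using d1 s by linarith+
    show "0 \<le> (y - p)\<^sup>2 / 2 - (y - p) ^ 3 / (6 * \<epsilon>)" "(y - p)\<^sup>2 / 2 - (y - p) ^ 3 / (6 * \<epsilon>) \<le> \<epsilon>"
      unfolding s_def[symmetric] using d2 s2 \<epsilon>(1) by linarith+
    show "0 \<le> 1 - (y - p) / \<epsilon>" "1 - (y - p) / \<epsilon> \<le> 1"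
      unfolding s_def[symmetric] using s \<epsilon>(1) by simp_all
  qed
  have g1_bound: "\<bar>g1 y\<bar> \<le> 1 + D * \<epsilon>" if y: "b \<le> y" for y
  proof -
    have De: "0 < D * \<epsilon>" using D \<epsilon> by simp
    consider "y \<le> p" | "p < y" "y \<le> p + \<epsilon>" | "p + \<epsilon> < y" by linarith
    then show ?thesis
    proof cases
      case 1
      then show ?thesis using u1[OF y 1] De unfolding g1_def by simp
    next
      case 2
      have "D * ((y - p) - (y - p)\<^sup>2 / (2 * \<epsilon>)) \<le> D * \<epsilon>" "0 \<le> D * ((y - p) - (y - p)\<^sup>2 / (2 * \<epsilon>))"
        using D s[of y] 2 by (auto intro!: mult_left_mono mult_nonneg_nonneg)
      then show ?thesis using 2 unfolding g1_def by (simp add: v1_def)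
    next
      case 3
      then have "g1 y = - 1 - D * \<epsilon> / 2" using \<epsilon> unfolding g1_def by (simp add: w1_def)
      then show ?thesis using De by simp
    qed
  qed
  define m where "m = min (b * (1 - b)) (p * (1 - p))"
  have m: "0 < m" unfolding m_def using b p by simp
  have u2_bound: "\<bar>u2 y\<bar> \<le> 2 * c / m\<^sup>2" if "b \<le> y" "y \<le> p" for y
  proof -
    have "m \<le> y * (1 - y)" unfolding m_def by (rule mult_one_minus_ge[OF that])
    then have "2 * c / (y * (1 - y))\<^sup>2 \<le> 2 * c / m\<^sup>2" using m c by (intro frac_le power_mono) auto
    then show ?thesis unfolding u2_def using c by simp
  qed
  have g2_bound: "\<bar>g2 y\<bar> \<le> 2 * c / m\<^sup>2 + D" if y: "b \<le> y" for y
  proof -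
    have pos: "0 \<le> 2 * c / m\<^sup>2" using c by simp
    consider "y \<le> p" | "p < y" "y \<le> p + \<epsilon>" | "p + \<epsilon> < y" by linarith
    then show ?thesis
    proof cases
      case 1
      then show ?thesis using u2_bound[OF y 1] D unfolding g2_def by simp
    next
      case 2
      have "\<bar>v2 y\<bar> = D * (1 - (y - p) / \<epsilon>)" unfolding v2_def using D s(5)[of y] 2 by (simp add: abs_mult)
      also have "\<dots> \<le> D * 1" using D s(6)[of y] 2 by (intro mult_left_mono) auto
      finally show ?thesis using 2 pos unfolding g2_def by simp
    next
      case 3
      then show ?thesis using \<epsilon> D pos unfolding g2_def by (simp add: w2_def)
    qed
  qed
  define K3 where "K3 = max (2 * c * (2 / m ^ 4)) (D / \<epsilon>)"
  have K30: "0 \<le> K3" unfolding K3_def using D \<epsilon>(1) by (simp add: le_max_iff_disj)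
  have u_lip: "\<bar>u2 y - u2 z\<bar> \<le> K3 * \<bar>y - z\<bar>" if "y \<in> {b..}" "z \<in> {b..}" "y \<le> p" "z \<le> p" for y z
  proof -
    have "u2 y - u2 z = 2 * c * (1 / (z * (1 - z))\<^sup>2 - 1 / (y * (1 - y))\<^sup>2)"
      unfolding u2_def by (simp add: right_diff_distrib)
    then have "\<bar>u2 y - u2 z\<bar> = 2 * c * \<bar>1 / (z * (1 - z))\<^sup>2 - 1 / (y * (1 - y))\<^sup>2\<bar>"
      using c by (simp add: abs_mult)
    also have "\<dots> \<le> 2 * c * (2 / m ^ 4 * \<bar>z - y\<bar>)"
      unfolding m_def using c b p that by (intro mult_left_mono inverse_square_lipschitz) auto
    also have "\<dots> = 2 * c * (2 / m ^ 4) * \<bar>y - z\<bar>" by (simp add: abs_minus_commute)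
    also have "\<dots> \<le> K3 * \<bar>y - z\<bar>" unfolding K3_def by (intro mult_right_mono) auto
    finally show ?thesis .
  qed
  have v_lip: "\<bar>v2 y - v2 z\<bar> \<le> K3 * \<bar>y - z\<bar>" for y z
  proof -
    have "v2 y - v2 z = D / \<epsilon> * (y - z)" unfolding v2_def using \<epsilon>(1) by (simp add: field_simps)
    then have "\<bar>v2 y - v2 z\<bar> = D / \<epsilon> * \<bar>y - z\<bar>" using D \<epsilon>(1) by (simp add: abs_mult)
    also have "\<dots> \<le> K3 * \<bar>y - z\<bar>" unfolding K3_def by (intro mult_right_mono) auto
    finally show ?thesis .
  qed
  have vw_lip: "\<bar>glue (p + \<epsilon>) v2 w2 y - glue (p + \<epsilon>) v2 w2 z\<bar> \<le> K3 * \<bar>y - z\<bar>" for y z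
    by (rule glue_lipschitz[of UNIV]) (use v_lip vw K30 in \<open>auto simp: w2_def\<close>)
  have g2_lip: "\<bar>g2 y - g2 z\<bar> \<le> K3 * \<bar>y - z\<bar>" if "b \<le> y" "b \<le> z" for y z
    unfolding g2_def by (rule glue_lipschitz[of "{b..}", OF u_lip vw_lip]) (use that p(1) gp uv in auto)
  have g_cand: "g y = f_cand c b y" if "b \<le> y" "y \<le> p" for y
    using that(2) by (simp add: g_def u_def f_cand_le p_def)
  have gen_eq: "g2 y / 2 * (y * (1 - y))\<^sup>2 = - c" if y: "b \<le> y" "y \<le> p" for y
  proof -
    have "y * (1 - y) \<noteq> 0" using y b p by auto
    then show ?thesis using y by (simp add: g2_def u2_def)
  qed
  have gen_ge: "- c \<le> g2 y / 2 * (y * (1 - y))\<^sup>2" if y: "b \<le> y" for y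
  proof -
    consider "y \<le> p" | "p < y" "y \<le> p + \<epsilon>" | "p + \<epsilon> < y" by linarith
    then show ?thesis
    proof cases
      case 1
      then show ?thesis using gen_eq[OF y] by simp
    next
      case 2
      define t where "t = y - p"
      have t: "0 \<le> t" "t \<le> \<epsilon>" "y = p + t" using 2 by (auto simp: t_def)
      have y1: "0 < y" "y < 1" using 2 p p\<epsilon> by auto
      \<comment> \<open>The slope of \<open>y (1 - y)\<close> is at most 1, so at distance
        \<open>t\<close> from \<open>p\<close> it has grown by at most \<open>t\<close>, as
        \<open>scaled_square_le\<close> allows.\<close>
      have "y * (1 - y) = q + t * (1 - 2 * p - t)" unfolding q_def t(3) by (simp add: algebra_simps)
      also have "\<dots> \<le> q + t * 1" using t p by (intro add_left_mono mult_left_mono) auto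
      finally have "(y * (1 - y))\<^sup>2 \<le> (q + t)\<^sup>2" using y1 by (intro power_mono) auto
      then have "(y * (1 - y))\<^sup>2 * (1 - t / \<epsilon>) \<le> (q + t)\<^sup>2 * (1 - t / \<epsilon>)"
        using t \<epsilon>(1) by (intro mult_right_mono) auto
      also have "\<dots> \<le> q\<^sup>2" by (rule scaled_square_le[OF q \<epsilon>(1,2) t(1,2)])
      finally have "D / 2 * ((y * (1 - y))\<^sup>2 * (1 - t / \<epsilon>)) \<le> D / 2 * q\<^sup>2"
        using D by (intro mult_left_mono) auto
      also have "D / 2 * q\<^sup>2 = c" unfolding D_def using q by simp
      finally have "D / 2 * ((y * (1 - y))\<^sup>2 * (1 - t / \<epsilon>)) \<le> c" .
      moreover have "g2 y / 2 * (y * (1 - y))\<^sup>2 = - (D / 2 * ((y * (1 - y))\<^sup>2 * (1 - t / \<epsilon>)))"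
        using 2 unfolding g2_def by (simp add: v2_def t_def)
      ultimately show ?thesis by linarith
    next
      case 3
      then show ?thesis using c \<epsilon>(1) by (simp add: g2_def w2_def)
    qed
  qed
  have g_le: "g y \<le> 1 - y" if y: "b \<le> y" for y
  proof -
    consider "y < p" | "y = p" | "p < y" "y \<le> p + \<epsilon>" | "p + \<epsilon> < y" by linarith
    then show ?thesis
    proof cases
      case 1
      \<comment> \<open>The slope is at least \<open>-1\<close> and \<open>u p = 1 - p\<close>, so
        to the left of \<open>p\<close> the graph stays below the line \<open>1 - y\<close>.\<close>
      have "\<exists>z. y < z \<and> z < p \<and> u p - u y = (p - y) * u1 z"
        using 1 y b p by (intro MVT2 du) auto
      then obtain z where z: "y < z" "z < p" "u p - u y = (p - y) * u1 z" by blast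
      have "(p - y) * (- 1) \<le> (p - y) * u1 z" using u1(1)[of z] z y 1 by (intro mult_left_mono) auto
      moreover have "u p = 1 - p" using uv by (simp add: v_def)
      ultimately show ?thesis using z(3) 1 unfolding g_def by simp
    next
      case 2
      then show ?thesis using uv unfolding g_def by (simp add: v_def)
    next
      case 3
      then have "0 \<le> D * ((y - p)\<^sup>2 / 2 - (y - p) ^ 3 / (6 * \<epsilon>))" using D s(3)[of y] by (intro mult_nonneg_nonneg) auto
      then show ?thesis using 3 unfolding g_def by (simp add: v_def)
    next
      case 4
      then have "0 \<le> D * (\<epsilon>\<^sup>2 / 3 + \<epsilon> / 2 * (y - p - \<epsilon>))" using D \<epsilon>(1) by (intro mult_nonneg_nonneg add_nonneg_nonneg) auto
      then show ?thesis using 4 \<epsilon>(1) unfolding g_def by (simp add: w_def)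
    qed
  qed
  have g_ge: "f_cand c b y - \<delta> \<le> g y" if y: "b \<le> y" "y \<le> 1" for y
  proof -
    consider "y \<le> p" | "p < y" "y \<le> p + \<epsilon>" | "p + \<epsilon> < y" by linarith
    then show ?thesis
    proof cases
      case 1
      then show ?thesis using g_cand[OF y(1) 1] \<delta> by simp
    next
      case 2
      have "D * ((y - p)\<^sup>2 / 2 - (y - p) ^ 3 / (6 * \<epsilon>)) \<le> D * \<epsilon>" using D s(4)[of y] 2 by (intro mult_left_mono) auto
      then have "1 - y - \<delta> \<le> g y" using 2 \<epsilon>(3) unfolding g_def by (simp add: v_def)
      then show ?thesis using 2 f_cand_ge[of c b y] by (simp add: p_def)
    next
      case 3
      \<comment> \<open>Here \<open>y \<le> 1\<close> and \<open>\<epsilon> < 1\<close> enter: the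
        affine continuation departs from \<open>1 - y\<close> without bound as \<open>y\<close>
        grows.\<close>
      have "\<epsilon>\<^sup>2 / 3 + \<epsilon> / 2 * (y - p - \<epsilon>) \<le> \<epsilon> * 1 / 3 + \<epsilon> / 2 * 1"
        unfolding power2_eq_square using \<epsilon>(1) p\<epsilon> y p by (intro add_mono divide_right_mono mult_left_mono) auto
      also have "\<dots> \<le> \<epsilon>" using \<epsilon>(1) by simp
      finally have "D * (\<epsilon>\<^sup>2 / 3 + \<epsilon> / 2 * (y - p - \<epsilon>)) \<le> D * \<epsilon>" using D by (intro mult_left_mono) auto
      then have "1 - y - \<delta> \<le> g y" using 3 \<epsilon> unfolding g_def by (simp add: w_def)
      then show ?thesis using 3 \<epsilon>(1) f_cand_ge[of c b y] by (simp add: p_def)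
    qed
  qed
  show ?thesis
    by (rule that[OF dg g1b g1_bound g2_bound g2_lip g_cand gen_eq gen_ge g_le g_ge])
qed

section \<open>The stopping problem\<close>

text \<open>Rounding time down to multiples of \<open>1 / real (Suc n)\<close> leaves countably many
  times, hence joint measurability; continuity of the paths yields the limit.\<close>

lemma continuous_process_measurable:
  fixes X :: "real \<Rightarrow> 'a \<Rightarrow> real"
  assumes m: "\<And>t. 0 \<le> t \<Longrightarrow> X t \<in> borel_measurable M"
    and cont: "\<And>\<omega>. \<omega> \<in> space M \<Longrightarrow> continuous_on {0..} (\<lambda>t. X t \<omega>)"
  shows "(\<lambda>z. X (max 0 (snd z)) (fst z)) \<in> borel_measurable (M \<Otimes>\<^sub>M borel)"
proof (rule borel_measurable_LIMSEQ_real)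
  define k where "k n z = nat \<lfloor>max 0 (snd z) * real (Suc n)\<rfloor>" for n and z :: "'a \<times> real"
  show "(\<lambda>z. X (real (k n z) / real (Suc n)) (fst z)) \<in> borel_measurable (M \<Otimes>\<^sub>M borel)" for n
  proof (rule measurable_compose_countable[where g="k n" and f="\<lambda>i z. X (real i / real (Suc n)) (fst z)"])
    show "(\<lambda>z. X (real i / real (Suc n)) (fst z)) \<in> borel_measurable (M \<Otimes>\<^sub>M borel)" for i
      by (rule measurable_compose[OF measurable_fst m]) simp
    show "k n \<in> measurable (M \<Otimes>\<^sub>M borel) (count_space UNIV)"
      unfolding k_def[abs_def] by measurable
  qed
  fix z assume "z \<in> space (M \<Otimes>\<^sub>M (borel :: real measure))"
  then have \<omega>: "fst z \<in> space M" by (auto simp: space_pair_measure)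
  define u where "u = max 0 (snd z)"
  have "\<bar>real (k n z) / real (Suc n) - u\<bar> \<le> 1 / real (Suc n)" for n
  proof -
    have "real (k n z) \<le> u * real (Suc n)" "u * real (Suc n) \<le> real (k n z) + 1"
      unfolding k_def u_def by (auto simp: of_nat_nat)
    then have "real (k n z) / real (Suc n) \<le> u" "u \<le> real (k n z) / real (Suc n) + 1 / real (Suc n)"
      unfolding add_divide_distrib[symmetric]
      by (simp_all only: pos_divide_le_eq pos_le_divide_eq of_nat_0_less_iff zero_less_Suc)
    then show ?thesis by linarith
  qed
  then have "(\<lambda>n. real (k n z) / real (Suc n) - u) \<longlonglongrightarrow> 0"
    by (intro Lim_null_comparison[OF always_eventually mesh_tendsto[of 1]]) simp
  then have "(\<lambda>n. real (k n z) / real (Suc n)) \<longlonglongrightarrow> u" by (rule LIM_zero_cancel)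
  then show "(\<lambda>n. X (real (k n z) / real (Suc n)) (fst z)) \<longlonglongrightarrow> X (max 0 (snd z)) (fst z)"
    unfolding u_def[symmetric]
    by (intro continuous_on_tendsto_compose[OF cont[OF \<omega>]]) (auto simp: u_def)
qed

text \<open>On \<open>{s<..t}\<close> the integrand is positive while the integral is 0, so the
  Stieltjes measure of this interval, which is \<open>A t - A s\<close>, vanishes.\<close>

lemma flat_off_boundary:
  fixes X A :: "real \<Rightarrow> real"
  assumes X: "continuous_on {0..} X" and A: "continuous_on {0..} A" "mono_on {0..} A"
    and int: "(\<integral>\<^sup>+s\<in>{0..}. ennreal (X s - b) \<partial>interval_measure (\<lambda>s. A (max 0 s))) = 0"
    and st: "0 \<le> s" "s \<le> t" "\<And>u. u \<in> {s..t} \<Longrightarrow> b < X u"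
  shows "A t = A s"
proof -
  let ?\<mu> = "interval_measure (\<lambda>s. A (max 0 s))"
  have mono: "A (max 0 x) \<le> A (max 0 y)" if "x \<le> y" for x y
    using that by (intro mono_onD[OF A(2)]) auto
  have "continuous_on UNIV (\<lambda>s. A (max 0 s))"
    by (rule continuous_on_compose2[OF A(1)]) (auto intro!: continuous_intros)
  then have cont: "continuous (at_right a) (\<lambda>s. A (max 0 s))" for a
    by (simp add: continuous_on_eq_continuous_at continuous_at_imp_continuous_at_within)
  have Ioc: "emeasure ?\<mu> {s<..t} = ennreal (A t - A s)"
    using emeasure_interval_measure_Ioc[OF st(2) mono cont] st by simp
  have "(\<lambda>s. indicator {0..} s *\<^sub>R (X s - b)) \<in> borel_measurable borel"
    by (intro borel_measurable_continuous_on_indicator continuous_intros X) auto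
  then have "(\<lambda>s. ennreal (indicator {0..} s *\<^sub>R (X s - b))) \<in> borel_measurable ?\<mu>"
    by (simp cong: measurable_cong_sets)
  moreover have "(\<lambda>s. ennreal (indicator {0..} s *\<^sub>R (X s - b))) = (\<lambda>s. ennreal (X s - b) * indicator {0..} s)"
    by (auto simp: indicator_def)
  ultimately have m: "(\<lambda>s. ennreal (X s - b) * indicator {0..} s) \<in> borel_measurable ?\<mu>" by simp
  have "AE s in ?\<mu>. ennreal (X s - b) * indicator {0..} s = 0"
    using int by (simp only: nn_integral_0_iff_AE[OF m])
  then have "AE u in ?\<mu>. u \<notin> {s<..t}"
  proof eventually_elim
    case (elim u)
    show ?case
    proof
      assume "u \<in> {s<..t}"
      then have "b < X u" "0 \<le> u" using st by auto
      with elim show False by (simp add: ennreal_eq_0_iff)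
    qed
  qed
  then have "emeasure ?\<mu> {s<..t} = 0"
    by (subst (asm) AE_iff_measurable[where N="{s<..t}"]) auto
  with Ioc have "A t \<le> A s" by (simp add: ennreal_eq_0_iff)
  moreover have "A s \<le> A t" using mono[OF st(2)] st by simp
  ultimately show ?thesis by simp
qed

lemma space_generated_filtration [simp]: "space (generated_filtration M W u) = space M"
  unfolding generated_filtration_def by (rule space_measure_of_conv)

lemma sets_generated_filtration:
  "sets (generated_filtration M W u) = sigma_sets (space M)
     ({W s -` B \<inter> space M | s B. 0 \<le> s \<and> ennreal s \<le> u \<and> B \<in> sets borel} \<union> null_sets M)"
  unfolding generated_filtration_def
  by (rule sets_measure_of) (auto dest: null_setsD2 sets.sets_into_space)

lemma brownian_filtration_generated:
  assumes "standard_brownian_motion M (generated_filtration M W) W"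
  shows "brownian_filtration M (generated_filtration M W) W"
proof -
  interpret prob_space M using assms unfolding standard_brownian_motion_def by simp
  have W: "W s \<in> borel_measurable M" if "0 \<le> s" for s
    using assms that unfolding standard_brownian_motion_def by simp
  show ?thesis
  proof unfold_locales
    fix u v :: ennreal assume "u \<le> v"
    then show "sets (generated_filtration M W u) \<subseteq> sets (generated_filtration M W v)"
      unfolding sets_generated_filtration by (intro sigma_sets_mono') (auto intro: order_trans)
  next
    fix u :: ennreal
    show "sets (generated_filtration M W u) \<subseteq> sets M"
      unfolding sets_generated_filtration
      by (intro sets.sigma_sets_subset) (auto intro!: measurable_sets[OF W])
  qed (use assms in simp_all)
qed

text \<open>Two assumptions of the locale need an argument: flatness passes from its Stieltjes form
  to the pathwise form, and continuous paths give joint measurability of the integrand.\<close>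

lemma reflected_process_diffusion:
  assumes rd: "reflecting_diffusion M W b X A x" and bx: "b \<le> x"
  shows "reflected_process M (generated_filtration M W) W (\<lambda>s \<omega>. X s \<omega> * (1 - X s \<omega>))
    (\<lambda>t \<omega>. X t \<omega> - X 0 \<omega> - A t \<omega>) X A b x"
proof -
  let ?F = "generated_filtration M W"
  note rd' = rd[unfolded reflecting_diffusion_def Let_def]
  interpret brownian_filtration M ?F W
    using rd' by (intro brownian_filtration_generated) simp
  have X: "X t \<in> borel_measurable (?F (ennreal t))" and A: "A t \<in> borel_measurable (?F (ennreal t))" if "0 \<le> t" for t
    using rd' that unfolding adapted_process_def by auto
  have cX: "continuous_on {0..} (\<lambda>t. X t \<omega>)" and cA: "continuous_on {0..} (\<lambda>t. A t \<omega>)" if "\<omega> \<in> space M" for \<omega>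
    using rd' that unfolding continuous_paths_def by auto
  have "(\<lambda>z. X (max 0 (snd z)) (fst z)) \<in> borel_measurable (M \<Otimes>\<^sub>M borel)"
    using X measurable_F_M cX by (intro continuous_process_measurable) blast+
  then have XN: "(\<lambda>z. X (max 0 (snd z)) (fst z)) \<in> borel_measurable NN"
    unfolding NN_def by (simp cong: measurable_cong_sets sets_pair_measure_cong)
  have "AE \<omega> in M. \<forall>s t. 0 \<le> s \<and> s \<le> t \<and> (\<forall>u\<in>{s..t}. b < X u \<omega>) \<longrightarrow> A t \<omega> = A s \<omega>"
  proof -
    have "AE \<omega> in M. mono_on {0..} (\<lambda>t. A t \<omega>)"
      "AE \<omega> in M. (\<integral>\<^sup>+s\<in>{0..}. ennreal (X s \<omega> - b) \<partial>interval_measure (\<lambda>s. A (max 0 s) \<omega>)) = 0"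
      using rd' by auto
    then show ?thesis using AE_space
    proof eventually_elim
      case (elim \<omega>)
      show ?case
        using flat_off_boundary[OF cX[OF elim(3)] cA[OF elim(3)] elim(1,2)] by blast
    qed
  qed
  then show ?thesis
    using rd' X A cX cA bx
    by unfold_locales (auto intro!: borel_measurable_times borel_measurable_diff XN)
qed

text \<open>\<open>dynkin\<close> asks for bounds and continuity on the whole line, so the functions
  are composed with \<open>max b\<close>, which freezes them below \<open>b\<close>, and all
  constants are merged into one \<open>K\<close>.\<close>

lemma test_function_exists:
  assumes c: "0 < c" and b: "0 < b" "b < 1" and \<delta>: "0 < \<delta>"
  defines "p \<equiv> pi_star c b"
  obtains f f1 f2 :: "real \<Rightarrow> real" and K where
    "\<And>y z. b \<le> y \<Longrightarrow> b \<le> z \<Longrightarrow>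
      \<bar>f z - f y - f1 y * (z - y) - f2 y / 2 * (z - y)\<^sup>2\<bar> \<le> K * min 1 \<bar>z - y\<bar> * (z - y)\<^sup>2"
    "\<And>y. b \<le> y \<Longrightarrow> \<bar>f1 y\<bar> \<le> K * (y - b)" "\<And>y. \<bar>f1 y\<bar> \<le> K" "f1 \<in> borel_measurable borel"
    "\<And>y. \<bar>f2 y\<bar> \<le> K" "continuous_on UNIV f2"
    "\<And>y. \<bar>f y\<bar> \<le> K * (1 + \<bar>y\<bar>)" "continuous_on UNIV f"
    "\<And>y. b \<le> y \<Longrightarrow> y \<le> p \<Longrightarrow> f y = f_cand c b y"
    "\<And>y. b \<le> y \<Longrightarrow> y \<le> p \<Longrightarrow> f2 y / 2 * (y * (1 - y))\<^sup>2 = - c"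
    "\<And>y. b \<le> y \<Longrightarrow> - c \<le> f2 y / 2 * (y * (1 - y))\<^sup>2"
    "\<And>y. b \<le> y \<Longrightarrow> f y \<le> 1 - y"
    "\<And>y. b \<le> y \<Longrightarrow> y \<le> 1 \<Longrightarrow> f_cand c b y - \<delta> \<le> f y"
proof (rule smooth_candidate[OF c b \<delta>, folded p_def])
  fix g g1 g2 :: "real \<Rightarrow> real" and K1 K2 K3
  assume dg: "\<And>y. b \<le> y \<Longrightarrow> (g has_real_derivative g1 y) (at y)"
    and dg1: "\<And>y. b \<le> y \<Longrightarrow> (g1 has_real_derivative g2 y) (at y)"
    and g1b: "g1 b = 0"
    and K1: "\<And>y. b \<le> y \<Longrightarrow> \<bar>g1 y\<bar> \<le> K1"
    and K2: "\<And>y. b \<le> y \<Longrightarrow> \<bar>g2 y\<bar> \<le> K2"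
    and K3: "\<And>y z. b \<le> y \<Longrightarrow> b \<le> z \<Longrightarrow> \<bar>g2 y - g2 z\<bar> \<le> K3 * \<bar>y - z\<bar>"
    and g: "\<And>y. b \<le> y \<Longrightarrow> y \<le> p \<Longrightarrow> g y = f_cand c b y"
    "\<And>y. b \<le> y \<Longrightarrow> y \<le> p \<Longrightarrow> g2 y / 2 * (y * (1 - y))\<^sup>2 = - c"
    "\<And>y. b \<le> y \<Longrightarrow> - c \<le> g2 y / 2 * (y * (1 - y))\<^sup>2"
    "\<And>y. b \<le> y \<Longrightarrow> g y \<le> 1 - y"
    "\<And>y. b \<le> y \<Longrightarrow> y \<le> 1 \<Longrightarrow> f_cand c b y - \<delta> \<le> g y"
  \<comment> \<open>\<open>2 * K2\<close> covers \<open>\<bar>y - z\<bar> > 1\<close>, where two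
    uniform bounds replace the Lipschitz estimate; \<open>\<bar>g b\<bar> + K1\<close> covers the
    linear growth.\<close>
  define K where "K = max (max K1 (\<bar>g b\<bar> + K1)) (max (2 * K2) (max K2 K3))"
  have nn: "0 \<le> K1" "0 \<le> K2" "0 \<le> K3" using K1[of b] K2[of b] K3[of b "b + 1"] by auto
  have K: "K1 \<le> K" "\<bar>g b\<bar> + K1 \<le> K" "2 * K2 \<le> K" "K2 \<le> K" "K3 \<le> K"
    unfolding K_def by auto
  define f f1 f2 where "f y = g (max b y)" and "f1 y = g1 (max b y)" and "f2 y = g2 (max b y)" for y
  have K3': "\<bar>g2 y - g2 z\<bar> \<le> K * min 1 \<bar>y - z\<bar>" if "b \<le> y" "b \<le> z" for y z
  proof (cases "\<bar>y - z\<bar> \<le> 1")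
    case True
    have "\<bar>g2 y - g2 z\<bar> \<le> K3 * \<bar>y - z\<bar>" by (rule K3[OF that])
    also have "\<dots> \<le> K * \<bar>y - z\<bar>" using K by (intro mult_right_mono) auto
    finally show ?thesis using True by simp
  next
    case False
    then show ?thesis using K2[OF that(1)] K2[OF that(2)] K by (simp add: min_def)
  qed
  have mvt: "\<bar>h y - h b\<bar> \<le> L * (y - b)"
    if h: "\<And>y. b \<le> y \<Longrightarrow> (h has_real_derivative h' y) (at y)" "\<And>y. b \<le> y \<Longrightarrow> \<bar>h' y\<bar> \<le> L" and y: "b \<le> y"
    for h h' L y
  proof (cases "y = b")
    case False
    then obtain \<xi> where \<xi>: "b < \<xi>" "\<xi> < y" "h y - h b = (y - b) * h' \<xi>"
      using MVT2[of b y h h'] h y by auto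
    have "\<bar>h y - h b\<bar> = \<bar>h' \<xi>\<bar> * (y - b)" using \<xi>(3) y by (simp add: abs_mult mult.commute)
    also have "\<dots> \<le> L * (y - b)" using h(2)[of \<xi>] \<xi> y by (intro mult_right_mono) auto
    finally show ?thesis .
  qed simp
  have clamp: "continuous_on UNIV (\<lambda>y. h (max b y))" if "continuous_on {b..} h" for h :: "real \<Rightarrow> real"
    by (rule continuous_on_compose2[OF that]) (auto intro!: continuous_intros)
  have cont: "continuous_on {b..} g" "continuous_on {b..} g1" "continuous_on {b..} g2"
  proof -
    show "continuous_on {b..} g" "continuous_on {b..} g1"
      using dg dg1 by (auto intro!: continuous_at_imp_continuous_on DERIV_isCont)
    show "continuous_on {b..} g2"
      using K3 nn by (intro lipschitz_on_continuous_on[where L=K3] lipschitz_onI) (auto simp: dist_real_def)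
  qed
  have f_eq: "f y = g y" "f1 y = g1 y" "f2 y = g2 y" if "b \<le> y" for y
    using that by (simp_all add: f_def f1_def f2_def max_def)
  show ?thesis
  proof (rule that[of f f1 f2 K])
    show "\<bar>f z - f y - f1 y * (z - y) - f2 y / 2 * (z - y)\<^sup>2\<bar> \<le> K * min 1 \<bar>z - y\<bar> * (z - y)\<^sup>2"
      if "b \<le> y" "b \<le> z" for y z
      using taylor_remainder[OF dg dg1 K3' that] that by (simp add: f_eq)
    show "\<bar>f1 y\<bar> \<le> K * (y - b)" if "b \<le> y" for y
    proof -
      have "\<bar>g1 y - g1 b\<bar> \<le> K2 * (y - b)" by (rule mvt[OF dg1 K2 that])
      also have "\<dots> \<le> K * (y - b)" using K that by (intro mult_right_mono) auto
      finally show ?thesis using g1b that by (simp add: f_eq)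
    qed
    show "\<bar>f1 y\<bar> \<le> K" "\<bar>f2 y\<bar> \<le> K" for y
      using K1[of "max b y"] K2[of "max b y"] K unfolding f1_def f2_def by auto
    show "continuous_on UNIV f" "continuous_on UNIV f2"
      unfolding f_def[abs_def] f2_def[abs_def] by (intro clamp cont)+
    show "f1 \<in> borel_measurable borel"
      unfolding f1_def[abs_def] by (intro borel_measurable_continuous_onI clamp cont)
    show "\<bar>f y\<bar> \<le> K * (1 + \<bar>y\<bar>)" for y
    proof -
      have "\<bar>f y - g b\<bar> \<le> K1 * (max b y - b)" unfolding f_def by (rule mvt[OF dg K1 max.cobounded1])
      also have "\<dots> \<le> K1 * \<bar>y\<bar>" using b nn by (intro mult_left_mono) auto
      finally have "\<bar>f y\<bar> \<le> (\<bar>g b\<bar> + K1) * 1 + K1 * \<bar>y\<bar>" using nn by simp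
      also have "\<dots> \<le> K * 1 + K * \<bar>y\<bar>" using K by (intro add_mono mult_right_mono) auto
      finally show ?thesis by (simp add: algebra_simps)
    qed
  qed (use g f_eq in simp_all)
qed

context reflected_process
begin

lemma stopped_at_measurable:
  assumes "stopping_time F \<tau>"
  shows "\<tau> \<in> borel_measurable M" and "stopped_at T \<tau> \<in> borel_measurable M"
proof -
  show [measurable]: "\<tau> \<in> borel_measurable M"
    using sets_F_le space_F by (intro measurable_stopping_time[OF assms]) auto
  show "stopped_at T \<tau> \<in> borel_measurable M" unfolding stopped_at_def[abs_def] by measurable
qed

text \<open>Tonelli: for each path the time section \<open>(0, r]\<close> has length
  \<open>r\<close>. This turns a generator with constant value \<open>- c\<close> into
  \<open>- c\<close> times a mean time.\<close>

lemma occupation_integral: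
  fixes r :: "'a \<Rightarrow> real"
  assumes [measurable]: "r \<in> borel_measurable M" and r: "\<And>\<omega>. 0 \<le> r \<omega>" "\<And>\<omega>. r \<omega> \<le> T"
  shows "integrable NN (\<lambda>z. indicator {0<..r (fst z)} (snd z) :: real)"
    and "(\<integral>z. indicator {0<..r (fst z)} (snd z) \<partial>NN) = expectation r"
proof -
  have eq: "indicator {0<..r (fst z)} (snd z) = (of_bool (0 < snd z \<and> snd z \<le> r (fst z)) :: real)" for z
    by (simp add: indicator_def)
  have m: "(\<lambda>z. indicator {0<..r (fst z)} (snd z) :: real) \<in> borel_measurable NN"
    unfolding eq by measurable
  then have m': "(\<lambda>z. ennreal (indicator {0<..r (fst z)} (snd z))) \<in> borel_measurable (M \<Otimes>\<^sub>M lborel)"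
    unfolding NN_def by simp
  have ir: "integrable M r" using r by (intro integrable_const_bound[of _ T]) auto
  have "(\<integral>\<^sup>+z. ennreal (indicator {0<..r (fst z)} (snd z)) \<partial>NN) =
     (\<integral>\<^sup>+\<omega>. (\<integral>\<^sup>+u. ennreal (indicator {0<..r \<omega>} u) \<partial>lborel) \<partial>M)"
    unfolding NN_def using lborel.nn_integral_fst[OF m'] by simp
  also have "\<dots> = (\<integral>\<^sup>+\<omega>. ennreal (r \<omega>) \<partial>M)"
    using r(1) by (simp add: ennreal_indicator)
  also have "\<dots> = ennreal (expectation r)" using r by (intro nn_integral_eq_integral ir) auto
  finally have nn: "(\<integral>\<^sup>+z. ennreal (indicator {0<..r (fst z)} (snd z)) \<partial>NN) = ennreal (expectation r)" .
  show "integrable NN (\<lambda>z. indicator {0<..r (fst z)} (snd z) :: real)"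
    using nn by (intro integrableI_nonneg m) auto
  have "(\<integral>z. indicator {0<..r (fst z)} (snd z) \<partial>NN) = enn2real (\<integral>\<^sup>+z. ennreal (indicator {0<..r (fst z)} (snd z)) \<partial>NN)"
    by (intro integral_eq_nn_integral m) auto
  then show "(\<integral>z. indicator {0<..r (fst z)} (snd z) \<partial>NN) = expectation r"
    unfolding nn using r by simp
qed

lemma AE_NN_fst:
  assumes "AE \<omega> in M. P \<omega>"
  shows "AE z in NN. P (fst z)"
proof -
  obtain N where N: "{\<omega> \<in> space M. \<not> P \<omega>} \<subseteq> N" "emeasure M N = 0" "N \<in> sets M"
    using assms by (rule AE_E)
  show ?thesis
  proof (rule AE_I)
    show "{z \<in> space NN. \<not> P (fst z)} \<subseteq> N \<times> UNIV"
      using N(1) unfolding NN_def by (auto simp: space_pair_measure)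
    show "emeasure NN (N \<times> UNIV) = 0"
      unfolding NN_def using N by (subst lborel.emeasure_pair_measure_Times) auto
    show "N \<times> UNIV \<in> sets NN" unfolding NN_def using N by auto
  qed
qed

end

locale reflecting_stopping = reflected_process M F W "\<lambda>s \<omega>. X s \<omega> * (1 - X s \<omega>)"
    "\<lambda>t \<omega>. X t \<omega> - X 0 \<omega> - A t \<omega>" X A b x
  for M :: "'a measure" and F W X A b x +
  fixes c :: real
  assumes c: "0 < c" and b: "0 < b" "b < 1" and x1: "x \<le> 1"
begin

lemma XN_measurable: "(\<lambda>z. X (max 0 (snd z)) (fst z)) \<in> borel_measurable (M \<Otimes>\<^sub>M borel)"
  by (intro continuous_process_measurable X_measurable X_continuous)

lemma X_at_measurable:
  assumes "r \<in> borel_measurable M" "\<And>\<omega>. 0 \<le> r \<omega>"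
  shows "(\<lambda>\<omega>. X (r \<omega>) \<omega>) \<in> borel_measurable M"
proof -
  have "(\<lambda>\<omega>. (\<omega>, r \<omega>)) \<in> measurable M (M \<Otimes>\<^sub>M borel)" using assms by measurable
  from measurable_compose[OF this XN_measurable] show ?thesis using assms(2) by (simp add: max_def)
qed

text \<open>Compares the generator term of \<open>dynkin\<close> with \<open>- c\<close> under the
  integral, path by path up to \<open>r\<close>; equality holds as long as the path stays where the
  generator equation does.\<close>

lemma stopped_test_function:
  fixes f f1 f2 :: "real \<Rightarrow> real"
  assumes T: "0 < T" and st: "stopping_time F \<tau>"
    and taylor: "\<And>y z. b \<le> y \<Longrightarrow> b \<le> z \<Longrightarrow>
      \<bar>f z - f y - f1 y * (z - y) - f2 y / 2 * (z - y)\<^sup>2\<bar> \<le> K * min 1 \<bar>z - y\<bar> * (z - y)\<^sup>2"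
    and f1: "\<And>y. b \<le> y \<Longrightarrow> \<bar>f1 y\<bar> \<le> K * (y - b)" "\<And>y. \<bar>f1 y\<bar> \<le> K" "f1 \<in> borel_measurable borel"
    and f2: "\<And>y. \<bar>f2 y\<bar> \<le> K" "continuous_on UNIV f2"
    and f: "\<And>y. \<bar>f y\<bar> \<le> K * (1 + \<bar>y\<bar>)" "continuous_on UNIV f"
    and gen: "\<And>y. b \<le> y \<Longrightarrow> - c \<le> f2 y / 2 * (y * (1 - y))\<^sup>2"
  defines "r \<equiv> stopped_at T \<tau>"
  shows "integrable M (\<lambda>\<omega>. f (X (r \<omega>) \<omega>))"
    and "f x - c * expectation r \<le> expectation (\<lambda>\<omega>. f (X (r \<omega>) \<omega>))"
    and "\<lbrakk>AE \<omega> in M. \<forall>u. 0 < u \<and> u \<le> r \<omega> \<longrightarrow> X u \<omega> \<le> p; \<And>y. b \<le> y \<Longrightarrow> y \<le> p \<Longrightarrow> f2 y / 2 * (y * (1 - y))\<^sup>2 = - c\<rbrakk>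
      \<Longrightarrow> expectation (\<lambda>\<omega>. f (X (r \<omega>) \<omega>)) = f x - c * expectation r"
proof -
  define L where "L z = indicator {0<..r (fst z)} (snd z) * (f2 (X (max 0 (snd z)) (fst z)) / 2 * (Hm z)\<^sup>2)" for z
  note dy = dynkin[OF T st taylor f1 f2 f, folded r_def]
  show "integrable M (\<lambda>\<omega>. f (X (r \<omega>) \<omega>))" by (rule dy(1))
  have L: "integrable NN L" "expectation (\<lambda>\<omega>. f (X (r \<omega>) \<omega>)) = f x + (\<integral>z. L z \<partial>NN)"
    unfolding L_def[abs_def] using dy(2,3) by simp_all
  have r: "r \<in> borel_measurable M" "\<And>\<omega>. 0 \<le> r \<omega>" "\<And>\<omega>. r \<omega> \<le> T"
    unfolding r_def using T by (auto intro: stopped_at_measurable[OF st] stopped_at_nonneg stopped_at_le)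
  note occ = occupation_integral[OF r]
  define I where "I z = - c * indicator {0<..r (fst z)} (snd z)" for z :: "'a \<times> real"
  have I: "integrable NN I" "(\<integral>z. I z \<partial>NN) = - c * expectation r"
    unfolding I_def[abs_def] using occ by auto
  have L_eq: "L z = indicator {0<..r (fst z)} (snd z) * (f2 (X (snd z) (fst z)) / 2 * (X (snd z) (fst z) * (1 - X (snd z) (fst z)))\<^sup>2)" for z
    unfolding L_def Hm_def by (auto simp: indicator_def max_def)
  have "AE z in NN. I z \<le> L z"
    using AE_NN_fst[OF AE_good_path]
  proof eventually_elim
    case (elim z)
    show ?case
    proof (cases "snd z \<in> {0<..r (fst z)}")
      case True
      then show ?thesis using gen[OF good_path_ge[OF elim, of "snd z"]] unfolding I_def L_eq by simp
    qed (simp add: I_def L_eq)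
  qed
  then have "(\<integral>z. I z \<partial>NN) \<le> (\<integral>z. L z \<partial>NN)" by (intro integral_mono_AE I L)
  then show "f x - c * expectation r \<le> expectation (\<lambda>\<omega>. f (X (r \<omega>) \<omega>))" using I L by simp
  assume low: "AE \<omega> in M. \<forall>u. 0 < u \<and> u \<le> r \<omega> \<longrightarrow> X u \<omega> \<le> p"
    and eq: "\<And>y. b \<le> y \<Longrightarrow> y \<le> p \<Longrightarrow> f2 y / 2 * (y * (1 - y))\<^sup>2 = - c"
  have "AE z in NN. L z = I z"
    using AE_NN_fst[OF AE_good_path] AE_NN_fst[OF low]
  proof eventually_elim
    case (elim z)
    show ?case
    proof (cases "snd z \<in> {0<..r (fst z)}")
      case True
      then have "X (snd z) (fst z) \<le> p" using elim(2) by simp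
      with True show ?thesis using eq[OF good_path_ge[OF elim(1), of "snd z"]] unfolding I_def L_eq by simp
    qed (simp add: I_def L_eq)
  qed
  then have "(\<integral>z. L z \<partial>NN) = (\<integral>z. I z \<partial>NN)"
    using I L by (intro integral_cong_AE) auto
  then show "expectation (\<lambda>\<omega>. f (X (r \<omega>) \<omega>)) = f x - c * expectation r" using I L by simp
qed

section \<open>The lower bound for an arbitrary stopping time\<close>

lemma stopped_at_eq:
  assumes "\<tau> \<omega> \<noteq> \<infinity>"
  shows "eventually (\<lambda>n. stopped_at (real (Suc n)) \<tau> \<omega> = enn2real (\<tau> \<omega>)) sequentially"
  using eventually_ge_at_top[of "nat \<lceil>enn2real (\<tau> \<omega>)\<rceil>"]
proof eventually_elim
  case (elim n)
  then have "enn2real (\<tau> \<omega>) \<le> real n" by (simp only: nat_ceiling_le_eq)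
  then have "enn2real (\<tau> \<omega>) \<le> real (Suc n)" by simp
  then have "ennreal (enn2real (\<tau> \<omega>)) \<le> ennreal (real (Suc n))" by (rule ennreal_leI)
  then have "\<tau> \<omega> \<le> ennreal (real (Suc n))" using assms by (simp add: less_top del: of_nat_Suc)
  then show ?case unfolding stopped_at_def by (simp add: min_def)
qed

lemma stopped_at_le_tau: "ennreal (stopped_at T \<tau> \<omega>) \<le> \<tau> \<omega>"
  unfolding ennreal_stopped_at by simp

lemma finite_mean:
  assumes "stopping_time F \<tau>" "(\<integral>\<^sup>+\<omega>. \<tau> \<omega> \<partial>M) \<noteq> \<infinity>"
  shows "AE \<omega> in M. \<tau> \<omega> \<noteq> \<infinity>" and "integrable M (\<lambda>\<omega>. enn2real (\<tau> \<omega>))"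
    and "AE \<omega> in M. \<forall>T. stopped_at T \<tau> \<omega> \<le> enn2real (\<tau> \<omega>)"
proof -
  have m [measurable]: "\<tau> \<in> borel_measurable M" by (rule stopped_at_measurable(1)[OF assms(1)])
  show fin: "AE \<omega> in M. \<tau> \<omega> \<noteq> \<infinity>" using assms(2) by (intro nn_integral_noteq_infinite) auto
  show "integrable M (\<lambda>\<omega>. enn2real (\<tau> \<omega>))"
  proof (rule integrableI_bounded)
    have "(\<integral>\<^sup>+\<omega>. ennreal (norm (enn2real (\<tau> \<omega>))) \<partial>M) \<le> (\<integral>\<^sup>+\<omega>. \<tau> \<omega> \<partial>M)"
      by (intro nn_integral_mono) (simp add: ennreal_enn2real_if)
    also have "\<dots> < \<infinity>" using assms(2) by (simp add: less_top)
    finally show "(\<integral>\<^sup>+\<omega>. ennreal (norm (enn2real (\<tau> \<omega>))) \<partial>M) < \<infinity>" .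
  qed simp
  show "AE \<omega> in M. \<forall>T. stopped_at T \<tau> \<omega> \<le> enn2real (\<tau> \<omega>)"
    using fin by eventually_elim (auto simp: stopped_at_def less_top intro!: enn2real_mono)
qed

lemma cost_ge:
  assumes st: "stopping_time F \<tau>"
  shows "ereal (f_cand c b x) \<le> expected_cost M X c \<tau>"
proof (cases "(\<integral>\<^sup>+\<omega>. \<tau> \<omega> \<partial>M) = \<infinity>")
  case True
  then show ?thesis unfolding expected_cost_def by simp
next
  case False
  note fm = finite_mean[OF st False]
  define t where "t \<omega> = enn2real (\<tau> \<omega>)" for \<omega>
  have t_int: "integrable M t" unfolding t_def[abs_def] by (rule fm(2))
  have t0: "0 \<le> t \<omega>" for \<omega> by (simp add: t_def)
  have Xt [measurable]: "(\<lambda>\<omega>. X (t \<omega>) \<omega>) \<in> borel_measurable M"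
    using t_int t0 by (intro X_at_measurable) auto
  \<comment> \<open>The smooth test function may fall below the candidate at \<open>x\<close> by up
    to \<open>\<delta>\<close>, which is sent to 0 at the end.\<close>
  have le: "f_cand c b x - \<delta> \<le> (\<integral>\<omega>. c * t \<omega> + (1 - X (t \<omega>) \<omega>) \<partial>M)" if \<delta>: "0 < \<delta>" for \<delta>
  proof (rule test_function_exists[OF c b \<delta>])
    fix f f1 f2 :: "real \<Rightarrow> real" and K
    assume taylor: "\<And>y z. b \<le> y \<Longrightarrow> b \<le> z \<Longrightarrow>
      \<bar>f z - f y - f1 y * (z - y) - f2 y / 2 * (z - y)\<^sup>2\<bar> \<le> K * min 1 \<bar>z - y\<bar> * (z - y)\<^sup>2"
    and f1: "\<And>y. b \<le> y \<Longrightarrow> \<bar>f1 y\<bar> \<le> K * (y - b)" "\<And>y. \<bar>f1 y\<bar> \<le> K" "f1 \<in> borel_measurable borel"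
    and f2: "\<And>y. \<bar>f2 y\<bar> \<le> K" "continuous_on UNIV f2"
    and f: "\<And>y. \<bar>f y\<bar> \<le> K * (1 + \<bar>y\<bar>)" "continuous_on UNIV f"
    and gen: "\<And>y. b \<le> y \<Longrightarrow> - c \<le> f2 y / 2 * (y * (1 - y))\<^sup>2"
    and f_le: "\<And>y. b \<le> y \<Longrightarrow> f y \<le> 1 - y"
    and f_ge: "\<And>y. b \<le> y \<Longrightarrow> y \<le> 1 \<Longrightarrow> f_cand c b y - \<delta> \<le> f y"
    define r where "r n = stopped_at (real (Suc n)) \<tau>" for n
    have sf: "integrable M (\<lambda>\<omega>. f (X (r n \<omega>) \<omega>))"
        "f x - c * expectation (r n) \<le> expectation (\<lambda>\<omega>. f (X (r n \<omega>) \<omega>))" for n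
    proof -
      have T: "0 < real (Suc n)" by simp
      note t = stopped_test_function[OF T st taylor f1 f2 f gen]
      show "integrable M (\<lambda>\<omega>. f (X (r n \<omega>) \<omega>))" unfolding r_def by (rule t(1))
      show "f x - c * expectation (r n) \<le> expectation (\<lambda>\<omega>. f (X (r n \<omega>) \<omega>))" unfolding r_def by (rule t(2))
    qed
    have r0: "0 \<le> r n \<omega>" for n \<omega> unfolding r_def by (rule stopped_at_nonneg)
    have [measurable]: "r n \<in> borel_measurable M" for n unfolding r_def by (rule stopped_at_measurable(2)[OF st])
    have r_le: "r n \<omega> \<le> real (Suc n)" for n \<omega> unfolding r_def by (rule stopped_at_le) simp
    have r_int: "integrable M (r n)" for n
      using r0 r_le by (intro integrable_const_bound[of _ "real (Suc n)"]) auto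
    have "expectation (r n) \<le> expectation t" for n
      using fm(3) unfolding t_def[abs_def] r_def[symmetric]
      by (intro integral_mono_AE r_int fm(2)) (auto simp: r_def elim!: eventually_mono)
    then have "c * expectation (r n) \<le> c * expectation t" for n using c by (intro mult_left_mono) auto
    with sf(2) have lower: "f x - c * expectation t \<le> expectation (\<lambda>\<omega>. f (X (r n \<omega>) \<omega>))" for n
      by (meson diff_left_mono order_trans)
    \<comment> \<open>Almost surely nonnegative because \<open>f y \<le> 1 - y \<le> 1 - b\<close>,
      and at least \<open>X - b\<close>. One application of Fatou's lemma along the truncated times
      thus controls both \<open>f (X)\<close> and \<open>X\<close> at \<open>\<tau>\<close>, where
      neither is yet known to be integrable.\<close>
    define Z where "Z n \<omega> = 1 - b - f (X (r n \<omega>) \<omega>)" for n \<omega>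
    define Z' where "Z' \<omega> = 1 - b - f (X (t \<omega>) \<omega>)" for \<omega>
    have fb: "f \<in> borel_measurable borel" using f(2) by (rule borel_measurable_continuous_onI)
    have mZ' [measurable]: "Z' \<in> borel_measurable M"
      unfolding Z'_def[abs_def] using measurable_compose[OF Xt fb] by simp
    have iZ: "integrable M (Z n)" for n unfolding Z_def[abs_def] using sf(1) by simp
    have Z_pos: "AE \<omega> in M. 0 \<le> Z n \<omega>" for n
      using AE_good_path
    proof eventually_elim
      case (elim \<omega>)
      have "b \<le> X (r n \<omega>) \<omega>" by (rule good_path_ge[OF elim r0])
      then show ?case using f_le[of "X (r n \<omega>) \<omega>"] unfolding Z_def by simp
    qed
    have Z'_ge: "AE \<omega> in M. b \<le> X (t \<omega>) \<omega> \<and> X (t \<omega>) \<omega> - b \<le> Z' \<omega>"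
      using AE_good_path
    proof eventually_elim
      case (elim \<omega>)
      have "b \<le> X (t \<omega>) \<omega>" by (rule good_path_ge[OF elim t0])
      then show ?case using f_le[of "X (t \<omega>) \<omega>"] unfolding Z'_def by simp
    qed
    have Zlim: "AE \<omega> in M. liminf (\<lambda>n. ennreal (Z n \<omega>)) = ennreal (Z' \<omega>)"
      using fm(1)
    proof eventually_elim
      case (elim \<omega>)
      have "eventually (\<lambda>n. r n \<omega> = t \<omega>) sequentially"
        unfolding r_def t_def by (rule stopped_at_eq[of \<tau> \<omega>, OF elim])
      then have "eventually (\<lambda>n. ennreal (Z n \<omega>) = ennreal (Z' \<omega>)) sequentially"
        by eventually_elim (simp only: Z_def Z'_def)
      then show ?case by (intro lim_imp_Liminf tendsto_eventually) auto
    qed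
    have "(\<integral>\<^sup>+\<omega>. ennreal (Z' \<omega>) \<partial>M) = (\<integral>\<^sup>+\<omega>. liminf (\<lambda>n. ennreal (Z n \<omega>)) \<partial>M)"
      using Zlim by (intro nn_integral_cong_AE) (auto elim!: eventually_mono)
    also have "\<dots> \<le> liminf (\<lambda>n. \<integral>\<^sup>+\<omega>. ennreal (Z n \<omega>) \<partial>M)"
      using iZ by (intro nn_integral_liminf) auto
    also have "\<dots> \<le> liminf (\<lambda>n :: nat. ennreal (1 - b - (f x - c * expectation t)))"
    proof (intro Liminf_mono always_eventually allI)
      fix n
      have "expectation (Z n) = 1 - b - expectation (\<lambda>\<omega>. f (X (r n \<omega>) \<omega>))"
        unfolding Z_def[abs_def] using sf(1) by (simp add: prob_space)
      then have "expectation (Z n) \<le> 1 - b - (f x - c * expectation t)" using lower[of n] by simp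
      then show "(\<integral>\<^sup>+\<omega>. ennreal (Z n \<omega>) \<partial>M) \<le> ennreal (1 - b - (f x - c * expectation t))"
        unfolding nn_integral_eq_integral[OF iZ Z_pos] by (rule ennreal_leI)
    qed
    also have "\<dots> = ennreal (1 - b - (f x - c * expectation t))" by (rule Liminf_const) simp
    finally have nnZ: "(\<integral>\<^sup>+\<omega>. ennreal (Z' \<omega>) \<partial>M) \<le> ennreal (1 - b - (f x - c * expectation t))" .
    have Z'0: "AE \<omega> in M. 0 \<le> Z' \<omega>" using Z'_ge by eventually_elim simp
    have iZ': "integrable M Z'"
      using nnZ by (intro integrableI_nonneg Z'0 mZ') (auto intro: le_less_trans)
    \<comment> \<open>This makes the upper bound nonnegative, so it passes from
      \<open>ennreal\<close> back to the reals unchanged.\<close>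
    have fx: "f x \<le> 1 - b" using f_le[OF b_le_x] b_le_x by simp
    have "0 \<le> c * expectation t" using c t0 by (intro mult_nonneg_nonneg integral_nonneg) auto
    then have "0 \<le> 1 - b - (f x - c * expectation t)" using fx by simp
    then have EZ': "expectation Z' \<le> 1 - b - (f x - c * expectation t)"
      using nnZ by (simp add: nn_integral_eq_integral[OF iZ' Z'0] ennreal_le_iff)
    \<comment> \<open>A nonintegrable function has integral 0 by convention, so integrability is
      secured before the cost is split into its terms.\<close>
    have iX: "integrable M (\<lambda>\<omega>. X (t \<omega>) \<omega>)"
    proof -
      have "integrable M (\<lambda>\<omega>. X (t \<omega>) \<omega> - b)"
      proof (rule Bochner_Integration.integrable_bound[OF iZ'])
        show "AE \<omega> in M. norm (X (t \<omega>) \<omega> - b) \<le> norm (Z' \<omega>)"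
          using Z'_ge by eventually_elim auto
      qed simp
      then have "integrable M (\<lambda>\<omega>. (X (t \<omega>) \<omega> - b) + b)" by (intro Bochner_Integration.integrable_add) auto
      then show ?thesis by simp
    qed
    have "expectation (\<lambda>\<omega>. X (t \<omega>) \<omega> - b) \<le> expectation Z'"
    proof (rule integral_mono_AE)
      show "AE \<omega> in M. X (t \<omega>) \<omega> - b \<le> Z' \<omega>" using Z'_ge by eventually_elim simp
    qed (use iX iZ' in simp_all)
    then have "expectation (\<lambda>\<omega>. X (t \<omega>) \<omega>) - b \<le> 1 - b - (f x - c * expectation t)"
      using iX EZ' by (simp add: prob_space)
    then have "f x \<le> c * expectation t + (1 - expectation (\<lambda>\<omega>. X (t \<omega>) \<omega>))" by simp
    also have "\<dots> = (\<integral>\<omega>. c * t \<omega> + (1 - X (t \<omega>) \<omega>) \<partial>M)"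
      using t_int iX by (simp add: prob_space)
    finally show "f_cand c b x - \<delta> \<le> (\<integral>\<omega>. c * t \<omega> + (1 - X (t \<omega>) \<omega>) \<partial>M)"
      using f_ge[OF b_le_x x1] by simp
  qed
  have "f_cand c b x \<le> (\<integral>\<omega>. c * t \<omega> + (1 - X (t \<omega>) \<omega>) \<partial>M)"
  proof (rule field_le_epsilon)
    fix e :: real assume "0 < e"
    from le[OF this] show "f_cand c b x \<le> (\<integral>\<omega>. c * t \<omega> + (1 - X (t \<omega>) \<omega>) \<partial>M) + e" by linarith
  qed
  then show ?thesis unfolding expected_cost_def t_def using False by simp
qed

section \<open>The first passage time and its optimality\<close>

definition hitting_time :: "real \<Rightarrow> 'a \<Rightarrow> ennreal" where
  "hitting_time p \<omega> = (if \<exists>s\<ge>0. p \<le> X s \<omega> then ennreal (Inf {s. 0 \<le> s \<and> p \<le> X s \<omega>}) else \<infinity>)"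

text \<open>The paths are continuous, so the set of times at or above \<open>p\<close> is closed and
  contains its infimum.\<close>

lemma hitting_time_finite:
  assumes \<omega>: "\<omega> \<in> space M" and s: "0 \<le> s" "p \<le> X s \<omega>"
  obtains t where "0 \<le> t" "t \<le> s" "p \<le> X t \<omega>" "hitting_time p \<omega> = ennreal t"
proof -
  define S where "S = {s. 0 \<le> s \<and> p \<le> X s \<omega>}"
  have "closed ({0..} \<inter> (\<lambda>t. X t \<omega>) -` {p..})"
    by (intro continuous_closed_preimage X_continuous[OF \<omega>]) auto
  moreover have "S = {0..} \<inter> (\<lambda>t. X t \<omega>) -` {p..}" unfolding S_def by auto
  ultimately have cl: "closed S" by simp
  have ne: "s \<in> S" unfolding S_def using s by simp
  have bdd: "bdd_below S" unfolding S_def by (intro bdd_belowI[of _ 0]) auto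
  have "Inf S \<in> S" using ne bdd cl by (intro closed_contains_Inf) auto
  moreover have "Inf S \<le> s" using ne bdd by (rule cInf_lower)
  moreover have "hitting_time p \<omega> = ennreal (Inf S)" unfolding hitting_time_def S_def using s by auto
  ultimately show ?thesis by (intro that[of "Inf S"]) (auto simp: S_def)
qed

lemma hitting_time_le_iff:
  assumes \<omega>: "\<omega> \<in> space M" and t: "0 \<le> t"
  shows "hitting_time p \<omega> \<le> ennreal t \<longleftrightarrow> (\<exists>s\<in>{0..t}. p \<le> X s \<omega>)"
proof
  assume le: "hitting_time p \<omega> \<le> ennreal t"
  then have "\<exists>s\<ge>0. p \<le> X s \<omega>" unfolding hitting_time_def by (auto simp: top_unique split: if_splits)
  then obtain s where s: "0 \<le> s" "p \<le> X s \<omega>" by blast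
  obtain u where "0 \<le> u" "p \<le> X u \<omega>" "hitting_time p \<omega> = ennreal u"
    by (rule hitting_time_finite[OF \<omega> s])
  with le t show "\<exists>s\<in>{0..t}. p \<le> X s \<omega>" by (intro bexI[of _ u]) (auto simp: ennreal_le_iff)
next
  assume "\<exists>s\<in>{0..t}. p \<le> X s \<omega>"
  then obtain s where s: "0 \<le> s" "s \<le> t" "p \<le> X s \<omega>" by auto
  obtain u where "u \<le> s" "hitting_time p \<omega> = ennreal u"
    by (rule hitting_time_finite[OF \<omega> s(1,3)])
  with s show "hitting_time p \<omega> \<le> ennreal t" by (auto intro!: ennreal_leI)
qed

text \<open>A countable description by values of \<open>X\<close> at times up to \<open>t\<close>,
  which puts the event into the past of \<open>t\<close>. From right to left, the maximum of
  \<open>X\<close> on the compact interval is at least \<open>p - 1 / real (Suc n)\<close> for every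
  \<open>n\<close>.\<close>

lemma reaches_iff_grid:
  assumes \<omega>: "\<omega> \<in> space M" and t: "0 \<le> t"
  shows "(\<exists>s\<in>{0..t}. p \<le> X s \<omega>) \<longleftrightarrow>
    (\<forall>n. \<exists>m i. i \<le> Suc m \<and> p - 1 / real (Suc n) < X (grid t m i) \<omega>)"
proof
  assume "\<exists>s\<in>{0..t}. p \<le> X s \<omega>"
  then obtain s where s: "s \<in> {0..t}" "p \<le> X s \<omega>" by blast
  show "\<forall>n. \<exists>m i. i \<le> Suc m \<and> p - 1 / real (Suc n) < X (grid t m i) \<omega>"
  proof
    fix n
    show "\<exists>m i. i \<le> Suc m \<and> p - 1 / real (Suc n) < X (grid t m i) \<omega>"
    proof (cases "t = 0")
      case True
      then have "p - 1 / real (Suc n) < X (grid t 0 0) \<omega>" using s by (auto intro: less_le_trans[of _ p])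
      then show ?thesis by blast
    next
      case False
      then have t': "0 < t" using t by simp
      obtain j where j: "\<And>n. j n \<le> Suc n" "(\<lambda>n. grid t n (j n)) \<longlonglongrightarrow> s"
        by (rule grid_approx[OF t' s(1)], rule that)
      have "(\<lambda>n. X (grid t n (j n)) \<omega>) \<longlonglongrightarrow> X s \<omega>"
        using s t by (intro continuous_on_tendsto_compose[OF X_continuous[OF \<omega>] j(2)])
          (auto intro!: always_eventually grid_nonneg)
      moreover have "p - 1 / real (Suc n) < p" by simp
      then have "p - 1 / real (Suc n) < X s \<omega>" using s(2) by (rule less_le_trans)
      ultimately have "eventually (\<lambda>m. p - 1 / real (Suc n) < X (grid t m (j m)) \<omega>) sequentially"
        by (rule order_tendstoD(1))
      then obtain m where "p - 1 / real (Suc n) < X (grid t m (j m)) \<omega>"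
        using eventually_happens'[OF sequentially_bot] by blast
      with j(1)[of m] show ?thesis by blast
    qed
  qed
next
  assume *: "\<forall>n. \<exists>m i. i \<le> Suc m \<and> p - 1 / real (Suc n) < X (grid t m i) \<omega>"
  have "continuous_on {0..t} (\<lambda>s. X s \<omega>)" using X_continuous[OF \<omega>] by (rule continuous_on_subset) auto
  then obtain s where s: "s \<in> {0..t}" "\<And>u. u \<in> {0..t} \<Longrightarrow> X u \<omega> \<le> X s \<omega>"
    using continuous_attains_sup[of "{0..t}" "\<lambda>s. X s \<omega>"] t by auto
  have "p - 1 / real (Suc n) \<le> X s \<omega>" for n
  proof -
    obtain m i where mi: "i \<le> Suc m" "p - 1 / real (Suc n) < X (grid t m i) \<omega>" using * by blast
    have "X (grid t m i) \<omega> \<le> X s \<omega>" using mi(1) t by (intro s(2)) (auto intro: grid_nonneg grid_le)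
    with mi(2) show ?thesis by simp
  qed
  moreover have "(\<lambda>n. p - 1 / real (Suc n)) \<longlonglongrightarrow> p - 0"
    by (intro tendsto_diff tendsto_const mesh_tendsto[of 1])
  ultimately have "p - 0 \<le> X s \<omega>" by (intro LIMSEQ_le_const2[of "\<lambda>n. p - 1 / real (Suc n)"]) auto
  with s(1) show "\<exists>s\<in>{0..t}. p \<le> X s \<omega>" by auto
qed

lemma stopping_time_hitting_time: "stopping_time F (hitting_time p)"
proof (rule stopping_timeI)
  fix u :: ennreal
  show "Measurable.pred (F u) (\<lambda>\<omega>. hitting_time p \<omega> \<le> u)"
  proof (cases u)
    case top
    then show ?thesis by simp
  next
    case (real t)
    have [measurable]: "X (grid t m i) \<in> borel_measurable (F u)" if "i \<le> Suc m" for m i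
      using real that by (auto intro!: measurable_F_mono[OF ennreal_leI X_adapted] grid_nonneg grid_le)
    have "Measurable.pred (F u) (\<lambda>\<omega>. i \<le> Suc m \<and> p - 1 / real (Suc n) < X (grid t m i) \<omega>)" for n m i
      by (cases "i \<le> Suc m") simp_all
    then have "Measurable.pred (F u) (\<lambda>\<omega>. \<forall>n. \<exists>m i. i \<le> Suc m \<and> p - 1 / real (Suc n) < X (grid t m i) \<omega>)"
      by (intro pred_intros_countable)
    moreover have "(hitting_time p \<omega> \<le> u) = (\<forall>n. \<exists>m i. i \<le> Suc m \<and> p - 1 / real (Suc n) < X (grid t m i) \<omega>)"
      if "\<omega> \<in> space (F u)" for \<omega>
    proof -
      have "\<omega> \<in> space M" using that unfolding space_F .
      from hitting_time_le_iff[OF this real(1)] reaches_iff_grid[OF this real(1)] show ?thesis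
        unfolding real(2) by (rule trans)
    qed
    ultimately show ?thesis by (subst measurable_cong)
  qed
qed

text \<open>Strictly before the passage the path is below \<open>p\<close>; continuity extends this
  weakly to the passage time itself, which belongs to the half-open occupation interval.\<close>

lemma before_hitting_time:
  assumes \<omega>: "\<omega> \<in> space M" and x: "X 0 \<omega> < p" and u: "0 \<le> u" "ennreal u \<le> hitting_time p \<omega>"
  shows "X u \<omega> \<le> p"
proof (cases "u = 0")
  case False
  then have u0: "0 < u" using u by simp
  have less: "X s \<omega> < p" if s: "0 \<le> s" "s < u" for s
  proof (rule ccontr)
    assume "\<not> X s \<omega> < p"
    then have "hitting_time p \<omega> \<le> ennreal s" using s by (subst hitting_time_le_iff[OF \<omega>]) (auto intro!: bexI[of _ s])
    with u(2) have "ennreal u \<le> ennreal s" by (rule order_trans)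
    with s show False by (simp add: ennreal_le_iff)
  qed
  have "(\<lambda>n. u - u / real (Suc n)) \<longlonglongrightarrow> u - 0" by (intro tendsto_diff tendsto_const mesh_tendsto)
  then have "(\<lambda>n. u - u / real (Suc n)) \<longlonglongrightarrow> u" by simp
  moreover have s: "0 \<le> u - u / real (Suc n)" "u - u / real (Suc n) < u" for n
    using u0 by (simp_all add: field_simps)
  ultimately have "(\<lambda>n. X (u - u / real (Suc n)) \<omega>) \<longlonglongrightarrow> X u \<omega>"
    using u by (intro continuous_on_tendsto_compose[OF X_continuous[OF \<omega>]]) (auto intro!: always_eventually)
  then show ?thesis using less[OF s] by (intro LIMSEQ_le_const2) (auto intro: less_imp_le)
qed (use x in simp)

text \<open>Up to the passage the test function coincides with the candidate and its generator is
  exactly \<open>- c\<close>, so any smoothing parameter is good; it is set to 1.\<close>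

lemma cost_hitting_time:
  assumes xp: "x < pi_star c b"
  shows "expected_cost M X c (hitting_time (pi_star c b)) = ereal (f_cand c b x)"
proof (rule test_function_exists[OF c b zero_less_one])
  define p where "p = pi_star c b"
  have p: "b < p" "p < 1" unfolding p_def using pi_star[OF c b] by auto
  fix f f1 f2 :: "real \<Rightarrow> real" and K
  assume taylor: "\<And>y z. b \<le> y \<Longrightarrow> b \<le> z \<Longrightarrow>
      \<bar>f z - f y - f1 y * (z - y) - f2 y / 2 * (z - y)\<^sup>2\<bar> \<le> K * min 1 \<bar>z - y\<bar> * (z - y)\<^sup>2"
    and f1: "\<And>y. b \<le> y \<Longrightarrow> \<bar>f1 y\<bar> \<le> K * (y - b)" "\<And>y. \<bar>f1 y\<bar> \<le> K" "f1 \<in> borel_measurable borel"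
    and f2: "\<And>y. \<bar>f2 y\<bar> \<le> K" "continuous_on UNIV f2"
    and f: "\<And>y. \<bar>f y\<bar> \<le> K * (1 + \<bar>y\<bar>)" "continuous_on UNIV f"
    and f_eq: "\<And>y. b \<le> y \<Longrightarrow> y \<le> pi_star c b \<Longrightarrow> f y = f_cand c b y"
    and gen_eq: "\<And>y. b \<le> y \<Longrightarrow> y \<le> pi_star c b \<Longrightarrow> f2 y / 2 * (y * (1 - y))\<^sup>2 = - c"
    and gen: "\<And>y. b \<le> y \<Longrightarrow> - c \<le> f2 y / 2 * (y * (1 - y))\<^sup>2"
  define \<tau> where "\<tau> = hitting_time p"
  define r where "r n = stopped_at (real (Suc n)) \<tau>" for n
  have st: "stopping_time F \<tau>" unfolding \<tau>_def by (rule stopping_time_hitting_time)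
  have K0: "0 \<le> K" using f2(1)[of 0] by simp
  have r0: "0 \<le> r n \<omega>" for n \<omega> unfolding r_def by (rule stopped_at_nonneg)
  have r_le: "r n \<omega> \<le> real (Suc n)" for n \<omega> unfolding r_def by (rule stopped_at_le) simp
  have r_tau: "ennreal (r n \<omega>) \<le> \<tau> \<omega>" for n \<omega> unfolding r_def by (rule stopped_at_le_tau)
  have [measurable]: "r n \<in> borel_measurable M" for n unfolding r_def by (rule stopped_at_measurable(2)[OF st])
  have r_int: "integrable M (r n)" for n
    using r0 r_le by (intro integrable_const_bound[of _ "real (Suc n)"]) auto
  have low: "AE \<omega> in M. \<forall>u. 0 \<le> u \<and> ennreal u \<le> \<tau> \<omega> \<longrightarrow> b \<le> X u \<omega> \<and> X u \<omega> \<le> p"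
    using AE_good_path AE_space
  proof eventually_elim
    case (elim \<omega>)
    have "X 0 \<omega> < p" using good_pathD(1)[OF elim(1)] xp by (simp add: p_def)
    then show ?case using before_hitting_time[OF elim(2)] good_path_ge[OF elim(1)] by (simp add: \<tau>_def)
  qed
  have "AE \<omega> in M. \<forall>u. 0 < u \<and> u \<le> r n \<omega> \<longrightarrow> X u \<omega> \<le> p" for n
    using low
  proof eventually_elim
    case (elim \<omega>)
    show ?case using elim r_tau[of n \<omega>] by (meson ennreal_leI less_imp_le order_trans)
  qed
  then have sf: "integrable M (\<lambda>\<omega>. f (X (r n \<omega>) \<omega>))"
      "expectation (\<lambda>\<omega>. f (X (r n \<omega>) \<omega>)) = f x - c * expectation (r n)" for n
  proof -
    have T: "0 < real (Suc n)" by simp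
    note t = stopped_test_function[OF T st taylor f1 f2 f gen]
    show "integrable M (\<lambda>\<omega>. f (X (r n \<omega>) \<omega>))" unfolding r_def by (rule t(1))
    assume low': "\<And>n. AE \<omega> in M. \<forall>u. 0 < u \<and> u \<le> r n \<omega> \<longrightarrow> X u \<omega> \<le> p"
    show "expectation (\<lambda>\<omega>. f (X (r n \<omega>) \<omega>)) = f x - c * expectation (r n)"
      unfolding r_def
      by (rule stopped_test_function(3)[OF T st taylor f1 f2 f gen low'[of n, unfolded r_def] gen_eq[folded p_def]])
  qed
  have f_bound: "\<bar>f y\<bar> \<le> 2 * K" if "b \<le> y" "y \<le> p" for y
  proof -
    have "K * (1 + \<bar>y\<bar>) \<le> K * 2" using K0 that b p by (intro mult_left_mono) auto
    then show ?thesis using f(1)[of y] by linarith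
  qed
  have fr: "AE \<omega> in M. norm (f (X (r n \<omega>) \<omega>)) \<le> 2 * K" for n
    using low by eventually_elim (use r0 r_tau f_bound in auto)
  \<comment> \<open>The martingale identity expresses \<open>c\<close> times the mean of
    \<open>r n\<close> as \<open>f x\<close> minus the mean of a bounded quantity. The bound is free
    of \<open>n\<close>, which gives the passage time a finite mean.\<close>
  have r_mean: "expectation (r n) \<le> (\<bar>f x\<bar> + 2 * K) / c" for n
  proof -
    have "- (2 * K) \<le> expectation (\<lambda>\<omega>. f (X (r n \<omega>) \<omega>))"
    proof -
      have "expectation (\<lambda>\<omega>. - (2 * K)) \<le> expectation (\<lambda>\<omega>. f (X (r n \<omega>) \<omega>))"
        using fr[of n] sf(1)[of n] by (intro integral_mono_AE) (auto elim!: eventually_mono)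
      then show ?thesis by (simp add: prob_space)
    qed
    then have "c * expectation (r n) \<le> \<bar>f x\<bar> + 2 * K" using sf(2)[of n] by linarith
    then show ?thesis using c by (simp add: field_simps)
  qed
  have tau_m [measurable]: "\<tau> \<in> borel_measurable M" by (rule stopped_at_measurable(1)[OF st])
  have fin: "(\<integral>\<^sup>+\<omega>. \<tau> \<omega> \<partial>M) \<noteq> \<infinity>"
  proof -
    have lim: "(\<lambda>n. ennreal (r n \<omega>)) \<longlonglongrightarrow> \<tau> \<omega>" for \<omega>
    proof (cases "\<tau> \<omega> = \<infinity>")
      case True
      have "ennreal (r n \<omega>) = of_nat (Suc n)" for n
        unfolding r_def ennreal_stopped_at using True by (simp add: ennreal_of_nat_eq_real_of_nat del: of_nat_Suc)
      then show ?thesis using True LIMSEQ_Suc[OF of_nat_tendsto_top_ennreal] by simp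
    next
      case False
      have "eventually (\<lambda>n. ennreal (r n \<omega>) = \<tau> \<omega>) sequentially"
        using stopped_at_eq[of \<tau> \<omega>, OF False] by eventually_elim (use False in \<open>simp add: r_def less_top\<close>)
      then show ?thesis by (rule tendsto_eventually)
    qed
    have "(\<integral>\<^sup>+\<omega>. \<tau> \<omega> \<partial>M) = (\<integral>\<^sup>+\<omega>. liminf (\<lambda>n. ennreal (r n \<omega>)) \<partial>M)"
      using lim_imp_Liminf[OF _ lim] by simp
    also have "\<dots> \<le> liminf (\<lambda>n. \<integral>\<^sup>+\<omega>. ennreal (r n \<omega>) \<partial>M)" by (rule nn_integral_liminf) simp
    also have "\<dots> \<le> liminf (\<lambda>n :: nat. ennreal ((\<bar>f x\<bar> + 2 * K) / c))"
      using r_mean r0 by (intro Liminf_mono always_eventually allI) (simp add: nn_integral_eq_integral[OF r_int] ennreal_leI)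
    also have "\<dots> = ennreal ((\<bar>f x\<bar> + 2 * K) / c)" by (rule Liminf_const) simp
    finally show ?thesis by (auto simp: top_unique)
  qed
  note fm = finite_mean[OF st fin]
  define t where "t \<omega> = enn2real (\<tau> \<omega>)" for \<omega>
  have t_int: "integrable M t" unfolding t_def[abs_def] by (rule fm(2))
  \<comment> \<open>A finite passage is attained with \<open>X \<ge> p\<close>, and
    \<open>low\<close> gives \<open>X \<le> p\<close> up to and including that time.\<close>
  have Xt: "AE \<omega> in M. X (t \<omega>) \<omega> = p"
    using fm(1) low AE_space
  proof eventually_elim
    case (elim \<omega>)
    have "\<exists>s\<ge>0. p \<le> X s \<omega>" using elim(1) unfolding \<tau>_def hitting_time_def by (auto split: if_splits)
    then obtain s where s: "0 \<le> s" "p \<le> X s \<omega>" by blast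
    obtain u where "0 \<le> u" "p \<le> X u \<omega>" "hitting_time p \<omega> = ennreal u"
      by (rule hitting_time_finite[OF elim(3) s])
    moreover from this have "t \<omega> = u" by (simp add: t_def \<tau>_def)
    ultimately show ?case using elim(2) by (auto simp: \<tau>_def intro!: antisym)
  qed
  have Xt_m: "(\<lambda>\<omega>. X (t \<omega>) \<omega>) \<in> borel_measurable M"
    using t_int by (intro X_at_measurable) (auto simp: t_def)
  have ev: "AE \<omega> in M. eventually (\<lambda>n. r n \<omega> = t \<omega>) sequentially"
    unfolding r_def t_def using fm(1) by eventually_elim (rule stopped_at_eq)
  have "(\<lambda>n. expectation (r n)) \<longlonglongrightarrow> expectation t"
  proof (rule integral_dominated_convergence[where w=t])
    show "AE \<omega> in M. (\<lambda>n. r n \<omega>) \<longlonglongrightarrow> t \<omega>" using ev by eventually_elim (rule tendsto_eventually)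
    show "AE \<omega> in M. norm (r n \<omega>) \<le> t \<omega>" for n
      using fm(3) by eventually_elim (use r0 in \<open>auto simp: r_def t_def\<close>)
  qed (use t_int in auto)
  then have lim1: "(\<lambda>n. f x - c * expectation (r n)) \<longlonglongrightarrow> f x - c * expectation t"
    by (intro tendsto_intros)
  have "(\<lambda>n. expectation (\<lambda>\<omega>. f (X (r n \<omega>) \<omega>))) \<longlonglongrightarrow> expectation (\<lambda>\<omega>. f p)"
  proof (rule integral_dominated_convergence[where w="\<lambda>_. 2 * K"])
    show "AE \<omega> in M. (\<lambda>n. f (X (r n \<omega>) \<omega>)) \<longlonglongrightarrow> f p"
      using ev Xt
    proof eventually_elim
      case (elim \<omega>)
      from elim(1) have "eventually (\<lambda>n. f (X (r n \<omega>) \<omega>) = f p) sequentially"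
        by eventually_elim (simp add: elim(2))
      then show ?case by (rule tendsto_eventually)
    qed
  qed (use sf(1) fr in auto)
  then have "(\<lambda>n. f x - c * expectation (r n)) \<longlonglongrightarrow> f p" unfolding sf(2) by (simp add: prob_space)
  with lim1 have eq: "f x - c * expectation t = f p" by (rule LIMSEQ_unique)
  have "(\<integral>\<omega>. c * t \<omega> + (1 - X (t \<omega>) \<omega>) \<partial>M) = (\<integral>\<omega>. c * t \<omega> + (1 - p) \<partial>M)"
    using Xt t_int Xt_m by (intro integral_cong_AE) (auto elim!: eventually_mono)
  also have "\<dots> = c * expectation t + (1 - p)" using t_int by (simp add: prob_space)
  also have "\<dots> = f x" using eq f_eq[of p] p f_cand_ge[of c b p] by (simp add: p_def)
  also have "\<dots> = f_cand c b x" using f_eq b_le_x xp by simp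
  finally show "expected_cost M X c (hitting_time (pi_star c b)) = ereal (f_cand c b x)"
    using fin unfolding expected_cost_def t_def \<tau>_def p_def by simp
qed

lemma cost_zero: "expected_cost M X c (\<lambda>_. 0) = ereal (1 - x)"
proof -
  have "(\<integral>\<omega>. 1 - X 0 \<omega> \<partial>M) = (\<integral>\<omega>. 1 - x \<partial>M)"
    using X_0 X_measurable[of 0] by (intro integral_cong_AE) (auto elim!: eventually_mono)
  then show ?thesis unfolding expected_cost_def by (simp add: prob_space)
qed

text \<open>At or above \<open>pi_star\<close> the bound is attained by stopping at once, since the
  candidate is the cost \<open>1 - x\<close> of the time 0; below it, by the passage time.\<close>

theorem value_eq: "(INF \<tau>\<in>{\<tau>. stopping_time F \<tau>}. expected_cost M X c \<tau>) = ereal (f_cand c b x)"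
proof (rule antisym)
  show "ereal (f_cand c b x) \<le> (INF \<tau>\<in>{\<tau>. stopping_time F \<tau>}. expected_cost M X c \<tau>)"
    by (intro INF_greatest cost_ge) simp
  show "(INF \<tau>\<in>{\<tau>. stopping_time F \<tau>}. expected_cost M X c \<tau>) \<le> ereal (f_cand c b x)"
  proof (cases "x < pi_star c b")
    case True
    show ?thesis
      by (rule INF_lower2[of "hitting_time (pi_star c b)"])
        (simp_all add: stopping_time_hitting_time cost_hitting_time[OF True])
  next
    case False
    then have "f_cand c b x = 1 - x" by (simp add: f_cand_ge)
    then show ?thesis
      by (intro INF_lower2[of "\<lambda>_. 0"]) (simp_all add: stopping_time_const cost_zero)
  qed
qed

end

text \<open>The first two conjuncts establish what the definitions presuppose: that
  \<open>deriv\<close> is a genuine derivative with the displayed formula, and that the description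
  in \<open>pi_star\<close> denotes a unique point.\<close>

theorem lemma5p2:
  fixes P :: "real \<Rightarrow> 'a measure"
    and W X A :: "real \<Rightarrow> 'a \<Rightarrow> real"
    and c pihat :: real
  assumes "c > 0"
    and "pihat \<in> {0<..<1}"
    and "\<And>x. x \<in> {pihat..1} \<Longrightarrow> reflecting_diffusion (P x) W pihat X A x"
  shows "(\<forall>x\<in>{0<..<1}. (Psi c has_real_derivative
            2 * c * ((2 * x - 2 * (x - 1) * x * ln (x / (1 - x)) - 1) / ((x - 1) * x))) (at x))
    \<and> (\<exists>!p. p \<in> {pihat<..<1} \<and> deriv (Psi c) p + A_bar c pihat = -1)
    \<and> (\<forall>x\<in>{pihat..1}. reflected_value P W X c x = ereal (f_cand c pihat x))"
proof (intro conjI ballI)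
  show "(Psi c has_real_derivative
            2 * c * ((2 * x - 2 * (x - 1) * x * ln (x / (1 - x)) - 1) / ((x - 1) * x))) (at x)"
    if "x \<in> {0<..<1}" for x
    by (rule Psi_deriv[unfolded dPsi_def]) (use that in auto)
  show "\<exists>!p. p \<in> {pihat<..<1} \<and> deriv (Psi c) p + A_bar c pihat = -1"
    using assms(1,2) by (intro pi_star_ex1) auto
  show "reflected_value P W X c x = ereal (f_cand c pihat x)" if x: "x \<in> {pihat..1}" for x
  proof -
    interpret reflected_process "P x" "generated_filtration (P x) W" W "\<lambda>s \<omega>. X s \<omega> * (1 - X s \<omega>)"
      "\<lambda>t \<omega>. X t \<omega> - X 0 \<omega> - A t \<omega>" X A pihat x
      using x by (intro reflected_process_diffusion assms(3)) auto
    interpret reflecting_stopping "P x" "generated_filtration (P x) W" W X A pihat x c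
      by unfold_locales (use assms(1,2) x in auto)
    show ?thesis unfolding reflected_value_def by (rule value_eq)
  qed
qed

end
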